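(* Let $n\ge2$ and let $\mathcal U_B\subset\mathbb C^n$ be a nontrivial monomial polyhedron. Let $q_*$ be the Hölder conjugate of $p_*$. For each $p\in(p_*,q_* )$, both $P^+_{\mathcal U_B}$ and $P_{\mathcal U_B}$ are of strong type $(p,p)$, i.e. bounded on $L^p(\mathcal U_B)$.
   Context: Monomial polyhedron: for an integer matrix $B\in\mathbb Z^{n\times n}$ with entry $b^j_k$ in row $j$, column $k$, set $\mathcal U_B=\{z\in\mathbb C^n:\ \prod_{k=1}^n|z_k|^{b^j_k}<1\text{ for }1\le j\le n\}$ (a point is in the set only if all the powers are defined; $0^0=1$). It is called a monomial polyhedron if it is a bounded domain (connected open set) in $\mathbb C^n$, $n\ge2$. It is nontrivial if it is not the unit polydisc $\mathbb D^n$. The rows of $B$ are ordered so that $\det B>0$ (permuting rows does not change $\mathcal U_B$). Let $\Delta=\operatorname{adj}B=(\det B)B^{-1}$ (an integer matrix with nonnegative entries and nonzero determinant), with columns $\delta_1,\dots,\delta_n$, and let $a_j=\delta_j/\gcd(\delta_j)$, where $\gcd(\delta_j)$ is the gcd of the entries of $\delta_j$. Let $\mathbf 1=(1,\dots,1)\in\mathbb Z^{1\times n}$, so $\mathbf 1a_j$ is the sum of the entries of $a_j$, and let $p_*=\max_j\frac{2\,\mathbf 1a_j}{\mathbf 1a_j+1}$. For a domain $\Omega\subset\mathbb C^n$ with Bergman kernel $K_\Omega$ (the reproducing kernel of the space of square-integrable holomorphic functions on $\Omega$), $P_\Omega f(z)=\int_\Omega K_\Omega(z,\zeta)f(\zeta)\,dV(\zeta)$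 is the Bergman projection and $P^+_\Omega f(z)=\int_\Omega|K_\Omega(z,\zeta)|f(\zeta)\,dV(\zeta)$ is the positive Bergman operator, whenever the integrals converge. *)

theory Defs
  imports "HOL-Analysis.Analysis"
begin

section \<open>Monomial polyhedra\<close>

text \<open>The first conjunct says that all powers are defined; it is needed because in HOL
  \<open>0 powi m = 0\<close> for negative \<open>m\<close>. Note \<open>0 powi 0 = 1\<close>.\<close>

definition monomial_set :: "int ^ 'n ^ 'n \<Rightarrow> (complex ^ 'n::finite) set" where
  "monomial_set B =
     {z. (\<forall>j k. z $ k = 0 \<longrightarrow> 0 \<le> B $ j $ k) \<and>
         (\<forall>j. (\<Prod>k\<in>UNIV. norm (z $ k) powi (B $ j $ k)) < 1)}"

definition monomial_polyhedron :: "int ^ 'n ^ 'n::finite \<Rightarrow> bool" where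
  "monomial_polyhedron B \<longleftrightarrow>
     open (monomial_set B) \<and> connected (monomial_set B) \<and> monomial_set B \<noteq> {} \<and>
     bounded (monomial_set B)"

definition unit_polydisc :: "(complex ^ 'n::finite) set" where
  "unit_polydisc = {z. \<forall>k. norm (z $ k) < 1}"

text \<open>The \<open>(i, j)\<close> entry of the adjugate is the cofactor of \<open>A\<close> at \<open>(j, i)\<close>, written as the
  determinant of \<open>A\<close> with its \<open>j\<close>-th row replaced by the \<open>i\<close>-th unit vector.\<close>

definition adjugate :: "'a::comm_ring_1 ^ 'n ^ 'n \<Rightarrow> 'a ^ 'n ^ 'n::finite" where
  "adjugate A = (\<chi> i j. det (\<chi> k. if k = j then axis i 1 else A $ k))"

lemma matrix_mult_adjugate:
  fixes A :: "'a::comm_ring_1 ^ 'n ^ 'n::finite"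
  shows "A ** adjugate A = mat (det A)"
proof -
  have "(\<Sum>k\<in>UNIV. A $ i $ k * det (\<chi> l. if l = j then axis k 1 else A $ l))
          = (if i = j then det A else 0)" for i j
  proof -
    have "(\<Sum>k\<in>UNIV. A $ i $ k * det (\<chi> l. if l = j then axis k 1 else A $ l))
        = (\<Sum>k\<in>UNIV. det (\<chi> l. if l = j then A $ i $ k *s axis k 1 else A $ l))"
      by (simp add: det_row_mul)
    also have "\<dots> = det (\<chi> l. if l = j then (\<Sum>k\<in>UNIV. A $ i $ k *s axis k 1) else A $ l)"
      by (rule det_linear_row_sum[symmetric]) simp
    also have "(\<Sum>k\<in>UNIV. A $ i $ k *s axis k 1) = A $ i"
      by (rule basis_expansion)
    also have "det (\<chi> l. if l = j then A $ i else A $ l) = (if i = j then det A else 0)"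
    proof (cases "i = j")
      case True
      then have "(\<chi> l. if l = j then A $ i else A $ l) = A"
        by (simp add: vec_eq_iff)
      with True show ?thesis by simp
    next
      case False
      then show ?thesis
        by (auto intro!: det_identical_rows[of i j] simp: row_def)
    qed
    finally show ?thesis .
  qed
  then show ?thesis
    by (simp add: matrix_matrix_mult_def adjugate_def mat_def vec_eq_iff)
qed

text \<open>The vector \<open>a\<^sub>j\<close>: the \<open>j\<close>-th column of \<open>adj B\<close> divided by the gcd of its entries.\<close>

definition reduced_column :: "int ^ 'n ^ 'n \<Rightarrow> 'n::finite \<Rightarrow> int ^ 'n" where
  "reduced_column B j =
     (let \<delta> = column j (adjugate B) in \<chi> i. \<delta> $ i div Gcd (range (\<lambda>k. \<delta> $ k)))"

definition entry_sum :: "int ^ 'n::finite \<Rightarrow> int" where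
  "entry_sum a = (\<Sum>i\<in>UNIV. a $ i)"

definition p_star :: "int ^ 'n ^ 'n::finite \<Rightarrow> real" where
  "p_star B = Max (range (\<lambda>j. 2 * real_of_int (entry_sum (reduced_column B j))
                                / (real_of_int (entry_sum (reduced_column B j)) + 1)))"

text \<open>Only meaningful for exponents greater than \<open>1\<close> (the conjugate of \<open>1\<close> is not a real).\<close>

definition hoelder_conjugate :: "real \<Rightarrow> real" where
  "hoelder_conjugate p = p / (p - 1)"


section \<open>Bergman spaces and the Bergman kernel\<close>

text \<open>Holomorphy in several variables: Frechet differentiability with complex linear derivative.\<close>

definition holomorphic_sv :: "(complex ^ 'n::finite) set \<Rightarrow> (complex ^ 'n \<Rightarrow> complex) \<Rightarrow> bool" where
  "holomorphic_sv \<Omega> f \<longleftrightarrow>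
     (\<forall>z\<in>\<Omega>. \<exists>L. (f has_derivative L) (at z) \<and> (\<forall>c v. L (c *s v) = c * L v))"

definition bergman_space :: "(complex ^ 'n::finite) set \<Rightarrow> (complex ^ 'n \<Rightarrow> complex) set" where
  "bergman_space \<Omega> =
     {f. holomorphic_sv \<Omega> f \<and> integrable (lebesgue_on \<Omega>) (\<lambda>z. (norm (f z))\<^sup>2)}"

text \<open>Functions are total in HOL; the last condition fixes the irrelevant values outside
  \<open>\<Omega> \<times> \<Omega>\<close>, so that the kernel is unique.\<close>

definition is_bergman_kernel ::
    "(complex ^ 'n::finite) set \<Rightarrow> (complex ^ 'n \<Rightarrow> complex ^ 'n \<Rightarrow> complex) \<Rightarrow> bool" where
  "is_bergman_kernel \<Omega> K \<longleftrightarrow>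
     (\<forall>w\<in>\<Omega>. (\<lambda>z. K z w) \<in> bergman_space \<Omega>) \<and>
     (\<forall>f\<in>bergman_space \<Omega>. \<forall>z\<in>\<Omega>. f z = (LINT \<zeta>|lebesgue_on \<Omega>. f \<zeta> * cnj (K \<zeta> z))) \<and>
     (\<forall>z w. z \<notin> \<Omega> \<or> w \<notin> \<Omega> \<longrightarrow> K z w = 0)"

lemma is_bergman_kernel_unique:
  assumes K: "is_bergman_kernel \<Omega> K" and K': "is_bergman_kernel \<Omega> K'"
  shows "K = K'"
proof (intro ext)
  fix z w
  have *: "M z w = cnj (N w z)"
    if M: "is_bergman_kernel \<Omega> M" and N: "is_bergman_kernel \<Omega> N" and zw: "z \<in> \<Omega>" "w \<in> \<Omega>"
    for M N and z w
  proof -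
    have mem: "(\<lambda>x. M x w) \<in> bergman_space \<Omega>" "(\<lambda>x. N x z) \<in> bergman_space \<Omega>"
      and rep: "\<And>f x. f \<in> bergman_space \<Omega> \<Longrightarrow> x \<in> \<Omega> \<Longrightarrow>
                  f x = (LINT \<zeta>|lebesgue_on \<Omega>. f \<zeta> * cnj (M \<zeta> x))"
              "\<And>f x. f \<in> bergman_space \<Omega> \<Longrightarrow> x \<in> \<Omega> \<Longrightarrow>
                  f x = (LINT \<zeta>|lebesgue_on \<Omega>. f \<zeta> * cnj (N \<zeta> x))"
      using M N zw unfolding is_bergman_kernel_def by auto
    have "M z w = (LINT \<zeta>|lebesgue_on \<Omega>. M \<zeta> w * cnj (N \<zeta> z))"
      by (rule rep(2)[OF mem(1) zw(1)])
    also have "\<dots> = cnj (LINT \<zeta>|lebesgue_on \<Omega>. N \<zeta> z * cnj (M \<zeta> w))"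
      by (subst Bochner_Integration.integral_cnj[symmetric]) (simp add: mult.commute)
    also have "(LINT \<zeta>|lebesgue_on \<Omega>. N \<zeta> z * cnj (M \<zeta> w)) = N w z"
      by (rule rep(1)[OF mem(2) zw(2), symmetric])
    finally show ?thesis .
  qed
  show "K z w = K' z w"
  proof (cases "z \<in> \<Omega> \<and> w \<in> \<Omega>")
    case True
    then show ?thesis
      using *[OF K K', of z w] *[OF K' K', of z w] by simp
  next
    case False
    then show ?thesis
      using K K' unfolding is_bergman_kernel_def by metis
  qed
qed

definition bergman_kernel ::
    "(complex ^ 'n::finite) set \<Rightarrow> complex ^ 'n \<Rightarrow> complex ^ 'n \<Rightarrow> complex" where
  "bergman_kernel \<Omega> = (THE K. is_bergman_kernel \<Omega> K)"


section \<open>The Bergman operators and strong type estimates\<close>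

text \<open>\<open>None\<close> marks the points at which the defining integral does not converge (absolutely).\<close>

definition integral_operator ::
    "'a::euclidean_space set \<Rightarrow> ('a \<Rightarrow> 'a \<Rightarrow> complex) \<Rightarrow> ('a \<Rightarrow> complex) \<Rightarrow> 'a \<Rightarrow> complex option" where
  "integral_operator \<Omega> k f z =
     (if integrable (lebesgue_on \<Omega>) (\<lambda>\<zeta>. k z \<zeta> * f \<zeta>)
      then Some (LINT \<zeta>|lebesgue_on \<Omega>. k z \<zeta> * f \<zeta>) else None)"

definition bergman_projection ::
    "(complex ^ 'n::finite) set \<Rightarrow> (complex ^ 'n \<Rightarrow> complex) \<Rightarrow> complex ^ 'n \<Rightarrow> complex option" where
  "bergman_projection \<Omega> = integral_operator \<Omega> (bergman_kernel \<Omega>)"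

definition positive_bergman_operator ::
    "(complex ^ 'n::finite) set \<Rightarrow> (complex ^ 'n \<Rightarrow> complex) \<Rightarrow> complex ^ 'n \<Rightarrow> complex option" where
  "positive_bergman_operator \<Omega> =
     integral_operator \<Omega> (\<lambda>z \<zeta>. complex_of_real (norm (bergman_kernel \<Omega> z \<zeta>)))"

definition Lp :: "real \<Rightarrow> 'a::euclidean_space set \<Rightarrow> ('a \<Rightarrow> complex) set" where
  "Lp p \<Omega> = {f \<in> borel_measurable (lebesgue_on \<Omega>).
               integrable (lebesgue_on \<Omega>) (\<lambda>z. norm (f z) powr p)}"

definition Lp_norm :: "real \<Rightarrow> 'a::euclidean_space set \<Rightarrow> ('a \<Rightarrow> complex) \<Rightarrow> real" where
  "Lp_norm p \<Omega> f = (LINT z|lebesgue_on \<Omega>. norm (f z) powr p) powr (1 / p)"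

definition strong_type ::
    "real \<Rightarrow> 'a::euclidean_space set \<Rightarrow> (('a \<Rightarrow> complex) \<Rightarrow> 'a \<Rightarrow> complex option) \<Rightarrow> bool" where
  "strong_type p \<Omega> T \<longleftrightarrow>
     (\<exists>C. \<forall>f\<in>Lp p \<Omega>. \<exists>g\<in>Lp p \<Omega>.
        (AE z in lebesgue_on \<Omega>. T f z = Some (g z)) \<and> Lp_norm p \<Omega> g \<le> C * Lp_norm p \<Omega> f)"

end

theory Submission
  imports Defs "HOL-Complex_Analysis.Conformal_Mappings"
begin

text \<open>Write \<open>U\<close> for the monomial polyhedron, \<open>D\<close> for the unit polydisc and call a point regular if none of its
coordinates vanishes. Since \<open>U\<close> is bounded, the adjugate of \<open>B\<close> has nonnegative entries, and the reduced
columns \<open>a\<^sub>j\<close> define a monomial map \<open>Phi\<close> with \<open>Phi(z)\<^sub>k = \<Prod>\<^sub>j z\<^sub>j ^ (a\<^sub>j)\<^sub>k\<close>. The matrix \<open>B A\<close> is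
diagonal with positive entries, so \<open>Phi\<close> maps the regular points of \<open>D\<close> onto those of \<open>U\<close>. It is a
homomorphism of the group of regular points with a finite kernel, the deck group, which consists of
vectors of roots of unity. Its Jacobian is a constant times the monomial \<open>J(z) = \<Prod>\<^sub>j z\<^sub>j ^ (s\<^sub>j - 1)\<close>,
where \<open>s\<^sub>j\<close> is the entry sum of \<open>a\<^sub>j\<close>.

The argument moves everything to \<open>D\<close> along \<open>Phi\<close>.

\<^item> Change of variables: a homomorphism of groups maps an invariant measure to a multiple of
  it. Applied to the measure \<open>dV / \<Prod> |z\<^sub>k|\<^sup>2\<close>, this gives the transformation formula for \<open>Phi\<close> up to a
  constant (\<open>cover_haar\<close>, \<open>integral_cover\<close>), with no determinant and no count of the sheets.

\<^item> The kernel: point evaluations on the Bergman space of an open set are bounded and the space is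
  complete, so the kernel exists (\<open>bergman_kernel_is_kernel\<close>). Square integrable holomorphic functions
  extend across coordinate hyperplanes (\<open>bergman_removable\<close>), hence pulling back along \<open>Phi\<close> and multiplying
  by \<open>J\<close> leads into the Bergman space of \<open>D\<close>. Averaging the reproducing formula of \<open>D\<close> over the deck group
  then identifies the kernel at regular points (\<open>bergman_kernel_formula\<close>); this is Bell's transformation
  formula.

\<^item> The estimate: by that formula the absolute integrals on \<open>U\<close> are dominated by those of the positive
  kernel of \<open>D\<close>, after multiplication by \<open>|J|\<close>. Boundedness on \<open>L\<^sup>p(U)\<close> thus follows from boundedness of that
  positive operator on \<open>L\<^sup>p(D, |J| powr (2 - p))\<close>. Kernel and weight are products over the
  coordinates, so Schur's test with a product weight reduces the claim to a Forelli--Rudin estimate in the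
  unit disc (\<open>disc_kernel_integral_bound\<close>), and the test functions are available when
  \<open>2 s\<^sub>j / (s\<^sub>j + 1) < p < 2 s\<^sub>j / (s\<^sub>j - 1)\<close> for all \<open>j\<close> (the upper bound being void for \<open>s\<^sub>j = 1\<close>), which is the
  range between \<open>p_star B\<close> and its conjugate.\<close>

section \<open>Lebesgue measure on complex vectors\<close>

lemma borel_measurable_vec_nth [measurable]:
  "(\<lambda>x::'a::euclidean_space ^ 'n. x $ k) \<in> borel_measurable borel"
  by (intro borel_measurable_continuous_onI continuous_intros)

lemma borel_measurable_vec_lambda [measurable (raw)]:
  fixes f :: "'n::finite \<Rightarrow> 'b \<Rightarrow> 'a::euclidean_space"
  assumes "\<And>k. f k \<in> borel_measurable M"
  shows "(\<lambda>x. \<chi> k. f k x) \<in> borel_measurable M"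
  unfolding borel_measurable_euclidean_space[where 'c="'a^'n"]
proof
  fix b :: "'a^'n" assume "b \<in> Basis"
  then obtain k u where b: "b = axis k u" by (auto simp: Basis_vec_def)
  have "(\<lambda>x. f k x \<bullet> u) \<in> borel_measurable M" using assms by measurable
  then show "(\<lambda>x. (\<chi> k. f k x) \<bullet> b) \<in> borel_measurable M"
    by (simp add: b inner_axis)
qed

interpretation lborel_product: product_sigma_finite "\<lambda>_::'n. lborel :: 'a::euclidean_space measure"
  ..

lemma box_vec_eq: "x \<in> box l u \<longleftrightarrow> (\<forall>k. x $ k \<in> box (l $ k) (u $ k))"
  for x :: "'a::euclidean_space ^ 'n"
  unfolding mem_box Basis_vec_def by (auto simp: inner_axis)

text \<open>Identifying Lebesgue measure on vectors with a product measure is what makes iterated integration over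
the coordinates available; the two measures agree on boxes.\<close>

lemma lborel_vec_eq_distr:
  "(lborel :: ('a::euclidean_space ^ 'n) measure)
     = distr (\<Pi>\<^sub>M k\<in>(UNIV::'n set). (lborel :: 'a measure)) borel (\<lambda>f. \<chi> k. f k)"
proof (rule lborel_eqI)
  fix l u :: "'a ^ 'n"
  assume le: "\<And>b. b \<in> Basis \<Longrightarrow> l \<bullet> b \<le> u \<bullet> b"
  have meas: "(\<lambda>f. \<chi> k. f k) \<in> borel_measurable (\<Pi>\<^sub>M k\<in>(UNIV::'n set). (lborel :: 'a measure))"
    by measurable
  have le': "l $ k \<bullet> b \<le> u $ k \<bullet> b" if "b \<in> Basis" for k b
    using le[of "axis k b"] that by (auto simp: Basis_vec_def inner_axis)
  have "emeasure (distr (\<Pi>\<^sub>M k\<in>(UNIV::'n set). (lborel :: 'a measure)) borel (\<lambda>f. \<chi> k. f k)) (box l u)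
      = emeasure (\<Pi>\<^sub>M k\<in>(UNIV::'n set). (lborel :: 'a measure)) (PiE UNIV (\<lambda>k. box (l $ k) (u $ k)))"
    by (subst emeasure_distr[OF meas]) (auto simp: box_vec_eq space_PiM PiE_iff intro!: arg_cong2[where f=emeasure])
  also have "\<dots> = (\<Prod>k\<in>UNIV. emeasure lborel (box (l $ k) (u $ k)))"
    by (rule lborel_product.emeasure_PiM) auto
  also have "\<dots> = (\<Prod>k\<in>UNIV. ennreal (\<Prod>b\<in>Basis. (u $ k - l $ k) \<bullet> b))"
    using le' by (intro prod.cong refl emeasure_lborel_box) auto
  also have "\<dots> = ennreal (\<Prod>k\<in>UNIV. \<Prod>b\<in>Basis. (u $ k - l $ k) \<bullet> b)"
    using le' by (intro prod_ennreal prod_nonneg) (auto simp: inner_diff_left)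
  also have "(\<Prod>k\<in>UNIV. \<Prod>b\<in>Basis. (u $ k - l $ k) \<bullet> b) = (\<Prod>b\<in>Basis. (u - l) \<bullet> b)"
  proof -
    have "(\<Prod>b\<in>Basis. (u - l) \<bullet> b) = (\<Prod>b\<in>(\<lambda>(k, b). axis k b) ` (UNIV \<times> Basis). (u - l) \<bullet> b)"
      by (rule prod.cong) (auto simp: Basis_vec_def)
    also have "\<dots> = (\<Prod>(k, b)\<in>UNIV \<times> Basis. (u - l) \<bullet> axis k b)"
      by (subst prod.reindex)
         (auto simp: inj_on_def axis_eq_axis case_prod_unfold nonzero_Basis)
    also have "\<dots> = (\<Prod>k\<in>UNIV. \<Prod>b\<in>Basis. (u $ k - l $ k) \<bullet> b)"
      by (subst prod.cartesian_product[symmetric]) (simp add: inner_axis)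
    finally show ?thesis by simp
  qed
  finally show "emeasure (distr (\<Pi>\<^sub>M k\<in>(UNIV::'n set). (lborel :: 'a measure)) borel (\<lambda>f. \<chi> k. f k)) (box l u)
     = ennreal (\<Prod>b\<in>Basis. (u - l) \<bullet> b)" .
qed simp

lemma nn_integral_vec_prod:
  fixes f :: "'n::finite \<Rightarrow> 'a::euclidean_space \<Rightarrow> ennreal"
  assumes [measurable]: "\<And>k. f k \<in> borel_measurable borel"
  shows "(\<integral>\<^sup>+z. (\<Prod>k\<in>UNIV. f k (z $ k)) \<partial>lborel) = (\<Prod>k\<in>UNIV. \<integral>\<^sup>+w. f k w \<partial>lborel)"
proof -
  have "(\<integral>\<^sup>+z. (\<Prod>k\<in>UNIV. f k (z $ k)) \<partial>lborel)
      = (\<integral>\<^sup>+x. (\<Prod>k\<in>UNIV. f k (x k)) \<partial>(\<Pi>\<^sub>M k\<in>(UNIV::'n set). (lborel :: 'a measure)))"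
    by (subst lborel_vec_eq_distr, subst nn_integral_distr) (auto)
  also have "\<dots> = (\<Prod>k\<in>UNIV. \<integral>\<^sup>+w. f k w \<partial>lborel)"
    by (rule lborel_product.product_nn_integral_prod) auto
  finally show ?thesis .
qed

section \<open>Push-forwards of invariant measures\<close>

text \<open>The classical proof that invariant measures are unique up to a factor, arranged for push-forwards: compute
the double integral of \<open>f(\<phi> x) g(y)\<close> by translating \<open>y\<close> by the inverse of \<open>\<phi> x\<close>, exchanging the
integrals, translating \<open>x\<close> by a preimage of \<open>y\<close>, and exchanging them back. Only one measure occurs, so no
finiteness of the image measure has to be known. The set \<open>X\<close> carries the group; it need only have full
measure.\<close>

lemma invariant_measure_pushforward:
  fixes M :: "'a::second_countable_topology measure" and f g :: "'a \<Rightarrow> ennreal"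
  assumes "sigma_finite_measure M" and sets: "sets M = sets borel"
    and [measurable]: "(\<lambda>(x, y). m x y) \<in> borel \<Otimes>\<^sub>M borel \<rightarrow>\<^sub>M borel"
      "iv \<in> borel \<rightarrow>\<^sub>M borel" "\<phi> \<in> borel \<rightarrow>\<^sub>M borel" "f \<in> borel_measurable borel" "g \<in> borel_measurable borel"
    and AE: "AE x in M. x \<in> X"
    and invar: "\<And>a f. a \<in> X \<Longrightarrow> f \<in> borel_measurable borel \<Longrightarrow> (\<integral>\<^sup>+x. f (m a x) \<partial>M) = (\<integral>\<^sup>+x. f x \<partial>M)"
    and closed: "\<And>x. x \<in> X \<Longrightarrow> \<phi> x \<in> X" "\<And>x. x \<in> X \<Longrightarrow> iv x \<in> X"
    and cancel: "\<And>x y. x \<in> X \<Longrightarrow> y \<in> X \<Longrightarrow> m (iv (m x y)) x = iv y"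
    and comm: "\<And>x y. m x y = m y x"
    and hom: "\<And>x y. x \<in> X \<Longrightarrow> y \<in> X \<Longrightarrow> \<phi> (m x y) = m (\<phi> x) (\<phi> y)"
    and surj: "\<And>y. y \<in> X \<Longrightarrow> \<exists>x\<in>X. \<phi> x = y"
  shows "(\<integral>\<^sup>+x. f (\<phi> x) \<partial>M) * (\<integral>\<^sup>+x. g x \<partial>M) = (\<integral>\<^sup>+x. g (iv (\<phi> x)) \<partial>M) * (\<integral>\<^sup>+x. f x \<partial>M)"
proof -
  interpret sigma_finite_measure M by fact
  interpret pair_sigma_finite M M ..
  note sets[measurable_cong]
  have m1[measurable]: "(\<lambda>x. m (a x) (b x)) \<in> N \<rightarrow>\<^sub>M borel"
    if [measurable]: "a \<in> N \<rightarrow>\<^sub>M borel" "b \<in> N \<rightarrow>\<^sub>M borel" for a b :: "'b \<Rightarrow> 'a" and N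
    using measurable_compose[OF measurable_Pair[OF that] assms(3)] by simp
  have "(\<integral>\<^sup>+x. f (\<phi> x) \<partial>M) * (\<integral>\<^sup>+y. g y \<partial>M) = (\<integral>\<^sup>+x. (\<integral>\<^sup>+y. f (\<phi> x) * g y \<partial>M) \<partial>M)"
    by (simp add: nn_integral_cmult nn_integral_multc)
  also have "\<dots> = (\<integral>\<^sup>+x. (\<integral>\<^sup>+y. f (\<phi> x) * g (m (iv (\<phi> x)) y) \<partial>M) \<partial>M)"
  proof (rule nn_integral_cong_AE, use AE in eventually_elim)
    fix x assume "x \<in> X"
    then show "(\<integral>\<^sup>+y. f (\<phi> x) * g y \<partial>M) = (\<integral>\<^sup>+y. f (\<phi> x) * g (m (iv (\<phi> x)) y) \<partial>M)"
      using invar[of "iv (\<phi> x)" "\<lambda>y. f (\<phi> x) * g y"] closed by simp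
  qed
  also have "\<dots> = (\<integral>\<^sup>+y. (\<integral>\<^sup>+x. f (\<phi> x) * g (m (iv (\<phi> x)) y) \<partial>M) \<partial>M)"
    by (rule Fubini'[symmetric]) simp
  also have "\<dots> = (\<integral>\<^sup>+y. (\<integral>\<^sup>+x. f (m (\<phi> x) y) * g (iv (\<phi> x)) \<partial>M) \<partial>M)"
  proof (rule nn_integral_cong_AE, use AE in eventually_elim)
    fix y assume y: "y \<in> X"
    then obtain u where u: "u \<in> X" "\<phi> u = y" using surj by blast
    have "(\<integral>\<^sup>+x. f (\<phi> x) * g (m (iv (\<phi> x)) y) \<partial>M)
        = (\<integral>\<^sup>+x. f (\<phi> (m u x)) * g (m (iv (\<phi> (m u x))) y) \<partial>M)"
      using invar[OF u(1), of "\<lambda>x. f (\<phi> x) * g (m (iv (\<phi> x)) y)"] by simp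
    also have "\<dots> = (\<integral>\<^sup>+x. f (m (\<phi> x) y) * g (iv (\<phi> x)) \<partial>M)"
      by (rule nn_integral_cong_AE, use AE in eventually_elim)
         (use u y hom closed cancel comm in \<open>metis\<close>)
    finally show "(\<integral>\<^sup>+x. f (\<phi> x) * g (m (iv (\<phi> x)) y) \<partial>M)
        = (\<integral>\<^sup>+x. f (m (\<phi> x) y) * g (iv (\<phi> x)) \<partial>M)" .
  qed
  also have "\<dots> = (\<integral>\<^sup>+x. (\<integral>\<^sup>+y. f (m (\<phi> x) y) * g (iv (\<phi> x)) \<partial>M) \<partial>M)"
    by (rule Fubini') simp
  also have "\<dots> = (\<integral>\<^sup>+x. (\<integral>\<^sup>+y. f y * g (iv (\<phi> x)) \<partial>M) \<partial>M)"
  proof (rule nn_integral_cong_AE, use AE in eventually_elim)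
    fix x assume "x \<in> X"
    then show "(\<integral>\<^sup>+y. f (m (\<phi> x) y) * g (iv (\<phi> x)) \<partial>M) = (\<integral>\<^sup>+y. f y * g (iv (\<phi> x)) \<partial>M)"
      using invar[of "\<phi> x" "\<lambda>y. f y * g (iv (\<phi> x))"] closed by simp
  qed
  also have "\<dots> = (\<integral>\<^sup>+x. g (iv (\<phi> x)) \<partial>M) * (\<integral>\<^sup>+x. f x \<partial>M)"
    by (simp add: nn_integral_cmult nn_integral_multc mult.commute)
  finally show ?thesis .
qed

text \<open>The additive instance. A good choice of \<open>g\<close> yields the factor by which a linear map changes
volumes.\<close>

lemma nn_integral_linear_bij:
  fixes \<phi> :: "'a::euclidean_space \<Rightarrow> 'a" and f g :: "'a \<Rightarrow> ennreal"
  assumes "linear \<phi>" "surj \<phi>" and [measurable]: "f \<in> borel_measurable borel" "g \<in> borel_measurable borel"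
  shows "(\<integral>\<^sup>+x. f (\<phi> x) \<partial>lborel) * (\<integral>\<^sup>+x. g x \<partial>lborel)
       = (\<integral>\<^sup>+x. g (- \<phi> x) \<partial>lborel) * (\<integral>\<^sup>+x. f x \<partial>lborel)"
proof (rule invariant_measure_pushforward[where m = "(+)" and X = UNIV])
  show "\<phi> \<in> borel \<rightarrow>\<^sub>M borel"
    by (intro borel_measurable_continuous_onI linear_continuous_on linear_conv_bounded_linear[THEN iffD1] assms)
  show "(\<integral>\<^sup>+x. f (a + x) \<partial>lborel) = (\<integral>\<^sup>+x. f x \<partial>lborel)" if [measurable]: "f \<in> borel_measurable borel"
    for a and f :: "'a \<Rightarrow> ennreal"
    by (subst (2) lborel_distr_plus[symmetric, of a]) (simp add: nn_integral_distr)
qed (use assms in \<open>auto simp: linear_add sigma_finite_lborel surj_def add.commute dest: sym\<close>)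

lemma indicator_ball_measurable [measurable, simp]:
  "(indicator (ball c r) :: complex \<Rightarrow> ennreal) \<in> borel_measurable borel"
  by (rule borel_measurable_indicator) simp

text \<open>Tested on the unit disc, whose preimage is a disc of radius \<open>1 / |a|\<close>.\<close>

lemma nn_integral_complex_mult:
  fixes f :: "complex \<Rightarrow> ennreal"
  assumes "a \<noteq> 0" and f: "f \<in> borel_measurable borel"
  shows "(\<integral>\<^sup>+z. f (a * z) \<partial>lborel) = ennreal (inverse ((norm a)\<^sup>2)) * (\<integral>\<^sup>+z. f z \<partial>lborel)"
proof -
  have ball: "emeasure lborel (ball (0::complex) r) = ennreal (r\<^sup>2 * pi)" if "r > 0" for r :: real
    using that by (simp add: emeasure_ball unit_ball_vol_2 power2_eq_square mult.commute)
  have "(\<integral>\<^sup>+x. f (a * x) \<partial>lborel) * (\<integral>\<^sup>+x. indicator (ball 0 1) (x::complex) \<partial>lborel)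
       = (\<integral>\<^sup>+x. indicator (ball 0 1) (- (a * x)) \<partial>lborel) * (\<integral>\<^sup>+x. f x \<partial>lborel)"
  proof (rule nn_integral_linear_bij[of "(*) a" f "\<lambda>x. indicator (ball 0 1) x"])
    show "surj ((*) a)" by (rule surjI[of _ "\<lambda>x. x / a"]) (use assms in simp)
  qed (use f in \<open>auto intro: linear_times\<close>)
  also have "(\<lambda>x. indicator (ball 0 1) (- (a * x)) :: ennreal) = indicator (ball 0 (inverse (norm a)))"
    using assms by (auto simp: fun_eq_iff indicator_def norm_mult field_simps)
  finally have "(\<integral>\<^sup>+x. f (a * x) \<partial>lborel) * ennreal pi
       = ennreal (inverse (norm a) ^ 2 * pi) * (\<integral>\<^sup>+x. f x \<partial>lborel)"
    using assms by (simp add: ball)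
  also have "\<dots> = (ennreal (inverse ((norm a)\<^sup>2)) * (\<integral>\<^sup>+z. f z \<partial>lborel)) * ennreal pi"
    by (simp add: ennreal_mult power_inverse mult_ac)
  finally show ?thesis
    by (auto simp: mult.commute[of _ "ennreal pi"] ennreal_mult_cancel_left)
qed

lemma vec_mult_measurable [measurable (raw)]:
  fixes f g :: "'b \<Rightarrow> complex ^ 'n::finite"
  assumes [measurable]: "f \<in> borel_measurable M" "g \<in> borel_measurable M"
  shows "(\<lambda>x. f x * g x) \<in> borel_measurable M"
proof -
  have "(\<lambda>x. f x * g x) = (\<lambda>x. \<chi> k. f x $ k * g x $ k)" by (simp add: vec_eq_iff fun_eq_iff)
  then show ?thesis by simp
qed

text \<open>Tested on the unit polydisc. Multiplication of vectors is componentwise.\<close>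

lemma nn_integral_vec_mult:
  fixes f :: "complex ^ 'n::finite \<Rightarrow> ennreal" and a :: "complex ^ 'n"
  assumes a: "\<And>k. a $ k \<noteq> 0" and f[measurable]: "f \<in> borel_measurable borel"
  shows "(\<integral>\<^sup>+z. f (a * z) \<partial>lborel)
       = ennreal (\<Prod>k\<in>UNIV. inverse ((norm (a $ k))\<^sup>2)) * (\<integral>\<^sup>+z. f z \<partial>lborel)"
proof -
  define g :: "complex ^ 'n \<Rightarrow> ennreal" where "g z = (\<Prod>k\<in>UNIV. indicator (ball 0 1) (z $ k))" for z
  have [measurable]: "g \<in> borel_measurable borel" unfolding g_def
    by (intro borel_measurable_prod_ennreal measurable_compose[OF borel_measurable_vec_nth] borel_measurable_indicator) auto
  have ball: "(\<integral>\<^sup>+x. indicator (ball 0 1) (x::complex) \<partial>lborel) = ennreal pi"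
    by (simp add: emeasure_ball unit_ball_vol_2)
  have g1: "(\<integral>\<^sup>+z. g z \<partial>lborel) = ennreal (pi ^ CARD('n))"
    unfolding g_def by (subst nn_integral_vec_prod) (auto simp: ball ennreal_power simp del: nn_integral_indicator)
  have "(\<integral>\<^sup>+z. g (- (a * z)) \<partial>lborel)
     = (\<integral>\<^sup>+z. (\<Prod>k\<in>UNIV. indicator (ball 0 1) (- a $ k * z $ k)) \<partial>lborel)"
    by (simp add: g_def)
  also have "\<dots> = (\<Prod>k\<in>UNIV. \<integral>\<^sup>+w. indicator (ball 0 1) (- a $ k * w) \<partial>lborel)"
    by (rule nn_integral_vec_prod, rule measurable_compose[where N = borel]) auto
  also have "\<dots> = (\<Prod>k\<in>UNIV. ennreal (inverse ((norm (a $ k))\<^sup>2)) * ennreal pi)"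
    using a by (intro prod.cong refl) (subst nn_integral_complex_mult, auto simp: ball simp del: nn_integral_indicator)
  also have "\<dots> = ennreal (\<Prod>k\<in>UNIV. inverse ((norm (a $ k))\<^sup>2)) * ennreal (pi ^ CARD('n))"
    by (simp add: prod.distrib prod_ennreal ennreal_power)
  finally have g2: "(\<integral>\<^sup>+z. g (- (a * z)) \<partial>lborel) = \<dots>" .
  have "(\<integral>\<^sup>+x. f (a * x) \<partial>lborel) * (\<integral>\<^sup>+x. g x \<partial>lborel)
       = (\<integral>\<^sup>+x. g (- (a * x)) \<partial>lborel) * (\<integral>\<^sup>+x. f x \<partial>lborel)"
  proof (rule nn_integral_linear_bij)
    show "linear ((*) a)" by (intro linearI) (auto simp: vec_eq_iff algebra_simps)
    show "surj ((*) a)"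
      by (rule surjI[of _ "\<lambda>x. \<chi> k. x $ k / a $ k"]) (use a in \<open>simp add: vec_eq_iff\<close>)
  qed measurable
  then have "(\<integral>\<^sup>+x. f (a * x) \<partial>lborel) * ennreal (pi ^ CARD('n)) =
    (ennreal (\<Prod>k\<in>UNIV. inverse ((norm (a $ k))\<^sup>2)) * (\<integral>\<^sup>+x. f x \<partial>lborel)) * ennreal (pi ^ CARD('n))"
    unfolding g1 g2 by (simp add: mult_ac)
  then show ?thesis
    by (auto simp: mult.commute[of _ "ennreal (pi ^ CARD('n))"] ennreal_mult_cancel_left)
qed

section \<open>The multiplicative Haar measure\<close>

definition regular :: "(complex ^ 'n::finite) set" where
  "regular = {z. \<forall>k. z $ k \<noteq> 0}"

lemma open_regular: "open (regular :: (complex ^ 'n::finite) set)"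
proof -
  have "open (\<Inter>k. {z::complex ^ 'n. z $ k \<noteq> 0})"
    by (intro open_INT ballI open_Collect_neq continuous_intros) auto
  also have "(\<Inter>k. {z::complex ^ 'n. z $ k \<noteq> 0}) = regular" by (auto simp: regular_def)
  finally show ?thesis .
qed

lemma regular_borel [measurable]: "regular \<in> sets borel"
  by (rule borel_open[OF open_regular])

lemma AE_regular: "AE z::complex ^ 'n::finite in lborel. z \<in> regular"
proof -
  have "AE z::complex ^ 'n in lborel. z $ k \<noteq> 0" for k
  proof -
    have "negligible {z::complex ^ 'n. axis k 1 \<bullet> z = 0}"
      by (rule negligible_hyperplane) (simp add: axis_eq_0_iff)
    then have "{z::complex ^ 'n. axis k 1 \<bullet> z = 0} \<in> null_sets lebesgue"
      by (simp add: negligible_iff_null_sets)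
    then have "AE z::complex ^ 'n in lebesgue. z \<notin> {z. axis k 1 \<bullet> z = 0}"
      by (rule AE_not_in)
    then have "AE z::complex ^ 'n in lborel. z \<notin> {z. axis k 1 \<bullet> z = 0}"
      by (simp add: AE_completion_iff)
    then show ?thesis
      by eventually_elim (auto simp: inner_axis')
  qed
  then show ?thesis
    by (simp add: regular_def AE_all_countable)
qed

text \<open>The Haar measure of the multiplicative group of regular vectors.\<close>

definition mult_haar :: "(complex ^ 'n::finite) measure" where
  "mult_haar = density lborel (\<lambda>z. ennreal (\<Prod>k\<in>UNIV. inverse ((norm (z $ k))\<^sup>2)))"

lemma sets_mult_haar [simp, measurable_cong]: "sets mult_haar = sets borel"
  by (simp add: mult_haar_def)

lemma nn_integral_mult_haar:
  assumes "f \<in> borel_measurable borel"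
  shows "(\<integral>\<^sup>+z. f z \<partial>mult_haar) = (\<integral>\<^sup>+z. ennreal (\<Prod>k\<in>UNIV. inverse ((norm (z $ k))\<^sup>2)) * f z \<partial>lborel)"
  using assms unfolding mult_haar_def by (intro nn_integral_density) auto

lemma nn_integral_mult_haar_mult:
  fixes f :: "complex ^ 'n::finite \<Rightarrow> ennreal"
  assumes a: "a \<in> regular" and [measurable]: "f \<in> borel_measurable borel"
  shows "(\<integral>\<^sup>+z. f (a * z) \<partial>mult_haar) = (\<integral>\<^sup>+z. f z \<partial>mult_haar)"
proof -
  let ?w = "\<lambda>z::complex^'n. (\<Prod>k\<in>UNIV. inverse ((norm (z $ k))\<^sup>2))"
  have a': "a $ k \<noteq> 0" for k using a by (auto simp: regular_def)
  have pos: "?w z \<ge> 0" for z by (intro prod_nonneg) auto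
  have w: "?w (a * z) = ?w a * ?w z" for z
    by (simp add: norm_mult power_mult_distrib prod.distrib)
  have w0: "?w a > 0" by (intro prod_pos) (use a' in auto)
  have "(\<lambda>z. ?w z * 1) = ?w" by simp
  have "ennreal (?w a) * (\<integral>\<^sup>+z. f (a * z) \<partial>mult_haar)
      = (\<integral>\<^sup>+z. ennreal (?w a) * (ennreal (?w z) * f (a * z)) \<partial>lborel)"
    by (subst nn_integral_mult_haar) (auto intro!: nn_integral_cmult[symmetric])
  also have "\<dots> = (\<integral>\<^sup>+z. ennreal (?w (a * z)) * f (a * z) \<partial>lborel)"
    unfolding w by (simp add: ennreal_mult pos mult.assoc)
  also have "\<dots> = ennreal (?w a) * (\<integral>\<^sup>+z. ennreal (?w z) * f z \<partial>lborel)"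
    by (rule nn_integral_vec_mult[OF a']) measurable
  also have "\<dots> = ennreal (?w a) * (\<integral>\<^sup>+z. f z \<partial>mult_haar)"
    by (subst nn_integral_mult_haar) auto
  finally show ?thesis
    using w0 by (subst (asm) ennreal_mult_cancel_left) (simp add: less_le_not_le ennreal_eq_0_iff)
qed

lemma AE_mult_haar_regular: "AE z in mult_haar. z \<in> regular"
  unfolding mult_haar_def by (subst AE_density) (use AE_regular in auto)

lemma sigma_finite_mult_haar: "sigma_finite_measure (mult_haar :: (complex ^ 'n::finite) measure)"
  unfolding mult_haar_def
  by (subst sigma_finite_measure.sigma_finite_iff_density_finite[OF sigma_finite_lborel]) auto

lemma emeasure_mult_haar_finite:
  fixes E :: "(complex ^ 'n::finite) set"
  assumes "bounded E" "E \<in> sets borel" "r > 0" "\<And>z k. z \<in> E \<Longrightarrow> r \<le> norm (z $ k)"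
  shows "emeasure mult_haar E < \<infinity>"
proof -
  have "ennreal (\<Prod>k\<in>UNIV. inverse ((norm (z $ k))\<^sup>2)) * indicator E z
     \<le> ennreal (\<Prod>k\<in>(UNIV::'n set). inverse (r\<^sup>2)) * indicator E z" for z
  proof (cases "z \<in> E")
    case True
    have "inverse ((norm (z $ k))\<^sup>2) \<le> inverse (r\<^sup>2)" for k
      using assms(3) assms(4)[OF True, of k] by (intro le_imp_inverse_le power_mono) auto
    with True show ?thesis by (auto intro!: ennreal_leI prod_mono simp del: prod_constant)
  qed auto
  note * = this
  have "emeasure mult_haar E = (\<integral>\<^sup>+z. ennreal (\<Prod>k\<in>UNIV. inverse ((norm (z $ k))\<^sup>2)) * indicator E z \<partial>lborel)"
    unfolding mult_haar_def using assms by (subst emeasure_density) auto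
  also have "\<dots> \<le> (\<integral>\<^sup>+z. ennreal (\<Prod>k\<in>(UNIV::'n set). inverse (r\<^sup>2)) * indicator E z \<partial>lborel)"
    by (rule nn_integral_mono) (rule *)
  also have "\<dots> = ennreal (\<Prod>k\<in>(UNIV::'n set). inverse (r\<^sup>2)) * emeasure lborel E"
    using assms by (subst nn_integral_cmult_indicator) auto
  also have "\<dots> < \<infinity>"
    using emeasure_bounded_finite[OF assms(1)] by (simp add: ennreal_mult_less_top del: prod_constant)
  finally show ?thesis .
qed

lemma emeasure_mult_haar_pos:
  fixes E :: "(complex ^ 'n::finite) set"
  assumes "open E" "E \<noteq> {}" "E \<subseteq> regular"
  shows "emeasure mult_haar E > 0"
proof (rule ccontr)
  assume "\<not> ?thesis"
  then have "emeasure mult_haar E = 0" by simp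
  then have "E \<in> null_sets mult_haar" using assms by (auto simp: null_sets_def)
  then have "AE z in mult_haar. z \<notin> E" by (rule AE_not_in)
  then have "AE z in lborel. (0::ennreal) < ennreal (\<Prod>k\<in>UNIV. inverse ((norm (z $ k))\<^sup>2)) \<longrightarrow> z \<notin> E"
    unfolding mult_haar_def by (subst (asm) AE_density) auto
  then have "AE z in lborel. z \<notin> E"
    by eventually_elim (use assms(3) in \<open>auto simp: regular_def intro!: prod_pos\<close>)
  then have "E \<in> null_sets lborel" using assms by (subst (asm) AE_iff_null_sets[symmetric]) auto
  then have "negligible E" by (simp add: negligible_iff_null_sets null_sets_completionI)
  then show False using open_not_negligible assms by blast
qed

section \<open>Monomial maps\<close>

lemma prod_powi: "(\<Prod>i\<in>S. f i) powi n = (\<Prod>i\<in>S. f i powi n)" for f :: "'b \<Rightarrow> 'z::field"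
  by (induction S rule: infinite_finite_induct) (auto simp: power_int_mult_distrib)

lemma powi_sum: "x \<noteq> 0 \<Longrightarrow> x powi (\<Sum>i\<in>S. f i) = (\<Prod>i\<in>S. x powi f i)" for x :: "'z::field"
  by (induction S rule: infinite_finite_induct) (auto simp: power_int_add)

text \<open>The natural matrix \<open>a\<close> inverts \<open>B\<close> up to positive integer factors of the rows; for a monomial polyhedron the
columns of \<open>a\<close> are the reduced columns. Everything about the covering follows from this one relation.\<close>

locale monomial_cover =
  fixes B :: "int ^ 'n ^ 'n::finite" and a :: "'n \<Rightarrow> 'n \<Rightarrow> nat" and m :: "'n \<Rightarrow> nat"
  assumes m_pos: "\<And>j. m j > 0"
    and BA: "\<And>j l. (\<Sum>k\<in>UNIV. B $ j $ k * int (a k l)) = (if j = l then int (m j) else 0)"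
begin

definition Phi :: "complex ^ 'n \<Rightarrow> complex ^ 'n" where
  "Phi z = (\<chi> k. \<Prod>j\<in>UNIV. z $ j ^ a k j)"

text \<open>The truncated subtraction is harmless: every column sum of \<open>a\<close> is at least 1.\<close>

definition jac_exponent :: "'n \<Rightarrow> nat" where "jac_exponent j = (\<Sum>k\<in>UNIV. a k j) - 1"

definition jac :: "complex ^ 'n \<Rightarrow> complex" where
  "jac z = (\<Prod>j\<in>UNIV. z $ j ^ jac_exponent j)"

lemma Phi_measurable [measurable]: "Phi \<in> borel \<rightarrow>\<^sub>M borel"
  unfolding Phi_def by measurable

lemma jac_measurable [measurable]: "jac \<in> borel \<rightarrow>\<^sub>M borel"
  unfolding jac_def by measurable

lemma Phi_mult: "Phi (x * y) = Phi x * Phi y"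
  by (simp add: Phi_def vec_eq_iff power_mult_distrib prod.distrib)

lemma jac_mult: "jac (x * y) = jac x * jac y"
  by (simp add: jac_def power_mult_distrib prod.distrib)

lemma Phi_regular: "z \<in> regular \<Longrightarrow> Phi z \<in> regular"
  by (simp add: Phi_def regular_def)

lemma jac_nz: "z \<in> regular \<Longrightarrow> jac z \<noteq> 0"
  by (simp add: jac_def regular_def)

lemma col_sum: "(\<Sum>k\<in>UNIV. a k j) \<ge> 1"
proof (rule ccontr)
  assume "\<not> ?thesis"
  then have "a k j = 0" for k by (simp add: not_le)
  then have "(\<Sum>k\<in>UNIV. B $ j $ k * int (a k j)) = 0" by simp
  with BA[of j j] m_pos[of j] show False by simp
qed

text \<open>This identity is the reason why \<open>jac\<close> is the Jacobian up to a constant: it compares the densities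
of Lebesgue and Haar measure in source and target.\<close>

lemma prod_Phi: "(\<Prod>k\<in>UNIV. Phi z $ k) = jac z * (\<Prod>j\<in>UNIV. z $ j)"
proof -
  have "(\<Prod>k\<in>UNIV. Phi z $ k) = (\<Prod>j\<in>UNIV. \<Prod>k\<in>UNIV. z $ j ^ a k j)"
    unfolding Phi_def by simp (rule prod.swap)
  also have "\<dots> = (\<Prod>j\<in>UNIV. z $ j ^ (\<Sum>k\<in>UNIV. a k j))"
    by (simp add: power_sum)
  also have "\<dots> = (\<Prod>j\<in>UNIV. z $ j ^ (jac_exponent j + 1))"
  proof (intro prod.cong refl arg_cong2[where f = power])
    show "(\<Sum>k\<in>UNIV. a k j) = jac_exponent j + 1" for j using col_sum[of j] by (simp add: jac_exponent_def)
  qed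
  finally show ?thesis by (simp add: jac_def prod.distrib mult.commute)
qed

definition inverse_exponent :: "'n \<Rightarrow> 'n \<Rightarrow> real" where "inverse_exponent j l = of_int (B $ j $ l) / of_nat (m j)"

lemma inverse_exponent_left: "(\<Sum>k\<in>UNIV. inverse_exponent j k * of_nat (a k l)) = (if j = l then 1 else 0)"
proof -
  have "(\<Sum>k\<in>UNIV. inverse_exponent j k * of_nat (a k l)) = real_of_int (\<Sum>k\<in>UNIV. B $ j $ k * int (a k l)) / of_nat (m j)"
    by (simp add: inverse_exponent_def sum_divide_distrib)
  then show ?thesis using m_pos[of j] unfolding BA by auto
qed

lemma inverse_exponent_right: "(\<Sum>j\<in>UNIV. of_nat (a k j) * inverse_exponent j l) = (if k = l then 1 else 0)"
proof -
  define P where "P = (\<chi> j k. inverse_exponent j k)"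
  define Q where "Q = (\<chi> k j. real (a k j))"
  have "P ** Q = mat 1" by (simp add: P_def Q_def matrix_matrix_mult_def mat_def vec_eq_iff inverse_exponent_left)
  then have "Q ** P = mat 1" by (simp add: matrix_left_right_inverse)
  then show ?thesis by (simp add: P_def Q_def matrix_matrix_mult_def mat_def vec_eq_iff)
qed

text \<open>In logarithmic coordinates \<open>Phi\<close> is linear with matrix \<open>a\<close>, so a real inverse matrix provides preimages. The
base point \<open>p\<close> allows for local inverses through any given point.\<close>

lemma Phi_exp: "Phi (\<chi> j. p $ j * exp (\<Sum>l\<in>UNIV. of_real (inverse_exponent j l) * v l)) = (\<chi> k. Phi p $ k * exp (v k))"
proof -
  have "(\<Prod>j\<in>UNIV. exp (\<Sum>l\<in>UNIV. of_real (inverse_exponent j l) * v l) ^ a k j) = exp (v k)" for k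
  proof -
    have "(\<Prod>j\<in>UNIV. exp (\<Sum>l\<in>UNIV. of_real (inverse_exponent j l) * v l) ^ a k j)
      = exp (\<Sum>j\<in>UNIV. \<Sum>l\<in>UNIV. of_real (of_nat (a k j) * inverse_exponent j l) * v l)"
      by (simp add: exp_sum[symmetric] exp_of_nat_mult[symmetric] sum_distrib_left mult.assoc)
    also have "(\<Sum>j\<in>UNIV. \<Sum>l\<in>UNIV. of_real (of_nat (a k j) * inverse_exponent j l) * v l)
       = (\<Sum>l\<in>UNIV. of_real (\<Sum>j\<in>UNIV. of_nat (a k j) * inverse_exponent j l) * v l)"
      by (subst sum.swap) (simp add: sum_distrib_right)
    also have "\<dots> = (\<Sum>l\<in>UNIV. if l = k then v l else 0)"
      unfolding inverse_exponent_right by (intro sum.cong) auto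
    also have "exp \<dots> = exp (v k)" by simp
    finally show ?thesis .
  qed
  then show ?thesis by (simp add: Phi_def vec_eq_iff power_mult_distrib prod.distrib)
qed

text \<open>A measurable global right inverse of \<open>Phi\<close> on regular points. It is discontinuous because of the branch cut
of the logarithm.\<close>

definition psi :: "complex ^ 'n \<Rightarrow> complex ^ 'n" where
  "psi x = (\<chi> j. exp (\<Sum>l\<in>UNIV. of_real (inverse_exponent j l) * Ln (x $ l)))"

lemma psi_regular: "psi x \<in> regular" by (simp add: psi_def regular_def)

lemma Phi_psi: assumes "x \<in> regular" shows "Phi (psi x) = x"
proof -
  have "Phi (psi x) = Phi (\<chi> j. (1 :: complex ^ 'n) $ j * exp (\<Sum>l\<in>UNIV. of_real (inverse_exponent j l) * Ln (x $ l)))"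
    by (simp add: psi_def)
  also have "\<dots> = x"
    unfolding Phi_exp using assms by (simp add: Phi_def regular_def vec_eq_iff)
  finally show ?thesis .
qed

text \<open>Consequence of \<open>B A\<close> being diagonal; it turns the inequalities defining the polyhedron into \<open>|z\<^sub>j| < 1\<close>.\<close>

lemma Phi_powi: assumes "z \<in> regular"
  shows "(\<Prod>k\<in>UNIV. norm (Phi z $ k) powi (B $ j $ k)) = norm (z $ j) ^ m j"
    and "(\<Prod>k\<in>UNIV. Phi z $ k powi (B $ j $ k)) = z $ j ^ m j"
proof -
  have *: "(\<Prod>k\<in>UNIV. (\<Prod>i\<in>UNIV. y i ^ a k i) powi (B $ j $ k)) = y j ^ m j"
    if y: "\<And>i. y i \<noteq> (0::'z::field)" for y
  proof -
    have "(\<Prod>k\<in>UNIV. (\<Prod>i\<in>UNIV. y i ^ a k i) powi (B $ j $ k))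
        = (\<Prod>k\<in>UNIV. \<Prod>i\<in>UNIV. y i powi (B $ j $ k * int (a k i)))"
    proof (intro prod.cong refl)
      fix k
      have "y i powi (B $ j $ k * int (a k i)) = (y i ^ a k i) powi (B $ j $ k)" for i
        by (subst mult.commute, subst power_int_mult) simp
      then show "(\<Prod>i\<in>UNIV. y i ^ a k i) powi (B $ j $ k) = (\<Prod>i\<in>UNIV. y i powi (B $ j $ k * int (a k i)))"
        by (simp add: prod_powi)
    qed
    also have "\<dots> = (\<Prod>i\<in>UNIV. y i powi (\<Sum>k\<in>UNIV. B $ j $ k * int (a k i)))"
      using y by (subst prod.swap) (simp add: powi_sum)
    also have "\<dots> = (\<Prod>i\<in>UNIV. if i = j then y i ^ m j else 1)"
      by (intro prod.cong refl) (simp add: BA)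
    finally show ?thesis by simp
  qed
  show "(\<Prod>k\<in>UNIV. norm (Phi z $ k) powi (B $ j $ k)) = norm (z $ j) ^ m j"
    using *[of "\<lambda>i. norm (z $ i)"] assms by (simp add: Phi_def regular_def prod_norm[symmetric] norm_power)
  show "(\<Prod>k\<in>UNIV. Phi z $ k powi (B $ j $ k)) = z $ j ^ m j"
    using *[of "\<lambda>i. z $ i"] assms by (simp add: Phi_def regular_def)
qed

end

section \<open>Averages over the unit circle\<close>

definition unit_circle :: "real \<Rightarrow> complex" where "unit_circle t = exp (2 * of_real pi * \<i> * of_real t)"

lemma norm_unit_circle [simp]: "norm (unit_circle t) = 1" by (simp add: unit_circle_def norm_exp_eq_Re)
lemma unit_circle_nz [simp]: "unit_circle t \<noteq> 0" by (simp add: unit_circle_def)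
lemma continuous_unit_circle [continuous_intros]:
  "continuous_on S f \<Longrightarrow> continuous_on S (\<lambda>x. unit_circle (f x))"
  unfolding unit_circle_def by (intro continuous_intros)
lemma unit_circle_measurable [measurable]: "unit_circle \<in> borel_measurable borel"
  by (intro borel_measurable_continuous_onI continuous_intros)

lemma circle_cauchy:
  assumes hol: "g holomorphic_on ball 0 R" and R: "R > 1" and w: "norm w < 1"
  shows "((\<lambda>t. g (unit_circle t) * unit_circle t / (unit_circle t - w)) has_integral g w) {0..1}"
proof -
  have "((\<lambda>u. g u / (u - w)) has_contour_integral (2 * of_real pi * \<i> * g w)) (circlepath 0 1)"
    by (rule Cauchy_integral_circlepath)
       (use w R in \<open>auto intro!: holomorphic_on_imp_continuous_on holomorphic_on_subset[OF hol]\<close>)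
  then have "((\<lambda>x. g (circlepath 0 1 x) / (circlepath 0 1 x - w) * vector_derivative (circlepath 0 1) (at x within {0..1}))
      has_integral (2 * of_real pi * \<i> * g w)) {0..1}"
    by (simp add: has_contour_integral_def)
  then have "((\<lambda>x. (2 * of_real pi * \<i>) * (g (unit_circle x) * unit_circle x / (unit_circle x - w))) has_integral (2 * of_real pi * \<i> * g w)) {0..1}"
    by (rule has_integral_eq[rotated])
       (simp add: vector_derivative_circlepath01, simp add: circlepath unit_circle_def)
  from has_integral_mult_right[OF this, of "inverse (2 * of_real pi * \<i>)"]
  show ?thesis by (simp add: field_simps)
qed

lemma circle_mean:
  assumes hol: "g holomorphic_on ball 0 R" and R: "R > 1"
  shows "((\<lambda>t. g (unit_circle t)) has_integral g 0) {0..1}"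
  using circle_cauchy[OF assms, of 0] by simp

lemma nn_integral_cmod_has_integral:
  fixes f :: "real \<Rightarrow> complex"
  assumes "(f has_integral I) {0..1}" "continuous_on {0..1} f"
  shows "ennreal (norm I) \<le> (\<integral>\<^sup>+t. indicator {0..1} t * ennreal (norm (f t)) \<partial>lborel)"
proof -
  have c: "continuous_on {0..1} (\<lambda>t. norm (f t))" by (intro continuous_intros assms)
  have i: "(\<lambda>t. norm (f t)) integrable_on {0..1}" by (rule integrable_continuous_real[OF c])
  have "norm I \<le> integral {0..1} (\<lambda>t. norm (f t))"
    using integral_norm_bound_integral[OF _ i, of f] assms
    by (auto simp: has_integral_iff)
  also have "ennreal \<dots> = (\<integral>\<^sup>+t. ennreal (norm (f t)) * indicator {0..1} t \<partial>lborel)"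
    by (rule nn_integral_has_integral_lebesgue'[symmetric]) (use i in auto)
  finally show ?thesis by (simp add: mult.commute ennreal_leI)
qed

section \<open>Holomorphic functions of several variables\<close>

lemma holomorphic_svD:
  assumes "holomorphic_sv \<Omega> f" "z \<in> \<Omega>"
  obtains L where "(f has_derivative L) (at z)" "\<And>c v. L (c *s v) = c * L v"
proof -
  from assms have "\<exists>L. (f has_derivative L) (at z) \<and> (\<forall>c v. L (c *s v) = c * L v)"
    unfolding holomorphic_sv_def by (rule bspec)
  then obtain L where L: "(f has_derivative L) (at z) \<and> (\<forall>c v. L (c *s v) = c * L v)" ..
  show thesis by (rule that[of L]) (use L in auto)
qed

lemma holomorphic_sv_subset: "holomorphic_sv \<Omega> f \<Longrightarrow> \<Omega>' \<subseteq> \<Omega> \<Longrightarrow> holomorphic_sv \<Omega>' f"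
  unfolding holomorphic_sv_def by (auto simp: subset_iff)

lemma holomorphic_sv_continuous_on: "holomorphic_sv \<Omega> f \<Longrightarrow> continuous_on \<Omega> f"
  by (rule continuous_at_imp_continuous_on) (auto simp: holomorphic_sv_def dest: has_derivative_continuous)

lemma holomorphic_sv_cong:
  assumes "holomorphic_sv \<Omega> f" "open \<Omega>" "\<And>z. z \<in> \<Omega> \<Longrightarrow> f z = g z"
  shows "holomorphic_sv \<Omega> g"
  unfolding holomorphic_sv_def
proof
  fix z assume z: "z \<in> \<Omega>"
  obtain L where L: "(f has_derivative L) (at z)" "\<And>c v. L (c *s v) = c * L v"
    using holomorphic_svD[OF assms(1) z] by blast
  have "(g has_derivative L) (at z)"
    by (rule has_derivative_transform_within_open[OF L(1) assms(2) z]) (use assms(3) in auto)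
  with L(2) show "\<exists>L. (g has_derivative L) (at z) \<and> (\<forall>c v. L (c *s v) = c * L v)"
    by (intro exI[of _ L]) simp
qed

lemma holomorphic_sv_const [intro]: "holomorphic_sv \<Omega> (\<lambda>z. c)"
  unfolding holomorphic_sv_def by (auto intro!: exI[of _ "\<lambda>_. 0"])

lemma has_derivative_vec_nth' [derivative_intros]:
  "((\<lambda>z::complex^'n::finite. z $ k) has_derivative (\<lambda>v. v $ k)) F"
  by (rule bounded_linear_imp_has_derivative[OF bounded_linear_vec_nth])

lemma holomorphic_sv_nth [intro]: "holomorphic_sv \<Omega> (\<lambda>z. z $ k)"
  unfolding holomorphic_sv_def by (auto intro!: exI[of _ "\<lambda>v. v $ k"] derivative_intros)

lemma holomorphic_sv_add [intro]:
  assumes "holomorphic_sv \<Omega> f" "holomorphic_sv \<Omega> g"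
  shows "holomorphic_sv \<Omega> (\<lambda>z. f z + g z)"
  unfolding holomorphic_sv_def
proof
  fix z assume z: "z \<in> \<Omega>"
  obtain L where L: "(f has_derivative L) (at z)" "\<And>c v. L (c *s v) = c * L v"
    using holomorphic_svD[OF assms(1) z] by blast
  obtain L' where L': "(g has_derivative L') (at z)" "\<And>c v. L' (c *s v) = c * L' v"
    using holomorphic_svD[OF assms(2) z] by blast
  show "\<exists>L. ((\<lambda>z. f z + g z) has_derivative L) (at z) \<and> (\<forall>c v. L (c *s v) = c * L v)"
    by (rule exI[of _ "\<lambda>v. L v + L' v"])
       (use has_derivative_add[OF L(1) L'(1)] in \<open>auto simp: L(2) L'(2) algebra_simps\<close>)
qed

lemma holomorphic_sv_mult [intro]:
  assumes "holomorphic_sv \<Omega> f" "holomorphic_sv \<Omega> g"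
  shows "holomorphic_sv \<Omega> (\<lambda>z. f z * g z)"
  unfolding holomorphic_sv_def
proof
  fix z assume z: "z \<in> \<Omega>"
  obtain L where L: "(f has_derivative L) (at z)" "\<And>c v. L (c *s v) = c * L v"
    using holomorphic_svD[OF assms(1) z] by blast
  obtain L' where L': "(g has_derivative L') (at z)" "\<And>c v. L' (c *s v) = c * L' v"
    using holomorphic_svD[OF assms(2) z] by blast
  show "\<exists>L. ((\<lambda>z. f z * g z) has_derivative L) (at z) \<and> (\<forall>c v. L (c *s v) = c * L v)"
    by (rule exI[of _ "\<lambda>v. f z * L' v + L v * g z"])
       (use has_derivative_mult[OF L(1) L'(1)] in \<open>auto simp: L(2) L'(2) algebra_simps\<close>)
qed

lemma holomorphic_sv_diff [intro]:
  assumes "holomorphic_sv \<Omega> f" "holomorphic_sv \<Omega> g"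
  shows "holomorphic_sv \<Omega> (\<lambda>z. f z - g z)"
  using holomorphic_sv_add[OF assms(1) holomorphic_sv_mult[OF holomorphic_sv_const[of \<Omega> "-1"] assms(2)]] by simp

lemma holomorphic_sv_sum [intro]:
  "(\<And>i. i \<in> S \<Longrightarrow> holomorphic_sv \<Omega> (f i)) \<Longrightarrow> holomorphic_sv \<Omega> (\<lambda>z. \<Sum>i\<in>S. f i z)"
  by (induction S rule: infinite_finite_induct) auto

lemma holomorphic_sv_prod [intro]:
  "(\<And>i. i \<in> S \<Longrightarrow> holomorphic_sv \<Omega> (f i)) \<Longrightarrow> holomorphic_sv \<Omega> (\<lambda>z. \<Prod>i\<in>S. f i z)"
  by (induction S rule: infinite_finite_induct) auto

lemma holomorphic_sv_power [intro]:
  "holomorphic_sv \<Omega> f \<Longrightarrow> holomorphic_sv \<Omega> (\<lambda>z. f z ^ n)"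
  by (induction n) auto

lemma holomorphic_sv_compose_1:
  assumes f: "holomorphic_sv \<Omega> f" and g: "g holomorphic_on S" and "open S" "\<And>z. z \<in> \<Omega> \<Longrightarrow> f z \<in> S"
  shows "holomorphic_sv \<Omega> (\<lambda>z. g (f z))"
  unfolding holomorphic_sv_def
proof
  fix z assume z: "z \<in> \<Omega>"
  obtain L where L: "(f has_derivative L) (at z)" "\<And>c v. L (c *s v) = c * L v"
    using holomorphic_svD[OF f z] by blast
  have "(g has_field_derivative deriv g (f z)) (at (f z))"
    using holomorphic_derivI[OF g \<open>open S\<close> assms(4)[OF z]] .
  then have "(g has_derivative (*) (deriv g (f z))) (at (f z))"
    by (simp add: has_field_derivative_def)
  from has_derivative_compose[OF L(1) this]
  show "\<exists>L. ((\<lambda>z. g (f z)) has_derivative L) (at z) \<and> (\<forall>c v. L (c *s v) = c * L v)"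
    by (intro exI[of _ "\<lambda>v. deriv g (f z) * L v"]) (auto simp: L(2))
qed

lemma holomorphic_sv_divide [intro]:
  assumes "holomorphic_sv \<Omega> f" "holomorphic_sv \<Omega> g" "\<And>z. z \<in> \<Omega> \<Longrightarrow> g z \<noteq> 0"
  shows "holomorphic_sv \<Omega> (\<lambda>z. f z / g z)"
proof -
  have "holomorphic_sv \<Omega> (\<lambda>z. inverse (g z))"
    by (rule holomorphic_sv_compose_1[OF assms(2), where S = "- {0}"]) (use assms(3) in \<open>auto intro!: holomorphic_intros\<close>)
  from holomorphic_sv_mult[OF assms(1) this] show ?thesis by (simp add: field_simps)
qed

lemma has_derivative_vec_lambda:
  fixes f :: "'a::real_normed_vector \<Rightarrow> 'n::finite \<Rightarrow> complex"
  assumes "\<And>k. ((\<lambda>x. f x k) has_derivative (\<lambda>v. D k v)) (at z)"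
  shows "((\<lambda>x. \<chi> k. f x k) has_derivative (\<lambda>v. \<chi> k. D k v)) (at z)"
proof (subst has_derivative_componentwise_within, rule ballI)
  fix b :: "complex ^ 'n" assume "b \<in> Basis"
  then obtain k u where b: "b = axis k u" by (auto simp: Basis_vec_def)
  show "((\<lambda>x. (\<chi> k. f x k) \<bullet> b) has_derivative (\<lambda>v. (\<chi> k. D k v) \<bullet> b)) (at z)"
    using has_derivative_inner_left[OF assms[of k], of u] by (simp add: b inner_axis)
qed

lemma holomorphic_sv_compose:
  fixes h :: "complex ^ 'm::finite \<Rightarrow> complex ^ 'n::finite"
  assumes f: "holomorphic_sv \<Omega>' f" and h: "\<And>k. holomorphic_sv \<Omega> (\<lambda>z. h z $ k)"
    and map: "\<And>z. z \<in> \<Omega> \<Longrightarrow> h z \<in> \<Omega>'"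
  shows "holomorphic_sv \<Omega> (\<lambda>z. f (h z))"
  unfolding holomorphic_sv_def
proof
  fix z assume z: "z \<in> \<Omega>"
  have "\<exists>L. ((\<lambda>z. h z $ k) has_derivative L) (at z) \<and> (\<forall>c v. L (c *s v) = c * L v)" for k
    using h[of k] z unfolding holomorphic_sv_def by (rule bspec)
  then obtain D where D: "\<And>k. ((\<lambda>z. h z $ k) has_derivative D k) (at z)" "\<And>k c v. D k (c *s v) = c * D k v"
    by metis
  have "((\<lambda>z. \<chi> k. h z $ k) has_derivative (\<lambda>v. \<chi> k. D k v)) (at z)"
    by (rule has_derivative_vec_lambda) (rule D(1))
  then have h': "(h has_derivative (\<lambda>v. \<chi> k. D k v)) (at z)" by simp
  obtain L where L: "(f has_derivative L) (at (h z))" "\<And>c v. L (c *s v) = c * L v"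
    using holomorphic_svD[OF f map[OF z]] by blast
  show "\<exists>L. ((\<lambda>z. f (h z)) has_derivative L) (at z) \<and> (\<forall>c v. L (c *s v) = c * L v)"
  proof (intro exI[of _ "\<lambda>v. L (\<chi> k. D k v)"] conjI allI)
    show "((\<lambda>z. f (h z)) has_derivative (\<lambda>v. L (\<chi> k. D k v))) (at z)"
      using has_derivative_compose[OF h' L(1)] .
    fix c v
    have "(\<chi> k. D k (c *s v)) = c *s (\<chi> k. D k v)" by (simp add: vec_eq_iff D(2))
    then show "L (\<chi> k. D k (c *s v)) = c * L (\<chi> k. D k v)" by (simp add: L(2))
  qed
qed

lemma has_derivative_smult_line:
  "((\<lambda>s. z + s *s v) has_derivative (\<lambda>\<mu>. \<mu> *s v)) (at x)" for z v :: "complex ^ 'n::finite"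
proof -
  have "((\<lambda>s. \<chi> k. z $ k + s * v $ k) has_derivative (\<lambda>\<mu>. \<chi> k. \<mu> * v $ k)) (at x)"
    by (rule has_derivative_vec_lambda) (auto intro!: derivative_eq_intros)
  moreover have "(\<lambda>s. \<chi> k. z $ k + s * v $ k) = (\<lambda>s. z + s *s v)" by (simp add: fun_eq_iff vec_eq_iff)
  moreover have "(\<lambda>\<mu>. \<chi> k. \<mu> * v $ k) = (\<lambda>\<mu>. \<mu> *s v)" by (simp add: fun_eq_iff vec_eq_iff)
  ultimately show ?thesis by simp
qed

lemma line_field_derivative:
  fixes z v :: "complex ^ 'n::finite"
  assumes "(f has_derivative L) (at (z + x *s v))" "\<And>c v. L (c *s v) = c * L v"
  shows "((\<lambda>s. f (z + s *s v)) has_field_derivative L v) (at x)"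
proof -
  have "(\<lambda>x. x * L v) = (*) (L v)" by (simp add: fun_eq_iff mult.commute)
  then show ?thesis
    using has_derivative_compose[OF has_derivative_smult_line[of z v x] assms(1)]
    by (simp add: has_field_derivative_def assms(2))
qed

lemma holomorphic_on_line:
  assumes "holomorphic_sv \<Omega> f" "\<And>s. s \<in> S \<Longrightarrow> z + s *s v \<in> \<Omega>"
  shows "(\<lambda>s. f (z + s *s v)) holomorphic_on S"
  unfolding holomorphic_on_def
proof
  fix x assume "x \<in> S"
  then obtain L where "(f has_derivative L) (at (z + x *s v))" "\<And>c v. L (c *s v) = c * L v"
    using holomorphic_svD[OF assms(1) assms(2)[of x]] by metis
  from line_field_derivative[OF this]
  show "(\<lambda>s. f (z + s *s v)) field_differentiable at x within S"
    using field_differentiable_at_within field_differentiable_def by blast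
qed

lemma continuous_smult [continuous_intros]:
  fixes g :: "'a::t2_space \<Rightarrow> complex ^ 'n::finite"
  assumes "continuous_on S f" "continuous_on S g"
  shows "continuous_on S (\<lambda>x. f x *s g x)"
proof -
  have "continuous_on S (\<lambda>x. \<chi> k. f x * g x $ k)"
    by (intro continuous_on_vec_lambda continuous_intros assms)
  then show ?thesis by (simp add: vector_scalar_mult_def)
qed

lemma norm_smult: "norm (c *s v) = norm c * norm v" for v :: "complex ^ 'n::finite"
  unfolding norm_vec_def L2_set_def
  by (simp add: norm_mult power_mult_distrib sum_distrib_left[symmetric] real_sqrt_mult)

text \<open>Cauchy's inequality on the complex line through \<open>z\<close> in direction \<open>v\<close>.\<close>

lemma cauchy_derivative_bound:
  assumes "holomorphic_sv \<Omega> f" "cball z r \<subseteq> \<Omega>" "r > 0"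
    and bound: "\<And>w. w \<in> cball z r \<Longrightarrow> norm (f w) \<le> M"
    and L: "(f has_derivative L) (at z)" "\<And>c v. L (c *s v) = c * L v"
  shows "norm (L v) \<le> M / r * norm v"
proof (cases "v = 0")
  case True
  then show ?thesis using L(2)[of 0 0] by simp
next
  case False
  define u where "u = complex_of_real (inverse (norm v)) *s v"
  have nu: "norm u = 1" using False by (simp add: u_def norm_smult norm_inverse)
  have in_ball: "z + s *s u \<in> cball z r" if "norm s \<le> r" for s
    using that by (simp add: dist_norm norm_smult nu)
  have "norm ((deriv ^^ 1) (\<lambda>s. f (z + s *s u)) 0) \<le> fact 1 * M / r ^ 1"
  proof (rule Cauchy_inequality)
    show "(\<lambda>s. f (z + s *s u)) holomorphic_on ball 0 r"
      by (rule holomorphic_on_line[OF assms(1)], rule subsetD[OF assms(2) in_ball]) simp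
    show "continuous_on (cball 0 r) (\<lambda>s. f (z + s *s u))"
      by (rule holomorphic_on_imp_continuous_on, rule holomorphic_on_line[OF assms(1)],
          rule subsetD[OF assms(2) in_ball]) simp
  qed (use assms(3) in_ball in \<open>auto intro!: bound\<close>)
  moreover have "deriv (\<lambda>s. f (z + s *s u)) 0 = L u"
    by (rule DERIV_imp_deriv, rule line_field_derivative) (use L in auto)
  ultimately have "norm (L u) \<le> M / r" by simp
  moreover have "v = complex_of_real (norm v) *s u" using False by (simp add: u_def vec_eq_iff)
  then have "L v = complex_of_real (norm v) * L u" using L(2)[of "complex_of_real (norm v)" u] by simp
  then have "norm (L v) = norm (L u) * norm v" by (simp add: norm_mult)
  ultimately show ?thesis using mult_right_mono[of "norm (L u)" "M / r" "norm v"] by simp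
qed

text \<open>By the Cauchy estimate the derivatives converge uniformly on a smaller ball, and uniform convergence of
functions and derivatives is enough to differentiate the limit.\<close>

lemma holomorphic_sv_uniform_limit:
  assumes hol: "\<And>n. holomorphic_sv \<Omega> (f n)" and "open \<Omega>"
    and lim: "\<And>z. z \<in> \<Omega> \<Longrightarrow> \<exists>r>0. cball z r \<subseteq> \<Omega> \<and> uniform_limit (cball z r) f g sequentially"
  shows "holomorphic_sv \<Omega> g"
  unfolding holomorphic_sv_def
proof
  fix z assume "z \<in> \<Omega>"
  then obtain r where r: "r > 0" "cball z r \<subseteq> \<Omega>" "uniform_limit (cball z r) f g sequentially"
    using lim by blast
  have "\<exists>L. (f n has_derivative L) (at x) \<and> (\<forall>c v. L (c *s v) = c * L v)" if "x \<in> \<Omega>" for n x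
    using hol[of n] that unfolding holomorphic_sv_def by (rule bspec)
  note ex = this
  define D where "D n x = (SOME L. (f n has_derivative L) (at x) \<and> (\<forall>c v. L (c *s v) = c * L v))" for n x
  have D: "(f n has_derivative D n x) (at x)" "D n x (c *s v) = c * D n x v" if "x \<in> \<Omega>" for n x c v
    using someI_ex[OF ex[OF that, of n]] unfolding D_def[symmetric] by auto
  define S where "S = ball z (r/2)"
  have S: "cball x (r/2) \<subseteq> cball z r" if "x \<in> S" for x
  proof
    fix y assume "y \<in> cball x (r/2)"
    then show "y \<in> cball z r" using that dist_triangle[of z y x] by (auto simp: S_def)
  qed
  have S\<Omega>: "x \<in> \<Omega>" if "x \<in> S" for x using S[OF that] r by force
  have cau: "\<exists>N. \<forall>m\<ge>N. \<forall>n\<ge>N. \<forall>x\<in>S. \<forall>v. norm (D m x v - D n x v) \<le> e * norm v" if "e > 0" for e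
  proof -
    have UC: "uniformly_Cauchy_on (cball z r) f"
      by (rule uniformly_convergent_Cauchy) (use r(3) in \<open>auto simp: uniformly_convergent_on_def\<close>)
    have "e * (r/2) > 0" using that r(1) by simp
    from UC[unfolded uniformly_Cauchy_on_def, rule_format, OF this]
    have "\<exists>N. \<forall>x\<in>cball z r. \<forall>m\<ge>N. \<forall>n\<ge>N. dist (f m x) (f n x) < e * (r/2)" .
    then obtain N where N: "\<And>m n x. m \<ge> N \<Longrightarrow> n \<ge> N \<Longrightarrow> x \<in> cball z r \<Longrightarrow> dist (f m x) (f n x) < e * (r/2)"
      by blast
    have "norm (D m x v - D n x v) \<le> e * norm v" if mn: "m \<ge> N" "n \<ge> N" "x \<in> S" for m n x v
    proof -
      have "norm (D m x v - D n x v) \<le> (e * (r/2)) / (r/2) * norm v"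
      proof (rule cauchy_derivative_bound[of \<Omega> "\<lambda>w. f m w - f n w" x "r/2" _ "\<lambda>v. D m x v - D n x v"])
        show "holomorphic_sv \<Omega> (\<lambda>w. f m w - f n w)" using hol by (intro holomorphic_sv_diff)
        show "((\<lambda>w. f m w - f n w) has_derivative (\<lambda>v. D m x v - D n x v)) (at x)"
          by (intro derivative_intros D S\<Omega> mn)
        show "cmod (f m w - f n w) \<le> e * (r / 2)" if "w \<in> cball x (r/2)" for w
          using N[OF mn(1,2), of w] S[OF mn(3)] that by (auto simp: dist_norm)
      qed (use S[OF mn(3)] r D(2)[OF S\<Omega>[OF mn(3)]] in \<open>auto simp: algebra_simps\<close>)
      then show ?thesis using r(1) by simp
    qed
    then show ?thesis by blast
  qed
  have conv: "convergent (\<lambda>n. D n x v)" if "x \<in> S" for x v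
  proof (rule Cauchy_convergent, rule CauchyI)
    fix e :: real assume "e > 0"
    then have "e / (norm v + 1) > 0" by (simp add: add_nonneg_pos)
    from cau[OF this] that obtain N where N: "\<forall>m\<ge>N. \<forall>n\<ge>N. norm (D m x v - D n x v) \<le> e / (norm v + 1) * norm v" by blast
    have "norm v + 1 > 0" by (simp add: add_nonneg_pos)
    then have "e / (norm v + 1) * norm v < e"
      using \<open>e > 0\<close> by (simp add: pos_divide_less_eq distrib_left)
    with N show "\<exists>N. \<forall>m\<ge>N. \<forall>n\<ge>N. norm (D m x v - D n x v) < e"
      by (intro exI[of _ N] allI impI) (rule le_less_trans, auto)
  qed
  define G where "G x v = lim (\<lambda>n. D n x v)" for x v
  have G: "(\<lambda>n. D n x v) \<longlonglongrightarrow> G x v" if "x \<in> S" for x v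
    using conv[OF that] unfolding G_def by (simp add: convergent_LIMSEQ_iff)
  have zS: "z \<in> S" using r by (simp add: S_def)
  have "\<exists>g'. \<forall>x\<in>S. (\<lambda>n. f n x) \<longlonglongrightarrow> g' x \<and> (g' has_derivative G x) (at x within S)"
  proof (rule has_derivative_sequence)
    show "convex S" by (simp add: S_def)
    show "(f n has_derivative D n x) (at x within S)" if "x \<in> S" for n x
      by (rule has_derivative_at_withinI) (rule D(1)[OF S\<Omega>[OF that]])
    show "\<forall>\<^sub>F n in sequentially. \<forall>x\<in>S. \<forall>h. norm (D n x h - G x h) \<le> e * norm h" if e: "e > 0" for e
    proof -
      obtain N where N: "\<forall>m\<ge>N. \<forall>n\<ge>N. \<forall>x\<in>S. \<forall>v. norm (D m x v - D n x v) \<le> e * norm v" using cau[OF e] by blast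
      have "norm (D n x h - G x h) \<le> e * norm h" if "n \<ge> N" "x \<in> S" for n x h
      proof (rule tendsto_upperbound)
        show "(\<lambda>m. norm (D n x h - D m x h)) \<longlonglongrightarrow> norm (D n x h - G x h)"
          by (intro tendsto_intros G that)
        show "\<forall>\<^sub>F m in sequentially. norm (D n x h - D m x h) \<le> e * norm h"
          using eventually_ge_at_top[of N] by eventually_elim (use N that in simp)
      qed simp
      then show ?thesis unfolding eventually_sequentially by blast
    qed
    show "(\<lambda>n. f n z) \<longlonglongrightarrow> g z"
      using tendsto_uniform_limitI[OF r(3)] r(1) by auto
  qed (rule zS)
  then obtain g' where g': "\<And>x. x \<in> S \<Longrightarrow> (\<lambda>n. f n x) \<longlonglongrightarrow> g' x" "\<And>x. x \<in> S \<Longrightarrow> (g' has_derivative G x) (at x within S)"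
    by blast
  have eq: "g' x = g x" if "x \<in> S" for x
  proof -
    have "x \<in> cball z r" using S[OF that] r(1) by force
    from tendsto_uniform_limitI[OF r(3) this] g'(1)[OF that] show ?thesis by (rule LIMSEQ_unique[THEN sym])
  qed
  have "(g' has_derivative G z) (at z)"
    using g'(2)[OF zS] at_within_open[OF zS] by (simp add: S_def)
  then have "(g has_derivative G z) (at z)"
    by (rule has_derivative_transform_within_open[of _ _ _ _ S]) (use zS eq in \<open>auto simp: S_def\<close>)
  moreover have "G z (c *s v) = c * G z v" for c v
  proof -
    have "(\<lambda>n. D n z (c *s v)) \<longlonglongrightarrow> c * G z v"
      unfolding D(2)[OF S\<Omega>[OF zS]] by (intro tendsto_intros G zS)
    with G[OF zS] show ?thesis by (rule LIMSEQ_unique)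
  qed
  ultimately show "\<exists>L. (g has_derivative L) (at z) \<and> (\<forall>c v. L (c *s v) = c * L v)"
    by (intro exI[of _ "G z"]) simp
qed

section \<open>The mean value inequality on polydiscs\<close>

definition polydisc :: "complex ^ 'n::finite \<Rightarrow> ('n \<Rightarrow> real) \<Rightarrow> (complex ^ 'n) set" where
  "polydisc z r = {w. \<forall>k. norm (w $ k - z $ k) < r k}"

lemma polydisc_borel [measurable]: "polydisc z r \<in> sets borel"
  unfolding polydisc_def by measurable

lemma prod_of_bool: "(\<Prod>k\<in>(UNIV::'n::finite set). of_bool (P k)) = (of_bool (\<forall>k. P k) :: ennreal)"
  by (cases "\<forall>k. P k") (auto intro: prod_zero)

lemma emeasure_polydisc:
  assumes "\<And>k. r k > 0"
  shows "emeasure lborel (polydisc z r) = ennreal (\<Prod>k\<in>UNIV. pi * (r k)\<^sup>2)"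
proof -
  have "emeasure lborel (polydisc z r) = (\<integral>\<^sup>+w. (\<Prod>k\<in>UNIV. indicator (ball (z $ k) (r k)) (w $ k)) \<partial>lborel)"
  proof -
    have "(\<integral>\<^sup>+w. (\<Prod>k\<in>UNIV. indicator (ball (z $ k) (r k)) (w $ k)) \<partial>lborel)
        = (\<integral>\<^sup>+w. indicator (polydisc z r) w \<partial>lborel)"
      by (intro nn_integral_cong) (auto simp: polydisc_def indicator_def dist_norm norm_minus_commute prod_of_bool)
    then show ?thesis by simp
  qed
  also have "\<dots> = (\<Prod>k\<in>UNIV. ennreal (pi * (r k)\<^sup>2))"
    by (subst nn_integral_vec_prod)
       (use assms in \<open>auto simp: emeasure_ball unit_ball_vol_2 less_imp_le intro!: borel_measurable_indicator\<close>)
  also have "\<dots> = ennreal (\<Prod>k\<in>UNIV. pi * (r k)\<^sup>2)" by (simp add: prod_ennreal)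
  finally show ?thesis .
qed

lemma nn_integral_rotate:
  fixes f :: "complex ^ 'n::finite \<Rightarrow> ennreal"
  assumes "f \<in> borel_measurable borel" "\<And>k. norm (a $ k) = 1"
  shows "(\<integral>\<^sup>+v. f (a * v) \<partial>lborel) = (\<integral>\<^sup>+v. f v \<partial>lborel)"
proof -
  have "a $ k \<noteq> 0" for k using assms(2)[of k] by force
  from nn_integral_vec_mult[OF this assms(1)] show ?thesis by (simp add: assms(2))
qed

lemma smult_vec: "c *s v = vec c * v" for v :: "complex ^ 'n::finite"
  by (simp add: vec_eq_iff)

text \<open>For a fixed point \<open>z + v\<close> of the polydisc, the mean value property on the circle \<open>z + \<lambda> v\<close>, \<open>|\<lambda>| = 1\<close>, bounds \<open>|f z|\<close>. Integrating
over \<open>v\<close> and using rotation invariance of Lebesgue measure gives the volume average. A single circle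
suffices, because polydiscs are balanced.\<close>

lemma polydisc_mean_value_inequality:
  fixes f :: "complex ^ 'n::finite \<Rightarrow> complex"
  assumes hol: "holomorphic_sv \<Omega> f" and "open \<Omega>" and sub: "polydisc z r \<subseteq> \<Omega>" and r: "\<And>k. r k > 0"
  shows "ennreal (norm (f z)) * emeasure lborel (polydisc z r)
     \<le> (\<integral>\<^sup>+w. indicator (polydisc z r) w * ennreal (norm (f w)) \<partial>lborel)"
proof -
  define g where "g w = (if w \<in> \<Omega> then f w else 0)" for w
  have [measurable]: "g \<in> borel_measurable borel"
    unfolding g_def using holomorphic_sv_continuous_on[OF hol] \<open>open \<Omega>\<close>
    by (intro borel_measurable_continuous_on_if) auto
  have sm[measurable]: "(\<lambda>x. h x *s k x) \<in> borel_measurable M"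
    if [measurable]: "h \<in> borel_measurable M" "k \<in> borel_measurable M" for h and k :: "'c \<Rightarrow> complex ^ 'n" and M :: "'c measure"
    unfolding vector_scalar_mult_def
    by (intro borel_measurable_vec_lambda borel_measurable_times that measurable_compose[OF that(2) borel_measurable_vec_nth])
  let ?V = "polydisc 0 r :: (complex ^ 'n) set"
  have inV: "z + v \<in> polydisc z r \<longleftrightarrow> v \<in> ?V" for v by (simp add: polydisc_def)
  have scale: "s *s v \<in> ?V" if "v \<in> ?V" "norm s \<le> 1" for s v
    using that by (auto simp: polydisc_def norm_mult intro: mult_left_le_one_le[THEN le_less_trans])
  have pt: "ennreal (norm (f z)) \<le> (\<integral>\<^sup>+t. indicator {0..1} t * ennreal (norm (g (z + unit_circle t *s v))) \<partial>lborel)"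
    if v: "v \<in> ?V" for v
  proof -
    define S where "S = {s. z + s *s v \<in> \<Omega>}"
    \<comment> \<open>The circle average needs holomorphy on a slightly larger disc.\<close>
    obtain R where R: "R > 1" "\<And>k. R * norm (v $ k) < r k"
    proof -
      have "\<exists>R>1. R * norm (v $ k) < r k" for k
      proof (cases "v $ k = 0")
        case True then show ?thesis using r by (auto intro!: exI[of _ 2])
      next
        case False
        then obtain R where "1 < R" "R < r k / norm (v $ k)"
          using v dense[of 1 "r k / norm (v $ k)"] by (auto simp: polydisc_def)
        then show ?thesis using False by (auto simp: field_simps)
      qed
      then obtain R where R: "\<And>k. R k > 1" "\<And>k. R k * norm (v $ k) < r k" by metis
      have "Min (range R) > 1" using R by (subst Min_gr_iff) auto
      moreover have "Min (range R) * norm (v $ k) < r k" for k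
        by (rule le_less_trans[OF mult_right_mono R(2)]) auto
      ultimately show ?thesis using that by blast
    qed
    have sub': "z + s *s v \<in> \<Omega>" if "s \<in> ball 0 R" for s
    proof -
      have "norm s * norm (v $ k) < r k" for k
        by (rule le_less_trans[OF mult_right_mono R(2)]) (use that in auto)
      then show ?thesis using sub by (auto simp: polydisc_def norm_mult)
    qed
    have "(\<lambda>s. f (z + s *s v)) holomorphic_on ball 0 R"
      by (rule holomorphic_on_line[OF hol sub'])
    then have I: "((\<lambda>t. f (z + unit_circle t *s v)) has_integral f (z + 0 *s v)) {0..1}"
      by (rule circle_mean[OF _ R(1)])
    have c: "continuous_on {0..1} (\<lambda>t. f (z + unit_circle t *s v))"
      by (rule continuous_on_compose2[OF holomorphic_sv_continuous_on[OF hol]])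
         (use R(1) in \<open>auto intro!: continuous_intros sub'\<close>)
    have "ennreal (norm (f z)) \<le> (\<integral>\<^sup>+t. indicator {0..1} t * ennreal (norm (f (z + unit_circle t *s v))) \<partial>lborel)"
      using nn_integral_cmod_has_integral[OF I c] by simp
    also have "\<dots> = (\<integral>\<^sup>+t. indicator {0..1} t * ennreal (norm (g (z + unit_circle t *s v))) \<partial>lborel)"
      using sub' R(1) by (intro nn_integral_cong) (auto simp: g_def)
    finally show ?thesis .
  qed
  have shift: "(\<integral>\<^sup>+w. h w \<partial>lborel) = (\<integral>\<^sup>+v. h (z + v) \<partial>lborel)" if [measurable]: "h \<in> borel_measurable borel"
    for h :: "complex ^ 'n \<Rightarrow> ennreal"
    by (subst lborel_distr_plus[symmetric, of z]) (simp add: nn_integral_distr)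
  have "ennreal (norm (f z)) * emeasure lborel (polydisc z r) = ennreal (norm (f z)) * emeasure lborel ?V"
    by (simp add: emeasure_polydisc r)
  also have "\<dots> = (\<integral>\<^sup>+v. indicator ?V v * ennreal (norm (f z)) \<partial>lborel)"
    by (simp add: nn_integral_cmult_indicator mult.commute[of "indicator ?V _"])
  also have "\<dots> \<le> (\<integral>\<^sup>+v. indicator ?V v * (\<integral>\<^sup>+t. indicator {0..1} t * ennreal (norm (g (z + unit_circle t *s v))) \<partial>lborel) \<partial>lborel)"
    using pt by (intro nn_integral_mono) (auto simp: indicator_def)
  also have "\<dots> = (\<integral>\<^sup>+v. (\<integral>\<^sup>+t. indicator ?V v * (indicator {0..1} t * ennreal (norm (g (z + unit_circle t *s v)))) \<partial>lborel) \<partial>lborel)"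
    by (intro nn_integral_cong nn_integral_cmult[symmetric]) measurable
  also have "\<dots> = (\<integral>\<^sup>+t. (\<integral>\<^sup>+v. indicator ?V v * (indicator {0..1} t * ennreal (norm (g (z + unit_circle t *s v)))) \<partial>lborel) \<partial>lborel)"
    by (rule lborel_pair.Fubini') measurable
  also have "\<dots> = (\<integral>\<^sup>+t. indicator {0..1} (t::real) * (\<integral>\<^sup>+v. indicator ?V v * ennreal (norm (g (z + v))) \<partial>lborel) \<partial>lborel)"
  proof (rule nn_integral_cong)
    fix t :: real
    have "indicator ?V (unit_circle t *s v) = (indicator ?V v :: ennreal)" for v
      by (simp add: indicator_def polydisc_def norm_mult)
    then have "(\<integral>\<^sup>+v. indicator ?V v * (indicator {0..1} t * ennreal (norm (g (z + unit_circle t *s v)))) \<partial>lborel)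
       = (\<integral>\<^sup>+v. indicator {0..1} t * (indicator ?V (unit_circle t *s v) * ennreal (norm (g (z + unit_circle t *s v)))) \<partial>lborel)"
      by (simp add: mult_ac)
    also have "\<dots> = indicator {0..1} t * (\<integral>\<^sup>+v. (indicator ?V (unit_circle t *s v) * ennreal (norm (g (z + unit_circle t *s v)))) \<partial>lborel)"
      by (intro nn_integral_cmult) measurable
    also have "(\<integral>\<^sup>+v. (indicator ?V (unit_circle t *s v) * ennreal (norm (g (z + unit_circle t *s v)))) \<partial>lborel)
       = (\<integral>\<^sup>+v. (indicator ?V v * ennreal (norm (g (z + v)))) \<partial>lborel)"
      unfolding smult_vec by (rule nn_integral_rotate) auto
    finally show "(\<integral>\<^sup>+v. indicator ?V v * (indicator {0..1} t * ennreal (norm (g (z + unit_circle t *s v)))) \<partial>lborel)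
      = indicator {0..1} t * (\<integral>\<^sup>+v. indicator ?V v * ennreal (norm (g (z + v))) \<partial>lborel)" .
  qed
  also have "\<dots> = (\<integral>\<^sup>+v. indicator ?V v * ennreal (norm (g (z + v))) \<partial>lborel)"
    by (simp add: nn_integral_multc)
  also have "\<dots> = (\<integral>\<^sup>+v. indicator (polydisc z r) (z + v) * ennreal (norm (g (z + v))) \<partial>lborel)"
    by (intro nn_integral_cong) (simp add: indicator_def inV)
  also have "\<dots> = (\<integral>\<^sup>+w. indicator (polydisc z r) w * ennreal (norm (g w)) \<partial>lborel)"
    by (subst shift[of "\<lambda>w. indicator (polydisc z r) w * ennreal (norm (g w))"]) auto
  also have "\<dots> = (\<integral>\<^sup>+w. indicator (polydisc z r) w * ennreal (norm (f w)) \<partial>lborel)"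
    using sub by (intro nn_integral_cong) (auto simp: g_def indicator_def)
  finally show ?thesis .
qed

text \<open>The previous inequality for the holomorphic function \<open>f\<^sup>2\<close>. The radii are independent, which is essential for
the removability theorem.\<close>

lemma polydisc_mean_square_inequality:
  fixes f :: "complex ^ 'n::finite \<Rightarrow> complex"
  assumes hol: "holomorphic_sv \<Omega> f" and "open \<Omega>" and sub: "polydisc z r \<subseteq> \<Omega>" and r: "\<And>k. r k > 0"
  shows "ennreal ((norm (f z))\<^sup>2) * ennreal (\<Prod>k\<in>UNIV. pi * (r k)\<^sup>2)
     \<le> (\<integral>\<^sup>+w. indicator (polydisc z r) w * ennreal ((norm (f w))\<^sup>2) \<partial>lborel)"
  using polydisc_mean_value_inequality[of \<Omega> "\<lambda>z. (f z)\<^sup>2" z r] assms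
  by (simp add: holomorphic_sv_power emeasure_polydisc norm_power)

section \<open>Existence of the Bergman kernel\<close>

lemma lebesgue_on_eq_lborel:
  fixes g :: "'a::euclidean_space \<Rightarrow> 'b::{banach, second_countable_topology}"
  assumes S: "S \<in> sets borel" and g: "(\<lambda>x. indicator S x *\<^sub>R g x) \<in> borel_measurable borel"
  shows "integrable (lebesgue_on S) g \<longleftrightarrow> integrable lborel (\<lambda>x. indicator S x *\<^sub>R g x)"
    and "(LINT x|lebesgue_on S. g x) = (LINT x|lborel. indicator S x *\<^sub>R g x)"
proof -
  have S': "S \<inter> space lebesgue \<in> sets lebesgue" using S by auto
  show "integrable (lebesgue_on S) g \<longleftrightarrow> integrable lborel (\<lambda>x. indicator S x *\<^sub>R g x)"
    using g by (subst integrable_restrict_space[OF S']) (simp add: integrable_completion)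
  show "(LINT x|lebesgue_on S. g x) = (LINT x|lborel. indicator S x *\<^sub>R g x)"
    using g by (subst integral_restrict_space[OF S']) (simp add: integral_completion)
qed

lemma nn_integral_lebesgue_on_eq_lborel:
  assumes S: "S \<in> sets borel" and g: "(\<lambda>x. g x * indicator S x) \<in> borel_measurable borel"
  shows "(\<integral>\<^sup>+x. g x \<partial>lebesgue_on S) = (\<integral>\<^sup>+x. g x * indicator S x \<partial>lborel)"
proof -
  have S': "S \<inter> space lebesgue \<in> sets lebesgue" using S by auto
  show ?thesis using g by (subst nn_integral_restrict_space[OF S']) (simp add: nn_integral_completion)
qed

lemma bergman_spaceD:
  assumes "f \<in> bergman_space \<Omega>"
  shows "holomorphic_sv \<Omega> f" "integrable (lebesgue_on \<Omega>) (\<lambda>z. (norm (f z))\<^sup>2)"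
  using assms by (auto simp: bergman_space_def)

lemma holomorphic_sv_measurable:
  "holomorphic_sv \<Omega> f \<Longrightarrow> open \<Omega> \<Longrightarrow> f \<in> borel_measurable (lebesgue_on \<Omega>)"
  by (intro continuous_imp_measurable_on_sets_lebesgue holomorphic_sv_continuous_on) auto

lemma holomorphic_sv_borel:
  "holomorphic_sv \<Omega> f \<Longrightarrow> open \<Omega> \<Longrightarrow> (\<lambda>x. indicator \<Omega> x *\<^sub>R f x) \<in> borel_measurable borel"
  by (intro borel_measurable_continuous_on_indicator holomorphic_sv_continuous_on) auto

lemma holomorphic_sv_borel_nn:
  assumes "holomorphic_sv \<Omega> f" "open \<Omega>"
  shows "(\<lambda>x. ennreal ((norm (f x))\<^sup>2) * indicator \<Omega> x) \<in> borel_measurable borel"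
proof -
  note [measurable] = holomorphic_sv_borel[OF assms]
  have "(\<lambda>x. ennreal ((norm (f x))\<^sup>2) * indicator \<Omega> x) = (\<lambda>x. ennreal ((norm (indicator \<Omega> x *\<^sub>R f x))\<^sup>2))"
    by (auto simp: fun_eq_iff indicator_def)
  also have "\<dots> \<in> borel_measurable borel" by measurable
  finally show ?thesis .
qed

lemma bergman_space_iff:
  assumes "open \<Omega>"
  shows "f \<in> bergman_space \<Omega> \<longleftrightarrow> holomorphic_sv \<Omega> f \<and>
     (\<integral>\<^sup>+z. ennreal ((norm (f z))\<^sup>2) * indicator \<Omega> z \<partial>lborel) < \<infinity>"
proof (cases "holomorphic_sv \<Omega> f")
  case True
  have "(\<lambda>z. (norm (f z))\<^sup>2) \<in> borel_measurable (lebesgue_on \<Omega>)"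
    using holomorphic_sv_measurable[OF True assms] by measurable
  then have "integrable (lebesgue_on \<Omega>) (\<lambda>z. (norm (f z))\<^sup>2) \<longleftrightarrow> (\<integral>\<^sup>+z. ennreal ((norm (f z))\<^sup>2) \<partial>lebesgue_on \<Omega>) < \<infinity>"
    by (simp add: integrable_iff_bounded)
  also have "\<dots> \<longleftrightarrow> (\<integral>\<^sup>+z. ennreal ((norm (f z))\<^sup>2) * indicator \<Omega> z \<partial>lborel) < \<infinity>"
    using assms by (subst nn_integral_lebesgue_on_eq_lborel) (auto intro!: holomorphic_sv_borel_nn True)
  finally show ?thesis using True by (simp add: bergman_space_def)
qed (simp add: bergman_space_def)

lemma bergman_space_integral:
  assumes "open \<Omega>" "f \<in> bergman_space \<Omega>"
  shows "ennreal (LINT z|lebesgue_on \<Omega>. (norm (f z))\<^sup>2) = (\<integral>\<^sup>+z. ennreal ((norm (f z))\<^sup>2) * indicator \<Omega> z \<partial>lborel)"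
  using assms
  by (subst nn_integral_lebesgue_on_eq_lborel[symmetric])
     (auto intro!: holomorphic_sv_borel_nn nn_integral_eq_integral[symmetric] dest: bergman_spaceD)

lemma bergman_space_prod_integrable:
  assumes "open \<Omega>" and f: "f \<in> bergman_space \<Omega>" and g: "g \<in> bergman_space \<Omega>"
  shows "integrable (lebesgue_on \<Omega>) (\<lambda>z. f z * cnj (g z))"
proof (rule Bochner_Integration.integrable_bound)
  show "integrable (lebesgue_on \<Omega>) (\<lambda>z. (norm (f z))\<^sup>2 + (norm (g z))\<^sup>2)"
    using bergman_spaceD[OF f] bergman_spaceD[OF g] by simp
  show "(\<lambda>z. f z * cnj (g z)) \<in> borel_measurable (lebesgue_on \<Omega>)"
    using bergman_spaceD[OF f] bergman_spaceD[OF g] holomorphic_sv_measurable assms(1)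
    by (intro borel_measurable_times) (auto intro!: measurable_compose[OF _ borel_measurable_continuous_onI[of cnj]] continuous_intros)
  have "norm (f z * cnj (g z)) \<le> (norm (f z))\<^sup>2 + (norm (g z))\<^sup>2" for z
  proof -
    have "2 * norm (f z) * norm (g z) \<le> (norm (f z))\<^sup>2 + (norm (g z))\<^sup>2" by (rule sum_squares_bound)
    moreover have "0 \<le> norm (f z) * norm (g z)" by simp
    ultimately show ?thesis unfolding norm_mult complex_mod_cnj by linarith
  qed
  then show "AE z in lebesgue_on \<Omega>. norm (f z * cnj (g z)) \<le> norm ((norm (f z))\<^sup>2 + (norm (g z))\<^sup>2)"
    by simp
qed

text \<open>The expansion of the square of a norm, in the form used for both the parallelogram law and variations.\<close>

lemma bergman_space_combination:
  assumes "open \<Omega>" and f: "f \<in> bergman_space \<Omega>" and g: "g \<in> bergman_space \<Omega>"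
  shows "(\<lambda>z. f z + c * g z) \<in> bergman_space \<Omega>"
    and "(LINT z|lebesgue_on \<Omega>. (norm (f z + c * g z))\<^sup>2)
       = (LINT z|lebesgue_on \<Omega>. (norm (f z))\<^sup>2) + 2 * Re (c * (LINT z|lebesgue_on \<Omega>. g z * cnj (f z)))
         + (norm c)\<^sup>2 * (LINT z|lebesgue_on \<Omega>. (norm (g z))\<^sup>2)"
proof -
  have eq: "(norm (f z + c * g z))\<^sup>2 = (norm (f z))\<^sup>2 + 2 * Re (c * (g z * cnj (f z))) + (norm c)\<^sup>2 * (norm (g z))\<^sup>2" for z
    unfolding power_mult_distrib[symmetric] norm_mult[symmetric] cmod_power2
    by (simp add: power2_eq_square algebra_simps)
  have i: "integrable (lebesgue_on \<Omega>) (\<lambda>z. Re (c * (g z * cnj (f z))))"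
    by (intro integrable_Re integrable_mult_right bergman_space_prod_integrable assms)
  show "(\<lambda>z. f z + c * g z) \<in> bergman_space \<Omega>"
    unfolding bergman_space_def mem_Collect_eq eq
    by (intro conjI holomorphic_sv_add holomorphic_sv_mult Bochner_Integration.integrable_add integrable_mult_right i
          holomorphic_sv_const bergman_spaceD[OF f] bergman_spaceD[OF g])
  show "(LINT z|lebesgue_on \<Omega>. (norm (f z + c * g z))\<^sup>2)
       = (LINT z|lebesgue_on \<Omega>. (norm (f z))\<^sup>2) + 2 * Re (c * (LINT z|lebesgue_on \<Omega>. g z * cnj (f z)))
         + (norm c)\<^sup>2 * (LINT z|lebesgue_on \<Omega>. (norm (g z))\<^sup>2)"
  proof -
    define p where "p z = c * (g z * cnj (f z))" for z
    have ip: "integrable (lebesgue_on \<Omega>) p"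
      unfolding p_def by (intro integrable_mult_right bergman_space_prod_integrable assms)
    have "(LINT z|lebesgue_on \<Omega>. p z) = c * (LINT z|lebesgue_on \<Omega>. g z * cnj (f z))"
      by (simp add: p_def)
    then have "(LINT z|lebesgue_on \<Omega>. Re (p z)) = Re (c * (LINT z|lebesgue_on \<Omega>. g z * cnj (f z)))"
      using ip by simp
    moreover have "integrable (lebesgue_on \<Omega>) (\<lambda>z. Re (p z))" using ip by simp
    ultimately show ?thesis
      unfolding eq p_def[symmetric] using bergman_spaceD[OF f] bergman_spaceD[OF g]
      by (simp del: times_complex.simps)
  qed
qed

lemma norm_le_sum_components: "norm v \<le> (\<Sum>k\<in>UNIV. norm (v $ k))" for v :: "complex ^ 'n::finite"
  unfolding norm_vec_def by (rule L2_set_le_sum) auto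

lemma polydisc_subset_ball:
  assumes "s > 0" "real CARD('n) * s \<le> r"
  shows "polydisc w (\<lambda>_. s) \<subseteq> ball (w :: complex ^ 'n::finite) r"
proof
  fix v assume v: "v \<in> polydisc w (\<lambda>_. s)"
  have "norm (v - w) \<le> (\<Sum>k\<in>UNIV. norm ((v - w) $ k))" by (rule norm_le_sum_components)
  also have "\<dots> < (\<Sum>k\<in>(UNIV::'n set). s)"
    using v by (intro sum_strict_mono) (auto simp: polydisc_def)
  also have "\<dots> \<le> r" using assms by simp
  finally show "v \<in> ball w r" by (simp add: dist_norm norm_minus_commute)
qed

text \<open>Polydiscs of a fixed size fit around all points near \<open>z\<close>, so the mean square inequality is locally uniform.\<close>

lemma bergman_evaluation_bound:
  fixes \<Omega> :: "(complex ^ 'n::finite) set"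
  assumes "open \<Omega>" "z \<in> \<Omega>"
  obtains r C where "r > 0" "C > 0" "cball z r \<subseteq> \<Omega>"
    "\<And>f w. f \<in> bergman_space \<Omega> \<Longrightarrow> w \<in> cball z r \<Longrightarrow>
        (norm (f w))\<^sup>2 \<le> C * (LINT z|lebesgue_on \<Omega>. (norm (f z))\<^sup>2)"
proof -
  obtain \<rho> where \<rho>: "\<rho> > 0" "ball z \<rho> \<subseteq> \<Omega>" using assms open_contains_ball by blast
  define s where "s = \<rho> / (2 * real CARD('n))"
  have s: "s > 0" "real CARD('n) * s \<le> \<rho> / 2" using \<rho> by (auto simp: s_def)
  define V where "V = (\<Prod>k\<in>(UNIV::'n set). pi * s\<^sup>2)"
  have V: "V > 0" unfolding V_def using s by (intro prod_pos) auto
  show thesis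
  proof (rule that)
    show "\<rho> / 3 > 0" "cball z (\<rho> / 3) \<subseteq> \<Omega>" using \<rho> by force+
    show "1 / V > 0" using V by simp
    fix f w assume f: "f \<in> bergman_space \<Omega>" and w: "w \<in> cball z (\<rho> / 3)"
    have "polydisc w (\<lambda>_. s) \<subseteq> ball w (\<rho> / 2)" by (rule polydisc_subset_ball) (use s in auto)
    also have "\<dots> \<subseteq> ball z \<rho>"
    proof
      fix x assume "x \<in> ball w (\<rho> / 2)"
      then show "x \<in> ball z \<rho>" using w \<rho>(1) dist_triangle[of z x w] by auto
    qed
    finally have sub: "polydisc w (\<lambda>_. s) \<subseteq> \<Omega>" using \<rho> by auto
    have "ennreal ((norm (f w))\<^sup>2) * ennreal V \<le> (\<integral>\<^sup>+x. indicator (polydisc w (\<lambda>_. s)) x * ennreal ((norm (f x))\<^sup>2) \<partial>lborel)"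
      unfolding V_def using bergman_spaceD[OF f] assms sub s by (intro polydisc_mean_square_inequality) auto
    also have "\<dots> \<le> (\<integral>\<^sup>+x. ennreal ((norm (f x))\<^sup>2) * indicator \<Omega> x \<partial>lborel)"
      using sub by (intro nn_integral_mono) (auto simp: indicator_def)
    also have "\<dots> = ennreal (LINT z|lebesgue_on \<Omega>. (norm (f z))\<^sup>2)"
      by (rule bergman_space_integral[symmetric]) (use assms f in auto)
    finally have "ennreal ((norm (f w))\<^sup>2 * V) \<le> ennreal (LINT z|lebesgue_on \<Omega>. (norm (f z))\<^sup>2)"
      using V by (simp add: ennreal_mult')
    then have "(norm (f w))\<^sup>2 * V \<le> (LINT z|lebesgue_on \<Omega>. (norm (f z))\<^sup>2)"
      by (subst (asm) ennreal_le_iff) (auto intro!: Bochner_Integration.integral_nonneg)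
    then show "(norm (f w))\<^sup>2 \<le> 1 / V * (LINT z|lebesgue_on \<Omega>. (norm (f z))\<^sup>2)"
      using V by (simp add: field_simps)
  qed
qed

text \<open>Completeness: evaluation bounds turn Cauchy sequences in the norm into locally uniform ones, and Fatou's
lemma controls the norm of the limit.\<close>

lemma bergman_space_cauchy_limit:
  fixes \<Omega> :: "(complex ^ 'n::finite) set" and f :: "nat \<Rightarrow> complex ^ 'n \<Rightarrow> complex"
  assumes "open \<Omega>" and f: "\<And>n. f n \<in> bergman_space \<Omega>"
    and cau: "\<And>e. e > 0 \<Longrightarrow> \<exists>M. \<forall>m\<ge>M. \<forall>n\<ge>M. (LINT z|lebesgue_on \<Omega>. (norm (f m z - f n z))\<^sup>2) \<le> e"
    and bound: "\<And>n. (LINT z|lebesgue_on \<Omega>. (norm (f n z))\<^sup>2) \<le> b n" and b: "b \<longlonglongrightarrow> c"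
  obtains g where "g \<in> bergman_space \<Omega>" "\<And>z. z \<in> \<Omega> \<Longrightarrow> (\<lambda>n. f n z) \<longlonglongrightarrow> g z"
    "(LINT z|lebesgue_on \<Omega>. (norm (g z))\<^sup>2) \<le> c"
proof -
  define g where "g z = lim (\<lambda>n. f n z)" for z
  have diff: "(\<lambda>z. f m z - f n z) \<in> bergman_space \<Omega>" for m n
    using bergman_space_combination(1)[OF assms(1) f[of m] f[of n], of "-1"] by simp
  have unif: "\<exists>r>0. cball z r \<subseteq> \<Omega> \<and> uniform_limit (cball z r) f g sequentially" if "z \<in> \<Omega>" for z
  proof -
    obtain r C where r: "r > 0" "C > 0" "cball z r \<subseteq> \<Omega>"
      "\<And>f w. f \<in> bergman_space \<Omega> \<Longrightarrow> w \<in> cball z r \<Longrightarrow>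
        (norm (f w))\<^sup>2 \<le> C * (LINT z|lebesgue_on \<Omega>. (norm (f z))\<^sup>2)"
      using bergman_evaluation_bound[OF assms(1) \<open>z \<in> \<Omega>\<close>] by metis
    have "uniformly_Cauchy_on (cball z r) f"
      unfolding uniformly_Cauchy_on_def
    proof (intro allI impI)
      fix e :: real assume e: "e > 0"
      then have "e\<^sup>2 / (2 * C) > 0" using r by simp
      from cau[OF this] obtain M where M: "\<And>m n. m \<ge> M \<Longrightarrow> n \<ge> M \<Longrightarrow>
          (LINT z|lebesgue_on \<Omega>. (norm (f m z - f n z))\<^sup>2) \<le> e\<^sup>2 / (2 * C)" by blast
      have "dist (f m x) (f n x) < e" if "x \<in> cball z r" "m \<ge> M" "n \<ge> M" for x m n
      proof -
        have "(norm (f m x - f n x))\<^sup>2 \<le> C * (LINT z|lebesgue_on \<Omega>. (norm (f m z - f n z))\<^sup>2)"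
          by (rule r(4)[OF diff that(1)])
        also have "\<dots> \<le> C * (e\<^sup>2 / (2 * C))"
          using M[OF that(2,3)] r(2) by (intro mult_left_mono) auto
        also have "\<dots> < e\<^sup>2" using e r(2) by simp
        finally have "norm (f m x - f n x) < e" using e by (rule_tac power2_less_imp_less) auto
        then show ?thesis by (simp add: dist_norm)
      qed
      then show "\<exists>M. \<forall>x\<in>cball z r. \<forall>m\<ge>M. \<forall>n\<ge>M. dist (f m x) (f n x) < e" by blast
    qed
    then have "uniformly_convergent_on (cball z r) f" by (rule Cauchy_uniformly_convergent)
    then have "uniform_limit (cball z r) f g sequentially"
      unfolding g_def by (simp add: uniformly_convergent_uniform_limit_iff)
    then show ?thesis using r by blast
  qed
  have hol: "holomorphic_sv \<Omega> g"
    by (rule holomorphic_sv_uniform_limit[OF _ assms(1) unif]) (use f in \<open>auto dest: bergman_spaceD\<close>)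
  have lim: "(\<lambda>n. f n z) \<longlonglongrightarrow> g z" if z: "z \<in> \<Omega>" for z
  proof -
    obtain r where "r > 0" "uniform_limit (cball z r) f g sequentially" using unif[OF z] by blast
    then show ?thesis by (intro tendsto_uniform_limitI) auto
  qed
  have "(\<integral>\<^sup>+z. ennreal ((norm (g z))\<^sup>2) \<partial>lebesgue_on \<Omega>)
      = (\<integral>\<^sup>+z. liminf (\<lambda>n. ennreal ((norm (f n z))\<^sup>2)) \<partial>lebesgue_on \<Omega>)"
  proof (rule nn_integral_cong)
    fix z assume "z \<in> space (lebesgue_on \<Omega>)"
    then have "z \<in> \<Omega>" by simp
    then have "(\<lambda>n. ennreal ((norm (f n z))\<^sup>2)) \<longlonglongrightarrow> ennreal ((norm (g z))\<^sup>2)"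
      by (intro tendsto_intros lim)
    then show "ennreal ((norm (g z))\<^sup>2) = liminf (\<lambda>n. ennreal ((norm (f n z))\<^sup>2))"
      by (intro lim_imp_Liminf[symmetric]) auto
  qed
  also have "\<dots> \<le> liminf (\<lambda>n. \<integral>\<^sup>+z. ennreal ((norm (f n z))\<^sup>2) \<partial>lebesgue_on \<Omega>)"
  proof (rule nn_integral_liminf)
    fix n
    show "(\<lambda>z. ennreal ((norm (f n z))\<^sup>2)) \<in> borel_measurable (lebesgue_on \<Omega>)"
      using holomorphic_sv_measurable[OF bergman_spaceD(1)[OF f[of n]] assms(1)] by measurable
  qed
  also have "\<dots> \<le> liminf (\<lambda>n. ennreal (b n))"
  proof (rule Liminf_mono, rule always_eventually, rule allI)
    fix n
    have "(\<integral>\<^sup>+z. ennreal ((norm (f n z))\<^sup>2) \<partial>lebesgue_on \<Omega>) = ennreal (LINT z|lebesgue_on \<Omega>. (norm (f n z))\<^sup>2)"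
      using bergman_spaceD(2)[OF f[of n]] by (intro nn_integral_eq_integral) auto
    then show "(\<integral>\<^sup>+z. ennreal ((norm (f n z))\<^sup>2) \<partial>lebesgue_on \<Omega>) \<le> ennreal (b n)"
      using bound[of n] by (simp add: ennreal_leI)
  qed
  also have "\<dots> = ennreal c"
    by (intro lim_imp_Liminf tendsto_ennrealI b) auto
  finally have le: "(\<integral>\<^sup>+z. ennreal ((norm (g z))\<^sup>2) \<partial>lebesgue_on \<Omega>) \<le> ennreal c" .
  have int: "integrable (lebesgue_on \<Omega>) (\<lambda>z. (norm (g z))\<^sup>2)"
  proof (rule integrableI_nonneg)
    show "(\<lambda>z. (norm (g z))\<^sup>2) \<in> borel_measurable (lebesgue_on \<Omega>)"
      using holomorphic_sv_measurable[OF hol assms(1)] by measurable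
    show "(\<integral>\<^sup>+z. ennreal ((norm (g z))\<^sup>2) \<partial>lebesgue_on \<Omega>) < \<infinity>"
      using le by (rule le_less_trans) simp
  qed simp
  have "c \<ge> 0"
  proof (rule LIMSEQ_le_const[OF b], intro exI allI impI)
    show "0 \<le> b n" for n by (rule order_trans[OF _ bound[of n]]) (simp add: Bochner_Integration.integral_nonneg)
  qed
  show thesis
  proof (rule that)
    show "g \<in> bergman_space \<Omega>" using hol int by (simp add: bergman_space_def)
    show "(LINT z|lebesgue_on \<Omega>. (norm (g z))\<^sup>2) \<le> c"
      using le \<open>c \<ge> 0\<close> by (subst (asm) nn_integral_eq_integral[OF int]) auto
  qed (rule lim)
qed

text \<open>The Riesz representation of evaluation at \<open>z\<close>. Among the functions with value 1 at \<open>z\<close> there is one of minimal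
norm; by minimality it is orthogonal to all functions vanishing at \<open>z\<close>, and a multiple of it represents the
evaluation. If no such function exists then the evaluation is zero.\<close>

lemma bergman_riesz:
  fixes \<Omega> :: "(complex ^ 'n::finite) set"
  assumes "open \<Omega>" "z \<in> \<Omega>"
  shows "\<exists>k\<in>bergman_space \<Omega>. \<forall>f\<in>bergman_space \<Omega>. f z = (LINT w|lebesgue_on \<Omega>. f w * cnj (k w))"
proof -
  define N where "N f = (LINT w|lebesgue_on \<Omega>. (norm (f w :: complex))\<^sup>2)" for f
  define ip where "ip f g = (LINT w|lebesgue_on \<Omega>. f w * cnj (g w))" for f g :: "complex ^ 'n \<Rightarrow> complex"
  have N0: "N f \<ge> 0" for f unfolding N_def by (rule Bochner_Integration.integral_nonneg) simp
  have comb: "(\<lambda>w. f w + c * g w) \<in> bergman_space \<Omega>"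
     "N (\<lambda>w. f w + c * g w) = N f + 2 * Re (c * ip g f) + (norm c)\<^sup>2 * N g"
    if "f \<in> bergman_space \<Omega>" "g \<in> bergman_space \<Omega>" for f g c
    unfolding N_def ip_def using bergman_space_combination[OF assms(1) that] by auto
  obtain r C where C: "C > 0" "r > (0::real)"
      "\<And>f w. f \<in> bergman_space \<Omega> \<Longrightarrow> w \<in> cball z r \<Longrightarrow> (norm (f w))\<^sup>2 \<le> C * N f"
    using bergman_evaluation_bound[OF assms] unfolding N_def by metis
  define S where "S = {f \<in> bergman_space \<Omega>. f z = 1}"
  have zero: "(\<lambda>_. 0) \<in> bergman_space \<Omega>" by (auto simp: bergman_space_def)
  show ?thesis
  proof (cases "S = {}")
    case True
    have "f z = 0" if "f \<in> bergman_space \<Omega>" for f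
    proof (rule ccontr)
      assume "f z \<noteq> 0"
      then have "(\<lambda>w. 0 + inverse (f z) * f w) \<in> S" using comb(1)[OF zero that] by (simp add: S_def)
      then show False using True by blast
    qed
    then show ?thesis by (intro bexI[OF _ zero]) auto
  next
    case False
    define I where "I = Inf (N ` S)"
    have bdd: "bdd_below (N ` S)" by (rule bdd_belowI[of _ 0]) (auto simp: N0)
    have I_le: "I \<le> N f" if "f \<in> S" for f unfolding I_def by (rule cInf_lower) (use that bdd in auto)
    have "\<exists>f\<in>S. N f < I + inverse (real (Suc n))" for n
    proof -
      have "Inf (N ` S) < I + inverse (real (Suc n))" by (simp add: I_def)
      then show ?thesis using cInf_lessD[of "N ` S"] False by auto
    qed
    then obtain F where F: "\<And>n. F n \<in> S" "\<And>n. N (F n) < I + inverse (real (Suc n))" by metis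
    have FA: "F n \<in> bergman_space \<Omega>" "F n z = 1" for n using F(1)[of n] by (auto simp: S_def)
    have est: "N (\<lambda>w. F m w - F n w) \<le> 2 * inverse (real (Suc m)) + 2 * inverse (real (Suc n))" for m n
    proof -
      \<comment> \<open>Midpoints lie in \<open>S\<close>, so the parallelogram law makes the minimizing sequence Cauchy.\<close>
      have mid: "(\<lambda>w. 0 + (1/2) * (F m w + 1 * F n w)) \<in> S"
        using comb(1)[OF zero comb(1)[OF FA(1)[of m] FA(1)[of n], of 1], of "1/2"] FA(2) by (simp add: S_def)
      have "N (\<lambda>w. 0 + (1/2) * (F m w + 1 * F n w)) = N (\<lambda>_. 0) + 2 * Re ((1/2) * ip (\<lambda>w. F m w + 1 * F n w) (\<lambda>_. 0))
           + (norm (1/2::complex))\<^sup>2 * N (\<lambda>w. F m w + 1 * F n w)"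
        by (rule comb(2)[OF zero comb(1)[OF FA(1) FA(1)]])
      then have "4 * I \<le> N (\<lambda>w. F m w + 1 * F n w)"
        using I_le[OF mid] by (simp add: N_def ip_def power2_eq_square norm_divide)
      moreover have "N (\<lambda>w. F m w + 1 * F n w) + N (\<lambda>w. F m w + (-1) * F n w) = 2 * N (F m) + 2 * N (F n)"
        using comb(2)[OF FA(1)[of m] FA(1)[of n], of 1] comb(2)[OF FA(1)[of m] FA(1)[of n], of "-1"] by simp
      ultimately show ?thesis using F(2)[of m] F(2)[of n] by simp
    qed
    obtain f where f: "f \<in> bergman_space \<Omega>" "\<And>w. w \<in> \<Omega> \<Longrightarrow> (\<lambda>n. F n w) \<longlonglongrightarrow> f w" "N f \<le> I"
    proof (rule bergman_space_cauchy_limit[OF assms(1) FA(1)])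
      fix e :: real assume e: "e > 0"
      obtain M where M: "inverse (real (Suc M)) < e / 4" using reals_Archimedean[of "e/4"] e by auto
      have "N (\<lambda>w. F m w - F n w) \<le> e" if "m \<ge> M" "n \<ge> M" for m n
      proof -
        have "inverse (real (Suc m)) \<le> inverse (real (Suc M))" "inverse (real (Suc n)) \<le> inverse (real (Suc M))"
          using that by (auto intro!: le_imp_inverse_le)
        then show ?thesis using est[of m n] M by linarith
      qed
      then show "\<exists>M. \<forall>m\<ge>M. \<forall>n\<ge>M. (LINT z|lebesgue_on \<Omega>. (norm (F m z - F n z))\<^sup>2) \<le> e"
        unfolding N_def by blast
    next
      show "(LINT z|lebesgue_on \<Omega>. (norm (F n z))\<^sup>2) \<le> I + inverse (real (Suc n))" for n
        using F(2)[of n] by (simp add: N_def)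
      show "(\<lambda>n. I + inverse (real (Suc n))) \<longlonglongrightarrow> I"
        using tendsto_add[OF tendsto_const[of I] LIMSEQ_inverse_real_of_nat] by simp
    qed (auto simp: N_def intro: that)
    have fz: "f z = 1"
      using LIMSEQ_unique[OF f(2)[OF assms(2)]] by (simp add: FA(2))
    have fS: "f \<in> S" using f fz by (simp add: S_def)
    have NfI: "N f = I" using I_le[OF fS] f(3) by simp
    have Nf: "N f > 0"
    proof (rule ccontr)
      assume "\<not> N f > 0"
      then have "N f = 0" using N0[of f] by simp
      then show False using C(3)[OF f(1), of z] C(2) fz by simp
    qed
    have orth: "ip h f = 0" if h: "h \<in> bergman_space \<Omega>" "h z = 0" for h
    proof (rule ccontr)
      assume nz: "ip h f \<noteq> 0"
      define d where "d = N h + 1"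
      have d: "d > 0" "N h < d" using N0[of h] by (auto simp: d_def)
      \<comment> \<open>A small step in the direction that decreases the norm to first order.\<close>
      define c where "c = - cnj (ip h f) / of_real d"
      have "N f \<le> N (\<lambda>w. f w + c * h w)"
        unfolding NfI by (rule I_le) (use comb(1)[OF f(1) h(1)] fz h(2) in \<open>simp add: S_def\<close>)
      also have "\<dots> = N f + 2 * Re (c * ip h f) + (norm c)\<^sup>2 * N h" by (rule comb(2)[OF f(1) h(1)])
      finally have *: "0 \<le> 2 * Re (c * ip h f) + (norm c)\<^sup>2 * N h" by simp
      have "c * ip h f = - of_real ((norm (ip h f))\<^sup>2 / d)"
        using complex_norm_square[of "ip h f"] by (simp add: c_def mult.commute)
      then have re: "Re (c * ip h f) = - ((norm (ip h f))\<^sup>2 / d)" by (simp del: of_real_divide of_real_power)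
      have nc: "(norm c)\<^sup>2 = (norm (ip h f))\<^sup>2 / d\<^sup>2"
        using d by (simp add: c_def norm_divide power_divide)
      have "(norm c)\<^sup>2 * N h \<le> (norm c)\<^sup>2 * d" using d by (intro mult_left_mono) auto
      also have "\<dots> = (norm (ip h f))\<^sup>2 / d" unfolding nc using d by (simp add: power2_eq_square)
      finally have "0 \<le> - ((norm (ip h f))\<^sup>2 / d)" using * re by simp
      moreover have "(norm (ip h f))\<^sup>2 / d > 0" using nz d by simp
      ultimately show False by simp
    qed
    define k where "k w = 0 + of_real (inverse (N f)) * f w" for w
    have kA: "k \<in> bergman_space \<Omega>" unfolding k_def by (rule comb(1)[OF zero f(1)])
    have "g z = ip g k" if g: "g \<in> bergman_space \<Omega>" for g
    proof -
      have "ip (\<lambda>w. g w + (- g z) * f w) f = 0"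
        by (rule orth[OF comb(1)[OF g f(1)]]) (simp add: fz)
      moreover have "ip (\<lambda>w. g w + (- g z) * f w) f = ip g f - g z * ip f f"
      proof -
        have "ip (\<lambda>w. g w + (- g z) * f w) f
            = (LINT w|lebesgue_on \<Omega>. g w * cnj (f w) - g z * (f w * cnj (f w)))"
          unfolding ip_def by (simp add: algebra_simps)
        also have "\<dots> = ip g f - (LINT w|lebesgue_on \<Omega>. g z * (f w * cnj (f w)))"
          unfolding ip_def
          by (intro Bochner_Integration.integral_diff integrable_mult_right bergman_space_prod_integrable assms g f(1))
        finally show ?thesis by (simp add: ip_def)
      qed
      moreover have "ip f f = of_real (N f)"
        unfolding ip_def N_def complex_norm_square[symmetric] by (simp add: integral_complex_of_real del: of_real_power)
      moreover have "ip g k = of_real (inverse (N f)) * ip g f"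
      proof -
        have "ip g k = (LINT w|lebesgue_on \<Omega>. of_real (inverse (N f)) * (g w * cnj (f w)))"
          unfolding ip_def k_def by (simp add: mult_ac)
        then show ?thesis by (simp add: ip_def)
      qed
      ultimately have "of_real (N f) * g z = of_real (N f) * ip g k"
        using Nf by (simp add: field_simps)
      then show ?thesis using Nf by simp
    qed
    with kA show ?thesis unfolding ip_def by blast
  qed
qed

theorem bergman_kernel_is_kernel:
  fixes \<Omega> :: "(complex ^ 'n::finite) set"
  assumes "open \<Omega>"
  shows "is_bergman_kernel \<Omega> (bergman_kernel \<Omega>)"
proof -
  from bergman_riesz[OF assms]
  obtain k where k: "\<And>z. z \<in> \<Omega> \<Longrightarrow> k z \<in> bergman_space \<Omega>"
    "\<And>z f. z \<in> \<Omega> \<Longrightarrow> f \<in> bergman_space \<Omega> \<Longrightarrow> f z = (LINT w|lebesgue_on \<Omega>. f w * cnj (k z w))"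
    by metis
  define K where "K z w = (if z \<in> \<Omega> \<and> w \<in> \<Omega> then k w z else 0)" for z w
  have "is_bergman_kernel \<Omega> K"
    unfolding is_bergman_kernel_def
  proof (intro conjI ballI allI impI)
    fix w assume w: "w \<in> \<Omega>"
    have "holomorphic_sv \<Omega> (\<lambda>z. K z w)"
      by (rule holomorphic_sv_cong[OF bergman_spaceD(1)[OF k(1)[OF w]] assms]) (use w in \<open>simp add: K_def\<close>)
    moreover have "integrable (lebesgue_on \<Omega>) (\<lambda>z. (norm (K z w))\<^sup>2) = integrable (lebesgue_on \<Omega>) (\<lambda>z. (norm (k w z))\<^sup>2)"
      by (rule Bochner_Integration.integrable_cong) (use w in \<open>auto simp: K_def\<close>)
    ultimately show "(\<lambda>z. K z w) \<in> bergman_space \<Omega>"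
      using bergman_spaceD(2)[OF k(1)[OF w]] by (simp add: bergman_space_def)
  next
    fix f z assume f: "f \<in> bergman_space \<Omega>" and z: "z \<in> \<Omega>"
    have "(LINT w|lebesgue_on \<Omega>. f w * cnj (k z w)) = (LINT w|lebesgue_on \<Omega>. f w * cnj (K w z))"
      by (rule Bochner_Integration.integral_cong) (use z in \<open>auto simp: K_def\<close>)
    then show "f z = (LINT w|lebesgue_on \<Omega>. f w * cnj (K w z))"
      using k(2)[OF z f] by simp
  qed (auto simp: K_def)
  then show ?thesis
    unfolding bergman_kernel_def
    by (rule theI[of "is_bergman_kernel \<Omega>" K]) (rule is_bergman_kernel_unique[OF _ \<open>is_bergman_kernel \<Omega> K\<close>])
qed

section \<open>Removability of coordinate hyperplanes\<close>

text \<open>The derivative at a nearby point \<open>u\<close> is the derivative at \<open>w\<close> of the translated function; the Cauchy estimate for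
the difference of both functions shows continuity.\<close>

lemma holomorphic_sv_continuous_derivative:
  assumes "holomorphic_sv \<Omega> f" "open \<Omega>"
  obtains D where "\<And>w. w \<in> \<Omega> \<Longrightarrow> (f has_derivative blinfun_apply (D w)) (at w)"
    "\<And>w c v. w \<in> \<Omega> \<Longrightarrow> blinfun_apply (D w) (c *s v) = c * blinfun_apply (D w) v" "continuous_on \<Omega> D"
proof -
  have "\<exists>L. (f has_derivative L) (at w) \<and> (\<forall>c v. L (c *s v) = c * L v)" if "w \<in> \<Omega>" for w
    using assms(1) that unfolding holomorphic_sv_def by (rule bspec)
  note ex = this
  define L where "L w = (SOME L. (f has_derivative L) (at w) \<and> (\<forall>c v. L (c *s v) = c * L v))" for w
  have L: "(f has_derivative L w) (at w)" "L w (c *s v) = c * L w v" if "w \<in> \<Omega>" for w c v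
    using someI_ex[OF ex[OF that]] unfolding L_def[symmetric] by auto
  define D where "D w = Blinfun (L w)" for w
  have D: "blinfun_apply (D w) = L w" if "w \<in> \<Omega>" for w
    unfolding D_def by (rule bounded_linear_Blinfun_apply) (rule has_derivative_bounded_linear[OF L(1)[OF that]])
  have "continuous_on \<Omega> D"
    unfolding continuous_on_iff
  proof (intro ballI allI impI)
    fix w e assume w: "w \<in> \<Omega>" and e: "(e::real) > 0"
    obtain r' where r': "r' > 0" "cball w r' \<subseteq> \<Omega>" using assms(2) w open_contains_cball by blast
    define r where "r = r' / 3"
    have r: "r > 0" "cball w (3 * r) \<subseteq> \<Omega>" using r' by (auto simp: r_def)
    have "uniformly_continuous_on (cball w (3 * r)) f"
      by (rule compact_uniformly_continuous)
         (use holomorphic_sv_continuous_on[OF assms(1)] r(2) continuous_on_subset in auto)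
    moreover have "(e / 2) * r > 0" using e r by simp
    ultimately obtain d where d: "d > 0" "\<And>x y. x \<in> cball w (3 * r) \<Longrightarrow> y \<in> cball w (3 * r) \<Longrightarrow>
        dist y x < d \<Longrightarrow> dist (f y) (f x) < (e / 2) * r"
      unfolding uniformly_continuous_on_def by metis
    show "\<exists>d>0. \<forall>u\<in>\<Omega>. dist u w < d \<longrightarrow> dist (D u) (D w) < e"
    proof (intro exI[of _ "min d r"] conjI ballI impI)
      fix u assume u: "u \<in> \<Omega>" "dist u w < min d r"
      have sh: "x + (u - w) \<in> cball w (3 * r)" if "x \<in> cball w (2 * r)" for x
      proof -
        have "norm ((w - x) - (u - w)) \<le> norm (w - x) + norm (u - w)" by (rule norm_triangle_ineq4)
        moreover have "w - (x + (u - w)) = (w - x) - (u - w)" by simp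
        ultimately show ?thesis using that u(2) unfolding mem_cball dist_norm by simp
      qed
      have "norm (D u - D w) \<le> e / 2"
      proof (rule norm_blinfun_bound)
        fix v
        have "norm (L u v - L w v) \<le> ((e / 2) * r) / r * norm v"
        proof (rule cauchy_derivative_bound[of "ball w (2 * r)" "\<lambda>x. f (x + (u - w)) - f x" w r _ "\<lambda>v. L u v - L w v"])
          have "holomorphic_sv (ball w (2 * r)) (\<lambda>x. f (x + (u - w)))"
          proof (rule holomorphic_sv_compose[OF assms(1)])
            show "holomorphic_sv (ball w (2 * r)) (\<lambda>x. (x + (u - w)) $ k)" for k
              unfolding vector_add_component by (intro holomorphic_sv_add holomorphic_sv_const holomorphic_sv_nth)
            show "x + (u - w) \<in> \<Omega>" if "x \<in> ball w (2 * r)" for x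
              using sh[of x] that r(2) by auto
          qed
          moreover have "holomorphic_sv (ball w (2 * r)) f"
            by (rule holomorphic_sv_subset[OF assms(1)]) (use r in auto)
          ultimately show "holomorphic_sv (ball w (2 * r)) (\<lambda>x. f (x + (u - w)) - f x)"
            by (rule holomorphic_sv_diff)
          show "norm (f (x + (u - w)) - f x) \<le> (e / 2) * r" if "x \<in> cball w r" for x
          proof -
            have "dist (f (x + (u - w))) (f x) < (e / 2) * r"
              by (rule d(2)) (use that sh[of x] r(1) u(2) in \<open>auto simp: dist_norm\<close>)
            then show ?thesis by (simp add: dist_norm)
          qed
          have "((\<lambda>x. x + (u - w)) has_derivative (\<lambda>v. v)) (at w)" by (auto intro!: derivative_eq_intros)
          moreover have "(f has_derivative L u) (at (w + (u - w)))" using L(1)[OF u(1)] by simp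
          ultimately have "((\<lambda>x. f (x + (u - w))) has_derivative (\<lambda>v. L u v)) (at w)"
            by (rule has_derivative_compose)
          then show "((\<lambda>x. f (x + (u - w)) - f x) has_derivative (\<lambda>v. L u v - L w v)) (at w)"
            using L(1)[OF w] by (rule has_derivative_diff)
          show "L u (c *s v) - L w (c *s v) = c * (L u v - L w v)" for c v
            using L(2)[OF u(1)] L(2)[OF w] by (simp add: algebra_simps)
        qed (use r in auto)
        then show "norm (blinfun_apply (D u - D w) v) \<le> e / 2 * norm v"
          using r(1) by (simp add: blinfun.diff_left D[OF u(1)] D[OF w])
      qed (use e in simp)
      then show "dist (D u) (D w) < e" using e by (simp add: dist_norm)
    qed (use d r in auto)
  qed
  then show thesis using that[of D] L D by simp
qed

text \<open>Averages of translates of a holomorphic function are holomorphic, by differentiation under the integral.\<close>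

lemma circle_average_holomorphic:
  fixes f :: "complex ^ 'n::finite \<Rightarrow> complex"
  assumes hol: "holomorphic_sv \<Omega> f" and "open \<Omega>"
    and in_dom: "\<And>z t. z \<in> ball a s \<Longrightarrow> z + (of_real \<rho> * unit_circle t) *s u \<in> \<Omega>"
  shows "holomorphic_sv (ball a s) (\<lambda>z. integral {0..1} (\<lambda>t. f (z + (of_real \<rho> * unit_circle t) *s u)))"
  unfolding holomorphic_sv_def
proof
  fix z assume z: "z \<in> ball a s"
  obtain D where D: "\<And>w. w \<in> \<Omega> \<Longrightarrow> (f has_derivative blinfun_apply (D w)) (at w)"
    "\<And>w c v. w \<in> \<Omega> \<Longrightarrow> blinfun_apply (D w) (c *s v) = c * blinfun_apply (D w) v" "continuous_on \<Omega> D"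
    using holomorphic_sv_continuous_derivative[OF assms(1,2)] by blast
  let ?p = "\<lambda>z t. z + (of_real \<rho> * unit_circle t) *s u"
  have cont: "continuous_on {0..1} (\<lambda>t. f (?p z t))" if "z \<in> ball a s" for z
    by (rule continuous_on_compose2[OF holomorphic_sv_continuous_on[OF hol]])
       (use in_dom that in \<open>auto intro!: continuous_intros\<close>)
  have contD: "continuous_on (ball a s \<times> {0..1}) (\<lambda>(z, t). D (?p z t))"
    unfolding case_prod_unfold
    by (rule continuous_on_compose2[OF D(3)]) (use in_dom in \<open>auto intro!: continuous_intros\<close>)
  have "((\<lambda>z. integral (cbox 0 1) (\<lambda>t. f (?p z t))) has_derivative
      blinfun_apply (integral (cbox 0 1) (\<lambda>t. D (?p z t)))) (at z within ball a s)"
  proof (rule leibniz_rule)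
    show "((\<lambda>x. f (?p x t)) has_derivative blinfun_apply (D (?p x t))) (at x within ball a s)"
      if "x \<in> ball a s" for x t
    proof (rule has_derivative_at_withinI)
      have "((\<lambda>x. ?p x t) has_derivative (\<lambda>v. v)) (at x)" by (auto intro!: derivative_eq_intros)
      then show "((\<lambda>x. f (?p x t)) has_derivative blinfun_apply (D (?p x t))) (at x)"
        using D(1)[OF in_dom[OF that, of t]] by (rule has_derivative_compose)
    qed
    show "(\<lambda>t. f (?p x t)) integrable_on cbox 0 1" if "x \<in> ball a s" for x
      using cont[OF that] by (intro integrable_continuous) simp
  qed (use z contD in auto)
  then have "((\<lambda>z. integral {0..1} (\<lambda>t. f (?p z t))) has_derivative
      blinfun_apply (integral {0..1} (\<lambda>t. D (?p z t)))) (at z)"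
    using at_within_open[OF z] by simp
  moreover have "blinfun_apply (integral {0..1} (\<lambda>t. D (?p z t))) (c *s v)
     = c * blinfun_apply (integral {0..1} (\<lambda>t. D (?p z t))) v" for c v
  proof -
    have "continuous_on {0..1} (\<lambda>t. D (?p z t))"
      by (rule continuous_on_compose2[OF D(3)]) (use in_dom z in \<open>auto intro!: continuous_intros\<close>)
    then have int: "(\<lambda>t. D (?p z t)) integrable_on {0..1}" by (rule integrable_continuous_real)
    have ap: "blinfun_apply (integral {0..1} (\<lambda>t. D (?p z t))) v = integral {0..1} (\<lambda>t. blinfun_apply (D (?p z t)) v)" for v
      by (rule blinfun_apply_integral[OF int])
    show ?thesis unfolding ap using D(2)[OF in_dom[OF z]] by simp
  qed
  ultimately show "\<exists>L. ((\<lambda>z. integral {0..1} (\<lambda>t. f (?p z t))) has_derivative L) (at z) \<and> (\<forall>c v. L (c *s v) = c * L v)"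
    by (intro exI[of _ "blinfun_apply (integral {0..1} (\<lambda>t. D (?p z t)))"]) simp
qed

lemma open_regular_part: "open \<Omega> \<Longrightarrow> open {z \<in> \<Omega>. (z :: complex ^ 'n::finite) $ k \<noteq> 0}"
proof -
  have "open {z :: complex ^ 'n. z $ k \<noteq> 0}" by (intro open_Collect_neq continuous_intros)
  moreover assume "open \<Omega>"
  moreover have "{z \<in> \<Omega>. z $ k \<noteq> 0} = \<Omega> \<inter> {z :: complex ^ 'n. z $ k \<noteq> 0}" by auto
  ultimately show ?thesis by auto
qed

text \<open>The finite measure with density \<open>|f|\<^sup>2\<close> does not charge the hyperplane, so thin neighbourhoods of it carry
little mass.\<close>

lemma small_near_hyperplane:
  fixes f :: "complex ^ 'n::finite \<Rightarrow> complex"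
  assumes hol: "holomorphic_sv \<Omega>' f" and \<Omega>': "open \<Omega>'" "\<And>w. w \<in> \<Omega>' \<Longrightarrow> w $ k \<noteq> 0"
    and fin: "(\<integral>\<^sup>+z. ennreal ((norm (f z))\<^sup>2) * indicator \<Omega>' z \<partial>lborel) < \<infinity>"
    and "e > 0"
  obtains \<delta> where "\<delta> > 0" "(\<integral>\<^sup>+z. ennreal ((norm (f z))\<^sup>2) * indicator {w \<in> \<Omega>'. norm (w $ k) < \<delta>} z \<partial>lborel) < e"
proof -
  let ?g = "\<lambda>z. ennreal ((norm (f z))\<^sup>2) * indicator \<Omega>' z"
  have [measurable]: "?g \<in> borel_measurable borel" by (rule holomorphic_sv_borel_nn[OF hol \<Omega>'(1)])
  define M where "M = density lborel ?g"
  define A where "A n = {w::complex^'n. norm (w $ k) < inverse (real (Suc n))}" for n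
  have A[measurable]: "A n \<in> sets borel" for n unfolding A_def by measurable
  have em: "emeasure M S = (\<integral>\<^sup>+z. ?g z * indicator S z \<partial>lborel)" if "S \<in> sets borel" for S
    unfolding M_def using that by (subst emeasure_density) auto
  have "(\<lambda>n. emeasure M (A n)) \<longlonglongrightarrow> emeasure M (\<Inter>n. A n)"
  proof (rule Lim_emeasure_decseq)
    show "range A \<subseteq> sets M" by (auto simp: M_def)
    show "decseq A" unfolding decseq_def A_def
      by (auto intro: less_le_trans le_imp_inverse_le)
    show "emeasure M (A n) \<noteq> \<infinity>" for n
    proof -
      have "emeasure M (A n) \<le> (\<integral>\<^sup>+z. ?g z \<partial>lborel)"
        unfolding em[OF A] by (intro nn_integral_mono) (auto simp: indicator_def)
      then show ?thesis using fin by (auto simp: top_unique)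
    qed
  qed
  moreover have "emeasure M (\<Inter>n. A n) = 0"
  proof -
    have "w $ k = 0" if "w \<in> (\<Inter>n. A n)" for w
    proof (rule ccontr)
      assume "w $ k \<noteq> 0"
      then obtain n where "inverse (real (Suc n)) < norm (w $ k)" using reals_Archimedean[of "norm (w $ k)"] by auto
      then show False using that by (auto simp: A_def dest!: spec[of _ n])
    qed
    then have "?g z * indicator (\<Inter>n. A n) z = 0" for z using \<Omega>'(2) by (auto simp: indicator_def)
    note * = this
    have "emeasure M (\<Inter>n. A n) = (\<integral>\<^sup>+z. ?g z * indicator (\<Inter>n. A n) z \<partial>lborel)"
      by (rule em) auto
    also have "\<dots> = (\<integral>\<^sup>+z. 0 \<partial>(lborel :: (complex ^ 'n) measure))" by (rule nn_integral_cong) (rule *)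
    finally show ?thesis by simp
  qed
  ultimately have "\<forall>\<^sub>F n in sequentially. emeasure M (A n) < e"
    using \<open>e > 0\<close> order_tendstoD(2) by metis
  then obtain n where n: "emeasure M (A n) < e" by (auto simp: eventually_sequentially)
  have "(\<integral>\<^sup>+z. ennreal ((norm (f z))\<^sup>2) * indicator {w \<in> \<Omega>'. norm (w $ k) < inverse (real (Suc n))} z \<partial>lborel) = emeasure M (A n)"
    unfolding em[OF A] by (intro nn_integral_cong) (auto simp: indicator_def A_def)
  then show thesis using n by (intro that[of "inverse (real (Suc n))"]) auto
qed

text \<open>Near a point of the hyperplane, the candidate for the extension is the average of \<open>f\<close> over circles in direction
\<open>k\<close> which stay away from the hyperplane. That it agrees with \<open>f\<close> follows in each complex line of direction \<open>k\<close>
from Riemann's theorem once \<open>f\<close> is \<open>o(1 / |x|)\<close>, \<open>x\<close> being the distance to the hyperplane. This growth bound comes from the mean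
square inequality on polydiscs with radius \<open>|x|\<close> in direction \<open>k\<close> and fixed radii in the other ones.\<close>

lemma removable_hyperplane_local:
  fixes f :: "complex ^ 'n::finite \<Rightarrow> complex"
  assumes "open \<Omega>" and hol: "holomorphic_sv {z \<in> \<Omega>. z $ k \<noteq> 0} f"
    and fin: "(\<integral>\<^sup>+z. ennreal ((norm (f z))\<^sup>2) * indicator {z \<in> \<Omega>. z $ k \<noteq> 0} z \<partial>lborel) < \<infinity>"
    and a: "a \<in> \<Omega>"
  shows "\<exists>s h. s > 0 \<and> ball a s \<subseteq> \<Omega> \<and> holomorphic_sv (ball a s) h \<and> (\<forall>z\<in>ball a s. z $ k \<noteq> 0 \<longrightarrow> h z = f z)"
proof (cases "a $ k = 0")
  case False
  obtain s where s: "s > 0" "ball a s \<subseteq> {z \<in> \<Omega>. z $ k \<noteq> 0}"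
    using open_regular_part[OF assms(1), of k] a False open_contains_ball by blast
  show ?thesis
    by (intro exI[of _ s] exI[of _ f]) (use s holomorphic_sv_subset[OF hol s(2)] in auto)
next
  case True
  define \<Omega>' where "\<Omega>' = {z \<in> \<Omega>. z $ k \<noteq> 0}"
  have op: "open \<Omega>'" unfolding \<Omega>'_def by (rule open_regular_part[OF assms(1)])
  obtain r0 where r0: "r0 > 0" "ball a r0 \<subseteq> \<Omega>" using assms(1) a open_contains_ball by blast
  define \<rho> where "\<rho> = r0 / 4"
  have \<rho>: "\<rho> > 0" "ball a (4 * \<rho>) \<subseteq> \<Omega>" using r0 by (auto simp: \<rho>_def)
  let ?e = "axis k 1 :: complex ^ 'n"
  have ne: "norm ?e = 1" by (rule norm_Basis) (auto simp: Basis_vec_def Basis_complex_def)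
  have comp: "norm (z $ k) < s" if "z \<in> ball a s" for z s
  proof -
    have "norm ((z - a) $ k) \<le> norm (z - a)" by (rule Finite_Cartesian_Product.norm_nth_le)
    then show ?thesis using that True by (simp add: dist_norm norm_minus_commute)
  qed
  have in_dom: "z + x *s ?e \<in> \<Omega>'" if "z \<in> ball a (\<rho>/2)" "norm x < 3 * \<rho>" "z $ k + x \<noteq> 0" for z x
  proof -
    have "norm (z + x *s ?e - a) \<le> norm (z - a) + norm (x *s ?e)"
    proof -
      have "z + x *s ?e - a = (z - a) + x *s ?e" by simp
      then show ?thesis by (simp only: norm_triangle_ineq)
    qed
    also have "\<dots> < 4 * \<rho>" using that \<rho> by (simp add: norm_smult ne dist_norm norm_minus_commute)
    finally have "z + x *s ?e \<in> \<Omega>" using \<rho>(2) by (auto simp: dist_norm norm_minus_commute)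
    then show ?thesis using that(3) by (simp add: \<Omega>'_def axis_def)
  qed
  define h where "h z = integral {0..1} (\<lambda>t. f (z + (of_real \<rho> * unit_circle t) *s ?e))" for z
  have circ_nz: "z $ k + of_real \<rho> * unit_circle t \<noteq> 0" if "z \<in> ball a (\<rho>/2)" for z t
  proof
    assume "z $ k + of_real \<rho> * unit_circle t = 0"
    then have "z $ k = - (of_real \<rho> * unit_circle t)" by (simp add: eq_neg_iff_add_eq_0)
    then have "norm (z $ k) = \<rho>" using \<rho> by (simp add: norm_mult)
    then show False using comp[OF that] \<rho> by simp
  qed
  have h_hol: "holomorphic_sv (ball a (\<rho>/2)) h"
    unfolding h_def
    by (rule circle_average_holomorphic[OF hol[folded \<Omega>'_def] op]) (rule in_dom, use \<rho> circ_nz in \<open>auto simp: norm_mult\<close>)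
  have eq: "h z = f z" if z: "z \<in> ball a (\<rho>/2)" "z $ k \<noteq> 0" for z
  proof -
    define G where "G x = f (z + (x - z $ k) *s ?e)" for x
    have dom: "z + (x - z $ k) *s ?e \<in> \<Omega>'" if "norm x < 2 * \<rho>" "x \<noteq> 0" for x
    proof (rule in_dom[OF z(1)])
      have "norm (x - z $ k) \<le> norm x + norm (z $ k)" by (rule norm_triangle_ineq4)
      then show "norm (x - z $ k) < 3 * \<rho>" using that comp[OF z(1)] \<rho> by simp
    qed (use that in auto)
    have Ghol: "G holomorphic_on (ball 0 (2 * \<rho>) - {0})"
    proof -
      have *: "(z - (z $ k) *s ?e) + x *s ?e = z + (x - z $ k) *s ?e" for x
        by (simp add: vec_eq_iff left_diff_distrib)
      have "(\<lambda>x. f ((z - (z $ k) *s ?e) + x *s ?e)) holomorphic_on (ball 0 (2 * \<rho>) - {0})"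
        by (rule holomorphic_on_line[OF hol[folded \<Omega>'_def]], subst *, rule dom) auto
      then show ?thesis unfolding G_def * .
    qed
    \<comment> \<open>The growth condition of the one-variable removability theorem.\<close>
    have lim0: "((\<lambda>x. (x - 0) * G x) \<longlongrightarrow> 0) (at 0)"
    proof (rule tendstoI)
      fix e :: real assume e: "e > 0"
      define \<sigma> where "\<sigma> = \<rho> / real CARD('n)"
      have \<sigma>: "\<sigma> > 0" "real CARD('n) * \<sigma> \<le> \<rho>" using \<rho> by (auto simp: \<sigma>_def)
      define c where "c = (\<Prod>j\<in>(UNIV - {k}). pi * \<sigma>\<^sup>2) * pi"
      have c: "c > 0" unfolding c_def using \<sigma> by (intro mult_pos_pos prod_pos) auto
      obtain \<delta> where \<delta>: "\<delta> > 0" "(\<integral>\<^sup>+z. ennreal ((norm (f z))\<^sup>2) * indicator {w \<in> \<Omega>'. norm (w $ k) < \<delta>} z \<partial>lborel) < ennreal (e\<^sup>2 * c)"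
        by (rule small_near_hyperplane[OF hol[folded \<Omega>'_def] op _ fin[folded \<Omega>'_def], of k "ennreal (e\<^sup>2 * c)"])
           (use e c in \<open>auto simp: \<Omega>'_def\<close>)
      define d where "d = Min {\<delta> / 2, \<sigma>, \<rho>}"
      have d: "d > 0" "d \<le> \<delta> / 2" "d \<le> \<sigma>" "d \<le> \<rho>" using \<delta> \<sigma> \<rho> by (auto simp: d_def)
      have "dist ((x - 0) * G x) 0 < e" if x: "x \<noteq> 0" "norm x < d" for x
      proof -
        let ?w = "z + (x - z $ k) *s ?e"
        let ?r = "\<lambda>j. if j = k then norm x else \<sigma>"
        have wk: "?w $ k = x" by (simp add: axis_def)
        have "?r j \<le> \<sigma>" for j using x(2) d(3) by simp
        then have "polydisc ?w ?r \<subseteq> polydisc ?w (\<lambda>_. \<sigma>)"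
          unfolding polydisc_def by (intro Collect_mono impI allI) (rule less_le_trans, auto)
        also have "\<dots> \<subseteq> ball ?w \<rho>" by (rule polydisc_subset_ball) (use \<sigma> in auto)
        also have "\<dots> \<subseteq> ball a (4 * \<rho>)"
        proof
          fix y assume y: "y \<in> ball ?w \<rho>"
          have "norm (x - z $ k) \<le> norm x + norm (z $ k)" by (rule norm_triangle_ineq4)
          moreover have "norm (y - a) \<le> norm (y - ?w) + norm (z - a) + norm ((x - z $ k) *s ?e)"
          proof -
            have "y - a = (y - ?w) + (z - a) + (x - z $ k) *s ?e" by simp
            then have "norm (y - a) \<le> norm ((y - ?w) + (z - a)) + norm ((x - z $ k) *s ?e)"
              by (simp only: norm_triangle_ineq)
            then show ?thesis using norm_triangle_ineq[of "y - ?w" "z - a"] by linarith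
          qed
          moreover have "norm (y - ?w) < \<rho>" "norm (z - a) < \<rho> / 2"
            using y z(1) unfolding mem_ball dist_norm norm_minus_commute[of y ?w] norm_minus_commute[of z a]
            by - assumption+
          moreover have "norm ((x - z $ k) *s ?e) = norm (x - z $ k)"
            by (simp only: norm_smult ne mult_1_right)
          ultimately have "norm (y - a) < 4 * \<rho>"
            using x(2) d(4) comp[OF z(1)] \<rho>(1) by linarith
          then show "y \<in> ball a (4 * \<rho>)" by (simp add: dist_norm norm_minus_commute)
        qed
        finally have sub: "polydisc ?w ?r \<subseteq> \<Omega>" using \<rho>(2) by auto
        have sub': "polydisc ?w ?r \<subseteq> {w \<in> \<Omega>'. norm (w $ k) < \<delta>}"
        proof
          fix y assume y: "y \<in> polydisc ?w ?r"
          then have *: "norm (y $ k - x) < norm x" using wk by (auto simp: polydisc_def dest!: spec[of _ k])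
          then have "y $ k \<noteq> 0" by auto
          moreover have "norm (y $ k) < \<delta>"
            using norm_triangle_sub[of "y $ k" x] * x(2) d(2) by simp
          ultimately show "y \<in> {w \<in> \<Omega>'. norm (w $ k) < \<delta>}" using sub y by (auto simp: \<Omega>'_def)
        qed
        have "ennreal ((norm (f ?w))\<^sup>2) * ennreal (\<Prod>j\<in>UNIV. pi * (?r j)\<^sup>2)
           \<le> (\<integral>\<^sup>+w. indicator (polydisc ?w ?r) w * ennreal ((norm (f w))\<^sup>2) \<partial>lborel)"
          by (rule polydisc_mean_square_inequality[OF hol[folded \<Omega>'_def] op]) (use sub' x \<sigma> in auto)
        also have "\<dots> \<le> (\<integral>\<^sup>+z. ennreal ((norm (f z))\<^sup>2) * indicator {w \<in> \<Omega>'. norm (w $ k) < \<delta>} z \<partial>lborel)"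
          using sub' by (intro nn_integral_mono) (auto simp: indicator_def)
        also have "\<dots> < ennreal (e\<^sup>2 * c)" by (rule \<delta>)
        also have "(\<Prod>j\<in>UNIV. pi * (?r j)\<^sup>2) = (norm x)\<^sup>2 * c"
          by (subst prod.remove[of _ k]) (auto simp: c_def intro!: prod.cong)
        finally have "ennreal ((norm (G x))\<^sup>2 * ((norm x)\<^sup>2 * c)) < ennreal (e\<^sup>2 * c)"
          using c by (simp add: ennreal_mult' G_def)
        then have "(norm (G x))\<^sup>2 * ((norm x)\<^sup>2 * c) < e\<^sup>2 * c"
          using c by (subst (asm) ennreal_less_iff) auto
        then have "(norm x * norm (G x))\<^sup>2 < e\<^sup>2" using c by (simp add: power_mult_distrib mult_ac)
        then have "norm x * norm (G x) < e" using e by (rule_tac power2_less_imp_less) auto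
        then show ?thesis by (simp add: norm_mult)
      qed
      then show "\<forall>\<^sub>F x in at 0. dist ((x - 0) * G x) 0 < e"
        unfolding eventually_at using d(1) by (intro exI[of _ d]) auto
    qed
    have "\<exists>g. g holomorphic_on ball 0 (2 * \<rho>) \<and> (\<forall>x\<in>ball 0 (2 * \<rho>) - {0}. g x = G x)"
      by (subst holomorphic_on_extend_lim[OF Ghol]) (use lim0 \<rho> in auto)
    then obtain g where g: "g holomorphic_on ball 0 (2 * \<rho>)" "\<And>x. x \<in> ball 0 (2 * \<rho>) - {0} \<Longrightarrow> g x = G x" by blast
    have zk: "norm (z $ k) < \<rho> / 2" by (rule comp[OF z(1)])
    have bd: "norm (z $ k + of_real \<rho> * x) < 2 * \<rho>" if "norm x < 3/2" for x
    proof -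
      have "norm (z $ k + of_real \<rho> * x) \<le> norm (z $ k) + \<rho> * norm x"
        using norm_triangle_ineq[of "z $ k" "of_real \<rho> * x"] \<rho>(1) by (simp add: norm_mult)
      also have "\<rho> * norm x < \<rho> * (3/2)" using that \<rho>(1) by (intro mult_strict_left_mono)
      finally show ?thesis using zk by simp
    qed
    have "(\<lambda>x. g (z $ k + of_real \<rho> * x)) holomorphic_on ball 0 (3/2)"
    proof -
      have "(g \<circ> (\<lambda>x. z $ k + of_real \<rho> * x)) holomorphic_on ball 0 (3/2)"
        by (rule holomorphic_on_compose_gen[OF _ g(1)]) (use bd in \<open>auto intro!: holomorphic_intros\<close>)
      then show ?thesis by (simp add: o_def)
    qed
    then have "((\<lambda>t. g (z $ k + of_real \<rho> * unit_circle t)) has_integral g (z $ k + of_real \<rho> * 0)) {0..1}"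
      by (rule circle_mean) simp
    moreover have "g (z $ k + of_real \<rho> * unit_circle t) = f (z + (of_real \<rho> * unit_circle t) *s ?e)" for t
      using g(2)[of "z $ k + of_real \<rho> * unit_circle t"] bd[of "unit_circle t"] circ_nz[OF z(1), of t] by (simp add: G_def)
    moreover have "g (z $ k) = f z" using g(2)[of "z $ k"] zk z(2) \<rho> by (simp add: G_def)
    ultimately show ?thesis unfolding h_def by (simp add: integral_unique)
  qed
  show ?thesis
    by (intro exI[of _ "\<rho>/2"] exI[of _ h]) (use \<rho> h_hol eq in auto)
qed

lemma removable_hyperplane:
  fixes f :: "complex ^ 'n::finite \<Rightarrow> complex"
  assumes "open \<Omega>" and hol: "holomorphic_sv {z \<in> \<Omega>. z $ k \<noteq> 0} f"
    and fin: "(\<integral>\<^sup>+z. ennreal ((norm (f z))\<^sup>2) * indicator {z \<in> \<Omega>. z $ k \<noteq> 0} z \<partial>lborel) < \<infinity>"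
  obtains g where "holomorphic_sv \<Omega> g" "\<And>z. z \<in> \<Omega> \<Longrightarrow> z $ k \<noteq> 0 \<Longrightarrow> g z = f z"
proof -
  let ?e = "axis k 1 :: complex ^ 'n"
  define g where "g z = (if z $ k \<noteq> 0 then f z else Lim (at 0) (\<lambda>x. f (z + x *s ?e)))" for z
  have "holomorphic_sv \<Omega> g"
    unfolding holomorphic_sv_def
  proof
    fix a assume a: "a \<in> \<Omega>"
    from removable_hyperplane_local[OF assms a]
    obtain s h where sh: "s > 0 \<and> ball a s \<subseteq> \<Omega> \<and> holomorphic_sv (ball a s) h \<and>
       (\<forall>z\<in>ball a s. z $ k \<noteq> 0 \<longrightarrow> h z = f z)"
      by (elim exE)
    have s: "s > 0" "holomorphic_sv (ball a s) h" "\<And>z. z \<in> ball a s \<Longrightarrow> z $ k \<noteq> 0 \<Longrightarrow> h z = f z"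
      using sh by simp_all
    have eq: "h z = g z" if z: "z \<in> ball a s" for z
    proof (cases "z $ k = 0")
      case True
      have "isCont h z" using holomorphic_sv_continuous_on[OF s(2)] z by (simp add: continuous_on_eq_continuous_at)
      moreover have "isCont (\<lambda>x. z + x *s ?e) 0" using has_derivative_continuous[OF has_derivative_smult_line[of z ?e 0]] by simp
      ultimately have "isCont (\<lambda>x. h (z + x *s ?e)) 0" using isCont_o2[of 0 "\<lambda>x. z + x *s ?e" h] by simp
      then have "((\<lambda>x. h (z + x *s ?e)) \<longlongrightarrow> h z) (at 0)" by (simp add: isCont_def)
      moreover have "\<forall>\<^sub>F x in at 0. h (z + x *s ?e) = f (z + x *s ?e)"
      proof -
        have "((\<lambda>x. z + x *s ?e) \<longlongrightarrow> z) (at 0)" using \<open>isCont (\<lambda>x. z + x *s ?e) 0\<close> by (simp add: isCont_def)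
        then have "\<forall>\<^sub>F x in at 0. z + x *s ?e \<in> ball a s" using z by (rule topological_tendstoD[OF _ open_ball])
        moreover have "\<forall>\<^sub>F x in at (0::complex). x \<noteq> 0" by (auto simp: eventually_at intro!: exI[of _ 1])
        ultimately show ?thesis proof eventually_elim
          case (elim x)
          have "(z + x *s ?e) $ k \<noteq> 0" using True elim(2) by (simp add: axis_def)
          then show ?case by (rule s(3)[OF elim(1)])
        qed
      qed
      ultimately have "((\<lambda>x. f (z + x *s ?e)) \<longlongrightarrow> h z) (at 0)" by (rule Lim_transform_eventually)
      then show ?thesis using True by (simp add: g_def tendsto_Lim)
    qed (use s(3)[OF z] in \<open>simp add: g_def\<close>)
    have "holomorphic_sv (ball a s) g" by (rule holomorphic_sv_cong[OF s(2) open_ball eq])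
    then show "\<exists>L. (g has_derivative L) (at a) \<and> (\<forall>c v. L (c *s v) = c * L v)"
      unfolding holomorphic_sv_def by (rule bspec) (use s(1) in simp)
  qed
  then show thesis using that[of g] by (simp add: g_def)
qed

text \<open>The hyperplanes are filled in one after the other; removing them again does not change integrals.\<close>

theorem bergman_removable:
  fixes f :: "complex ^ 'n::finite \<Rightarrow> complex"
  assumes "open \<Omega>" and "holomorphic_sv (\<Omega> \<inter> regular) f"
    and "(\<integral>\<^sup>+z. ennreal ((norm (f z))\<^sup>2) * indicator (\<Omega> \<inter> regular) z \<partial>lborel) < \<infinity>"
  obtains g where "g \<in> bergman_space \<Omega>" "\<And>z. z \<in> \<Omega> \<Longrightarrow> z \<in> regular \<Longrightarrow> g z = f z"
proof -
  have "\<exists>g. holomorphic_sv \<Omega> g \<and> (\<integral>\<^sup>+z. ennreal ((norm (g z))\<^sup>2) * indicator \<Omega> z \<partial>lborel) < \<infinity> \<and>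
      (\<forall>z\<in>\<Omega>. (\<forall>k\<in>S. z $ k \<noteq> 0) \<longrightarrow> g z = f z)"
    if "finite S" "holomorphic_sv {z \<in> \<Omega>. \<forall>k\<in>S. z $ k \<noteq> 0} f"
      "(\<integral>\<^sup>+z. ennreal ((norm (f z))\<^sup>2) * indicator {z \<in> \<Omega>. \<forall>k\<in>S. z $ k \<noteq> 0} z \<partial>lborel) < \<infinity>"
    for S :: "'n set" and f
    using that
  proof (induction S arbitrary: f rule: finite_induct)
    case empty
    then show ?case by auto
  next
    case (insert k S)
    let ?\<Omega> = "{z \<in> \<Omega>. \<forall>k\<in>S. z $ k \<noteq> 0}"
    have op: "open ?\<Omega>"
    proof -
      have "open (\<Omega> \<inter> (\<Inter>k\<in>S. {z \<in> UNIV. z $ k \<noteq> 0}))"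
        using insert.hyps assms(1) open_regular_part[OF open_UNIV] by (intro open_Int open_INT) auto
      also have "\<Omega> \<inter> (\<Inter>k\<in>S. {z \<in> UNIV. z $ k \<noteq> 0}) = ?\<Omega>" by auto
      finally show ?thesis .
    qed
    have set: "{z \<in> ?\<Omega>. z $ k \<noteq> 0} = {z \<in> \<Omega>. \<forall>k\<in>insert k S. z $ k \<noteq> 0}" by auto
    obtain g where g: "holomorphic_sv ?\<Omega> g" "\<And>z. z \<in> ?\<Omega> \<Longrightarrow> z $ k \<noteq> 0 \<Longrightarrow> g z = f z"
      using removable_hyperplane[OF op, of k f] insert.prems unfolding set by blast
    have "(\<integral>\<^sup>+z. ennreal ((norm (g z))\<^sup>2) * indicator ?\<Omega> z \<partial>lborel)
       = (\<integral>\<^sup>+z. ennreal ((norm (f z))\<^sup>2) * indicator {z \<in> \<Omega>. \<forall>k\<in>insert k S. z $ k \<noteq> 0} z \<partial>lborel)"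
      by (rule nn_integral_cong_AE, use AE_regular in eventually_elim)
         (use g(2) in \<open>auto simp: indicator_def regular_def\<close>)
    also have "\<dots> < \<infinity>" by (rule insert.prems)
    finally obtain g' where g': "holomorphic_sv \<Omega> g'"
       "(\<integral>\<^sup>+z. ennreal ((norm (g' z))\<^sup>2) * indicator \<Omega> z \<partial>lborel) < \<infinity>"
       "\<forall>z\<in>\<Omega>. (\<forall>k\<in>S. z $ k \<noteq> 0) \<longrightarrow> g' z = g z"
      using insert.IH[OF g(1)] by blast
    show ?case
      by (intro exI[of _ g'] conjI g') (use g'(3) g(2) in auto)
  qed
  from this[of UNIV f] assms obtain g where "holomorphic_sv \<Omega> g"
     "(\<integral>\<^sup>+z. ennreal ((norm (g z))\<^sup>2) * indicator \<Omega> z \<partial>lborel) < \<infinity>"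
     "\<forall>z\<in>\<Omega>. (\<forall>k. z $ k \<noteq> 0) \<longrightarrow> g z = f z"
    by (auto simp: regular_def Int_def)
  then show thesis
    using that[of g] bergman_space_iff[OF assms(1)] by (auto simp: regular_def)
qed

section \<open>The unit disc\<close>

lemma indicator_ball_measurable_real [measurable, simp]:
  "(indicator (ball c r) :: complex \<Rightarrow> real) \<in> borel_measurable borel"
  by (rule borel_measurable_indicator) simp

text \<open>Cauchy's formula for the first derivative.\<close>

lemma circle_cauchy_derivative:
  assumes hol: "g holomorphic_on ball 0 R" and R: "R > 1" and b: "norm b < 1"
    and d: "(g has_field_derivative d) (at b)"
  shows "((\<lambda>t. g (unit_circle t) * unit_circle t / (unit_circle t - b)\<^sup>2) has_integral d) {0..1}"
proof -
  have c: "continuous_on (cball 0 1) g" "g holomorphic_on ball 0 1"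
    using R by (auto intro!: holomorphic_on_imp_continuous_on holomorphic_on_subset[OF hol])
  have bb: "b \<in> ball 0 1" using b by simp
  note C = Cauchy_derivative_integral_circlepath[OF c bb]
  have "contour_integral (circlepath 0 1) (\<lambda>u. g u / (u - b)\<^sup>2) = 2 * of_real pi * \<i> * d"
    using DERIV_unique[OF d C(2)] by simp
  then have "((\<lambda>u. g u / (u - b)\<^sup>2) has_contour_integral (2 * of_real pi * \<i> * d)) (circlepath 0 1)"
    using C(1) has_contour_integral_integral by fastforce
  then have "((\<lambda>x. g (circlepath 0 1 x) / (circlepath 0 1 x - b)\<^sup>2 * vector_derivative (circlepath 0 1) (at x within {0..1}))
      has_integral (2 * of_real pi * \<i> * d)) {0..1}"
    by (simp add: has_contour_integral_def)
  then have "((\<lambda>x. (2 * of_real pi * \<i>) * (g (unit_circle x) * unit_circle x / (unit_circle x - b)\<^sup>2)) has_integral (2 * of_real pi * \<i> * d)) {0..1}"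
    by (rule has_integral_eq[rotated])
       (simp add: vector_derivative_circlepath01, simp add: circlepath unit_circle_def)
  from has_integral_mult_right[OF this, of "inverse (2 * of_real pi * \<i>)"]
  show ?thesis by (simp add: field_simps)
qed

lemma lborel_rotate:
  assumes "norm a = 1"
  shows "distr lborel borel ((*) (a::complex)) = lborel"
proof (rule measure_eqI)
  fix A assume "A \<in> sets (distr lborel borel ((*) a))"
  then have A[measurable]: "A \<in> sets borel" by simp
  have a: "a \<noteq> 0" using assms by auto
  have "emeasure (distr lborel borel ((*) a)) A = (\<integral>\<^sup>+z. indicator A z \<partial>distr lborel borel ((*) a))" by simp
  also have "\<dots> = (\<integral>\<^sup>+z. indicator A (a * z) \<partial>lborel)"
    by (subst nn_integral_distr) auto
  also have "\<dots> = (\<integral>\<^sup>+z. indicator A z \<partial>lborel)"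
    by (subst nn_integral_complex_mult[OF a]) (use assms in auto)
  finally show "emeasure (distr lborel borel ((*) a)) A = emeasure lborel A" by simp
qed simp

text \<open>Rotation invariance of area, integrated over all rotations.\<close>

lemma nn_integral_circle_average:
  fixes F :: "complex \<Rightarrow> ennreal"
  assumes [measurable]: "F \<in> borel_measurable borel"
  shows "(\<integral>\<^sup>+w. F w \<partial>lborel) = (\<integral>\<^sup>+w. (\<integral>\<^sup>+t. indicator {0..1} t * F (unit_circle t * w) \<partial>lborel) \<partial>lborel)"
proof -
  have "(\<integral>\<^sup>+w. (\<integral>\<^sup>+t. indicator {0..1} t * F (unit_circle t * w) \<partial>lborel) \<partial>lborel)
     = (\<integral>\<^sup>+t. (\<integral>\<^sup>+w. indicator {0..1} t * F (unit_circle t * w) \<partial>lborel) \<partial>lborel)"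
    by (rule lborel_pair.Fubini') measurable
  also have "\<dots> = (\<integral>\<^sup>+t. indicator {0..1} (t::real) * (\<integral>\<^sup>+w. F w \<partial>lborel) \<partial>lborel)"
  proof (rule nn_integral_cong)
    fix t :: real
    have "(\<integral>\<^sup>+w. indicator {0..1} t * F (unit_circle t * w) \<partial>lborel) = indicator {0..1} t * (\<integral>\<^sup>+w. F (unit_circle t * w) \<partial>lborel)"
      by (intro nn_integral_cmult) measurable
    also have "(\<integral>\<^sup>+w. F (unit_circle t * w) \<partial>lborel) = (\<integral>\<^sup>+w. F w \<partial>lborel)"
      by (subst nn_integral_complex_mult) auto
    finally show "(\<integral>\<^sup>+w. indicator {0..1} t * F (unit_circle t * w) \<partial>lborel) = indicator {0..1} t * (\<integral>\<^sup>+w. F w \<partial>lborel)" .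
  qed
  also have "\<dots> = (\<integral>\<^sup>+w. F w \<partial>lborel)" by (simp add: nn_integral_multc)
  finally show ?thesis by simp
qed

lemma integral_circle_average:
  fixes F :: "complex \<Rightarrow> complex"
  assumes F: "integrable lborel F"
  shows "(LINT w|lborel. F w) = (LINT w|lborel. (LINT t|lborel. indicator {0..1} t *\<^sub>R F (unit_circle t * w)))"
proof -
  have [measurable]: "F \<in> borel_measurable borel" using F by simp
  let ?f = "\<lambda>(t::real) w. indicator {0..1} t *\<^sub>R F (unit_circle t * w)"
  have rot: "(LINT w|lborel. F (unit_circle t * w)) = (LINT w|lborel. F w)" for t
    by (subst (2) lborel_rotate[of "unit_circle t", symmetric]) (auto simp: integral_distr)
  have "integrable (lborel \<Otimes>\<^sub>M lborel) (case_prod ?f)"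
  proof (rule integrableI_bounded)
    have "(\<integral>\<^sup>+x. ennreal (norm (case_prod ?f x)) \<partial>(lborel \<Otimes>\<^sub>M lborel))
       = (\<integral>\<^sup>+t. (\<integral>\<^sup>+w. ennreal (norm (?f t w)) \<partial>lborel) \<partial>lborel)"
      by (subst lborel.nn_integral_fst[symmetric]) auto
    also have "\<dots> = (\<integral>\<^sup>+w. (\<integral>\<^sup>+t. ennreal (norm (?f t w)) \<partial>lborel) \<partial>lborel)"
      by (rule lborel_pair.Fubini') measurable
    also have "\<dots> = (\<integral>\<^sup>+w. (\<integral>\<^sup>+t. indicator {0..1} t * ennreal (norm (F (unit_circle t * w))) \<partial>lborel) \<partial>lborel)"
      by (intro nn_integral_cong) (auto simp: indicator_def)
    also have "\<dots> = (\<integral>\<^sup>+w. ennreal (norm (F w)) \<partial>lborel)"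
      by (rule nn_integral_circle_average[symmetric]) measurable
    also have "\<dots> < \<infinity>" using F by (simp add: integrable_iff_bounded)
    finally show "(\<integral>\<^sup>+x. ennreal (norm (case_prod ?f x)) \<partial>(lborel \<Otimes>\<^sub>M lborel)) < \<infinity>" .
  qed measurable
  then have "(LINT w|lborel. (LINT t|lborel. ?f t w)) = (LINT t|lborel. (LINT w|lborel. ?f t w))"
    by (rule lborel_pair.Fubini_integral)
  also have "\<dots> = (LINT t|lborel. indicator {0..1} (t::real) *\<^sub>R (LINT w|lborel. F w))"
    by (simp add: rot)
  also have "\<dots> = (LINT w|lborel. F w)" by simp
  finally show ?thesis by simp
qed

text \<open>The area of \<open>{w. |w|\<^sup>2 > x}\<close> in the unit disc is \<open>\<pi> (1 - x)\<close>.\<close>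

lemma distr_norm_square_disc:
  "distr (density lborel (indicator (ball (0::complex) 1))) borel (\<lambda>w. (norm w)\<^sup>2)
     = density lborel (\<lambda>t. ennreal (pi * indicator {0..1} t))"
proof (rule measure_eqI_lessThan)
  have em: "emeasure (distr (density lborel (indicator (ball (0::complex) 1))) borel (\<lambda>w. (norm w)\<^sup>2)) {x<..}
    = emeasure lborel (ball (0::complex) 1 \<inter> {w. x < (norm w)\<^sup>2})" for x
  proof -
    have "emeasure (distr (density lborel (indicator (ball (0::complex) 1))) borel (\<lambda>w. (norm w)\<^sup>2)) {x<..}
       = emeasure (density lborel (indicator (ball (0::complex) 1))) {w. x < (norm w)\<^sup>2}"
      by (subst emeasure_distr) (auto intro!: arg_cong2[where f = emeasure])
    also have "\<dots> = (\<integral>\<^sup>+w. indicator (ball (0::complex) 1) w * indicator {w. x < (norm w)\<^sup>2} w \<partial>lborel)"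
      by (subst emeasure_density) auto
    also have "\<dots> = (\<integral>\<^sup>+w. indicator (ball (0::complex) 1 \<inter> {w. x < (norm w)\<^sup>2}) w \<partial>lborel)"
      by (intro nn_integral_cong) (auto simp: indicator_def)
    also have "\<dots> = emeasure lborel (ball (0::complex) 1 \<inter> {w. x < (norm w)\<^sup>2})"
      by (rule nn_integral_indicator) measurable
    finally show ?thesis .
  qed
  have le: "emeasure lborel (ball (0::complex) 1 \<inter> S) < \<infinity>" if "S \<in> sets borel" for S
    by (rule le_less_trans[OF emeasure_mono emeasure_lborel_ball_finite[of "0::complex" 1]]) (use that in auto)
  show "emeasure (distr (density lborel (indicator (ball (0::complex) 1))) borel (\<lambda>w. (norm w)\<^sup>2)) {x<..} < \<infinity>" for x
    unfolding em by (rule le) measurable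
  show "emeasure (distr (density lborel (indicator (ball (0::complex) 1))) borel (\<lambda>w. (norm w)\<^sup>2)) {x<..}
     = emeasure (density lborel (\<lambda>t. ennreal (pi * indicator {0..1} t))) {x<..}" for x
  proof -
    have N: "emeasure (density lborel (\<lambda>t. ennreal (pi * indicator {0..1} t))) {x<..} = ennreal pi * emeasure lborel ({0..1} \<inter> {x<..})"
    proof -
      have "emeasure (density lborel (\<lambda>t. ennreal (pi * indicator {0..1} t))) {x<..}
          = (\<integral>\<^sup>+t. ennreal pi * indicator ({0..1} \<inter> {x<..}) t \<partial>lborel)"
        by (subst emeasure_density) (auto intro!: nn_integral_cong simp: indicator_def)
      then show ?thesis by (simp add: nn_integral_cmult_indicator)
    qed
    consider "x < 0" | "0 \<le> x" "x < 1" | "x \<ge> 1" by linarith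
    then show ?thesis
    proof cases
      case 1
      have "ball (0::complex) 1 \<inter> {w. x < (norm w)\<^sup>2} = ball 0 1"
        using 1 by (auto intro: less_le_trans)
      moreover have "{0..1} \<inter> {x<..} = {0..1}" using 1 by auto
      ultimately show ?thesis unfolding em N by (simp add: emeasure_ball unit_ball_vol_2)
    next
      case 2
      have "x < y\<^sup>2 \<longleftrightarrow> sqrt x < y" if "y \<ge> 0" for y
        using that 2(1) by (metis real_sqrt_less_iff real_sqrt_abs abs_of_nonneg)
      then have "ball (0::complex) 1 \<inter> {w. x < (norm w)\<^sup>2} = ball 0 1 - cball 0 (sqrt x)"
        by auto
      moreover have "emeasure lborel (ball (0::complex) 1 - cball 0 (sqrt x)) = ennreal (pi - pi * x)"
      proof (subst emeasure_Diff)
        have c: "emeasure lborel (cball (0::complex) (sqrt x)) = ennreal (pi * x)"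
          using 2 by (simp add: emeasure_cball unit_ball_vol_2)
        show "emeasure lborel (cball (0::complex) (sqrt x)) \<noteq> \<infinity>" unfolding c by simp
        show "cball (0::complex) (sqrt x) \<subseteq> ball 0 1"
        proof
          fix w :: complex assume "w \<in> cball 0 (sqrt x)"
          then have "norm w \<le> sqrt x" by simp
          also have "\<dots> < 1" using 2 by simp
          finally show "w \<in> ball 0 1" by simp
        qed
        show "emeasure lborel (ball (0::complex) 1) - emeasure lborel (cball (0::complex) (sqrt x)) = ennreal (pi - pi * x)"
          unfolding c using 2 by (simp add: emeasure_ball unit_ball_vol_2 ennreal_minus)
      qed auto
      moreover have "{0..1} \<inter> {x<..} = {x<..1}" using 2 by auto
      ultimately show ?thesis unfolding em N using 2 by (simp add: ennreal_mult[symmetric] right_diff_distrib)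
    next
      case 3
      have "ball (0::complex) 1 \<inter> {w. x < (norm w)\<^sup>2} = {}"
      proof -
        have "(norm w)\<^sup>2 < 1" if "norm w < 1" for w :: complex
          using that by (simp add: power_less_one_iff)
        then show ?thesis using 3 by fastforce
      qed
      moreover have "{0..1} \<inter> {x<..} = {}" using 3 by auto
      ultimately show ?thesis unfolding em N by simp
    qed
  qed
qed auto

lemma nn_integral_radial_disc:
  fixes g :: "real \<Rightarrow> ennreal"
  assumes [measurable]: "g \<in> borel_measurable borel"
  shows "(\<integral>\<^sup>+w. indicator (ball (0::complex) 1) w * g ((norm w)\<^sup>2) \<partial>lborel)
       = ennreal pi * (\<integral>\<^sup>+t. indicator {0..1} t * g t \<partial>lborel)"
proof -
  have "(\<integral>\<^sup>+w. indicator (ball (0::complex) 1) w * g ((norm w)\<^sup>2) \<partial>lborel)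
     = (\<integral>\<^sup>+t. g t \<partial>distr (density lborel (indicator (ball (0::complex) 1))) borel (\<lambda>w. (norm w)\<^sup>2))"
    by (subst nn_integral_distr) (auto simp: nn_integral_density)
  also have "\<dots> = (\<integral>\<^sup>+t. ennreal (pi * indicator {0..1} t) * g t \<partial>lborel)"
    unfolding distr_norm_square_disc by (rule nn_integral_density) auto
  also have "\<dots> = (\<integral>\<^sup>+t. ennreal pi * (indicator {0..1} t * g t) \<partial>lborel)"
    by (intro nn_integral_cong) (auto simp: indicator_def)
  also have "\<dots> = ennreal pi * (\<integral>\<^sup>+t. indicator {0..1} t * g t \<partial>lborel)"
    by (rule nn_integral_cmult) measurable
  finally show ?thesis .
qed

lemma integral_radial_disc:
  fixes g :: "real \<Rightarrow> complex"
  assumes [measurable]: "g \<in> borel_measurable borel"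
  shows "(LINT w|lborel. indicator (ball (0::complex) 1) w *\<^sub>R g ((norm w)\<^sup>2))
       = of_real pi * (LINT t|lborel. indicator {0..1} t *\<^sub>R g t)"
proof -
  have d: "density lborel (indicator (ball (0::complex) 1)) = density lborel (\<lambda>w. ennreal (indicator (ball 0 1) w))"
    by (simp add: ennreal_indicator)
  have "(LINT w|lborel. indicator (ball (0::complex) 1) w *\<^sub>R g ((norm w)\<^sup>2))
     = (LINT w|density lborel (\<lambda>w. ennreal (indicator (ball (0::complex) 1) w)). g ((norm w)\<^sup>2))"
    by (rule integral_density[symmetric]) auto
  also have "\<dots> = (LINT t|distr (density lborel (indicator (ball (0::complex) 1))) borel (\<lambda>w. (norm w)\<^sup>2). g t)"
    unfolding d by (rule integral_distr[symmetric]) auto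
  also have "\<dots> = (LINT t|lborel. (pi * indicator {0..1} t) *\<^sub>R g t)"
    unfolding distr_norm_square_disc by (rule integral_density) auto
  also have "\<dots> = (LINT t|lborel. pi *\<^sub>R (indicator {0..1} t *\<^sub>R g t))" by simp
  also have "\<dots> = of_real pi * (LINT t|lborel. indicator {0..1} t *\<^sub>R g t)"
    by (subst integral_scaleR_right) (simp add: scaleR_conv_of_real)
  finally show ?thesis .
qed

lemma set_integral_01:
  fixes f :: "real \<Rightarrow> complex"
  assumes "(f has_integral I) {0..1}" "continuous_on {0..1} f"
  shows "(LINT t|lborel. indicator {0..1} t *\<^sub>R f t) = I"
  using set_borel_integral_eq_integral(2)[OF borel_integrable_atLeastAtMost'[OF assms(2)]] assms(1)
  by (simp add: set_lebesgue_integral_def integral_unique)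

lemma disc_kernel_denominator_nz:
  assumes "norm a < 1" "norm w \<le> (1::real)"
  shows "1 - a * cnj w \<noteq> 0"
proof
  assume "1 - a * cnj w = 0"
  then have "norm (a * cnj w) = 1" by simp
  moreover have "norm (a * cnj w) \<le> norm a"
    using assms mult_left_le[of "norm w" "norm a"] by (simp add: norm_mult)
  ultimately show False using assms by simp
qed

lemma disc_kernel_denominator_bound:
  assumes "norm w \<le> (1::real)"
  shows "1 - norm a \<le> norm (1 - a * cnj w)"
proof -
  have "norm (a * cnj w) \<le> norm a"
    using assms mult_left_le[of "norm w" "norm a"] by (simp add: norm_mult)
  then show ?thesis using norm_triangle_ineq2[of 1 "a * cnj w"] by simp
qed

text \<open>For fixed \<open>w\<close>, Cauchy's formula evaluates the average of the integrand over the circle through \<open>w\<close> as the derivative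
of \<open>t f(a t)\<close> at \<open>t = |w|\<^sup>2\<close>. What remains is a radial integral, computed by the fundamental theorem of calculus.\<close>

lemma disc_reproducing:
  assumes f: "f holomorphic_on ball 0 1" and bound: "\<And>w. norm w < 1 \<Longrightarrow> norm (f w) \<le> M" and a: "norm a < 1"
  shows "(LINT w|lborel. indicator (ball 0 1) w *\<^sub>R (f w / (of_real pi * (1 - a * cnj w)\<^sup>2))) = f a"
proof -
  define F where "F w = indicator (ball 0 1) w *\<^sub>R (f w / (1 - a * cnj w)\<^sup>2)" for w
  have dnz: "1 - a * cnj w \<noteq> 0" if "norm w < 1" for w using disc_kernel_denominator_nz[OF a] that by simp
  have cf: "continuous_on (ball 0 1) (\<lambda>w. f w / (1 - a * cnj w)\<^sup>2)"
    by (intro continuous_intros holomorphic_on_imp_continuous_on[OF f]) (use dnz in auto)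
  have [measurable]: "F \<in> borel_measurable borel"
    unfolding F_def by (rule borel_measurable_continuous_on_indicator[OF _ cf]) simp
  have M: "M \<ge> 0" by (rule order_trans[OF norm_ge_zero bound[of 0]]) simp
  have Fint: "integrable lborel F"
  proof (rule Bochner_Integration.integrable_bound)
    show "integrable lborel (\<lambda>w. indicator (ball (0::complex) 1) w * (M / (1 - norm a)\<^sup>2))"
      by (rule integrable_mult_left) (use emeasure_lborel_ball_finite[of "0::complex" 1] in auto)
    show "AE w in lborel. norm (F w) \<le> norm (indicator (ball (0::complex) 1) w * (M / (1 - norm a)\<^sup>2))"
    proof (rule AE_I2)
      fix w
      show "norm (F w) \<le> norm (indicator (ball (0::complex) 1) w * (M / (1 - norm a)\<^sup>2))"
      proof (cases "norm w < 1")
        case True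
        have "norm (f w) / (norm (1 - a * cnj w))\<^sup>2 \<le> M / (1 - norm a)\<^sup>2"
          using True M a bound[OF True] disc_kernel_denominator_bound[of w a]
          by (intro frac_le power_mono) auto
        then show ?thesis using True M by (simp add: F_def norm_divide norm_power)
      qed (simp add: F_def)
    qed
  qed measurable
  \<comment> \<open>The derivative of \<open>t * f (a * t)\<close>.\<close>
  define H where "H s = f (a * of_real s) + a * of_real s * deriv f (a * of_real s)" for s
  have as: "a * of_real s \<in> ball 0 1" if "s \<in> {0..1}" for s
    using that a mult_left_le[of s "norm a"] by (auto simp: norm_mult)
  have cH: "continuous_on {0..1} H"
    unfolding H_def
    by (intro continuous_intros continuous_on_compose2[OF holomorphic_on_imp_continuous_on[OF f]]
         continuous_on_compose2[OF holomorphic_on_imp_continuous_on[OF holomorphic_deriv[OF f open_ball]]])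
       (use as in auto)
  define H' where "H' s = indicator {0..1} s *\<^sub>R H s" for s
  have [measurable]: "H' \<in> borel_measurable borel"
    unfolding H'_def by (rule borel_measurable_continuous_on_indicator[OF _ cH]) simp
  have avg: "(LINT t|lborel. indicator {0..1} t *\<^sub>R F (unit_circle t * w)) = indicator (ball 0 1) w *\<^sub>R H' ((norm w)\<^sup>2)" for w
  proof (cases "norm w < 1")
    case False
    then show ?thesis by (simp add: F_def norm_mult)
  next
    case True
    define b where "b = a * cnj w"
    have b: "norm b < 1" using a True mult_strict_mono[of "norm a" 1 "norm w" 1] by (simp add: b_def norm_mult)
    obtain R where R: "R > 1" "R * norm w < 1"
    proof (cases "w = 0")
      case True then show ?thesis using that[of 2] by simp
    next
      case False
      then obtain R where "1 < R" "R < 1 / norm w" using True dense[of 1 "1 / norm w"] by auto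
      then show ?thesis using that[of R] False by (auto simp: field_simps)
    qed
    have in_disc: "norm (u * w) < 1" if "norm u < R" for u
      using R that mult_right_mono[of "norm u" R "norm w"] by (simp add: norm_mult)
    have "(f \<circ> (\<lambda>u. u * w)) holomorphic_on ball 0 R"
      by (rule holomorphic_on_compose_gen[OF _ f]) (use in_disc in \<open>auto intro!: holomorphic_intros\<close>)
    then have hol: "(\<lambda>u. u * f (u * w)) holomorphic_on ball 0 R"
      by (auto intro!: holomorphic_intros simp: o_def)
    have bw: "b * w = a * of_real ((norm w)\<^sup>2)"
      unfolding b_def complex_norm_square by (simp add: mult_ac)
    have "(f has_field_derivative deriv f (b * w)) (at (b * w))"
      by (rule holomorphic_derivI[OF f]) (use in_disc[of b] b R in auto)
    from DERIV_chain2[where g = "\<lambda>u. u * w" and x = b and s = UNIV and Db = w, OF this]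
    have "((\<lambda>u. f (u * w)) has_field_derivative deriv f (b * w) * w) (at b)"
      by (rule meta_mp) (auto intro!: derivative_eq_intros)
    then have d: "((\<lambda>u. u * f (u * w)) has_field_derivative (f (b * w) + b * w * deriv f (b * w))) (at b)"
      by (auto intro!: derivative_eq_intros)
    have I: "((\<lambda>t. unit_circle t * f (unit_circle t * w) * unit_circle t / (unit_circle t - b)\<^sup>2) has_integral (f (b * w) + b * w * deriv f (b * w))) {0..1}"
      by (rule circle_cauchy_derivative[OF hol R(1) b d])
    have nz: "unit_circle t - b \<noteq> 0" for t using b norm_unit_circle[of t] by (metis eq_iff_diff_eq_0 less_irrefl)
    have cont: "continuous_on {0..1} (\<lambda>t. unit_circle t * f (unit_circle t * w) * unit_circle t / (unit_circle t - b)\<^sup>2)"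
      by (intro continuous_intros continuous_on_compose2[OF holomorphic_on_imp_continuous_on[OF f]])
         (use True nz in \<open>auto simp: norm_mult\<close>)
    have cc: "cnj (unit_circle t) = 1 / unit_circle t" for t
      using complex_norm_square[of "unit_circle t"] by (simp add: field_simps)
    have eq: "F (unit_circle t * w) = unit_circle t * f (unit_circle t * w) * unit_circle t / (unit_circle t - b)\<^sup>2" for t
    proof -
      have "1 - a * cnj (unit_circle t * w) = (unit_circle t - b) / unit_circle t"
        by (simp add: b_def cc field_simps)
      then show ?thesis using True by (simp add: F_def norm_mult power2_eq_square)
    qed
    have nw: "(norm w)\<^sup>2 \<in> {0..1}" using True by (simp add: power_le_one)
    have "(LINT t|lborel. indicator {0..1} t *\<^sub>R F (unit_circle t * w)) = f (b * w) + b * w * deriv f (b * w)"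
      unfolding eq by (rule set_integral_01[OF I cont])
    also have "\<dots> = H ((norm w)\<^sup>2)" unfolding bw H_def ..
    finally show ?thesis using True nw by (simp add: H'_def)
  qed
  have FTC: "(H has_integral (1 * f (a * of_real 1) - 0)) {0..1}"
  proof -
    have "(H has_integral ((\<lambda>s. of_real s * f (a * of_real s)) 1 - (\<lambda>s. of_real s * f (a * of_real s)) 0)) {0..1}"
    proof (rule fundamental_theorem_of_calculus)
      fix s :: real assume s: "s \<in> {0..1}"
      have "(f has_field_derivative deriv f (a * of_real s)) (at (a * of_real s))"
        by (rule holomorphic_derivI[OF f open_ball as[OF s]])
      from DERIV_chain2[where g = "\<lambda>u. a * u" and x = "of_real s" and s = UNIV and Db = a, OF this]
      have "((\<lambda>u. f (a * u)) has_field_derivative deriv f (a * of_real s) * a) (at (of_real s))"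
        by (rule meta_mp) (auto intro!: derivative_eq_intros)
      then have "((\<lambda>u. u * f (a * u)) has_field_derivative H s) (at (of_real s))"
        unfolding H_def by (auto intro!: derivative_eq_intros)
      then have "((\<lambda>s. of_real s * f (a * of_real s)) has_vector_derivative H s) (at s within {0..1})"
        by (rule has_vector_derivative_real_field)
      then show "((\<lambda>s. of_real s * f (a * of_real s)) has_vector_derivative H s) (at s within {0..1})" .
    qed simp
    then show ?thesis by simp
  qed
  have "(LINT w|lborel. F w) = (LINT w|lborel. indicator (ball (0::complex) 1) w *\<^sub>R H' ((norm w)\<^sup>2))"
    by (subst integral_circle_average[OF Fint]) (simp only: avg)
  also have "\<dots> = of_real pi * (LINT t|lborel. indicator {0..1} t *\<^sub>R H' t)"
    by (rule integral_radial_disc) measurable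
  also have "(LINT t|lborel. indicator {0..1} t *\<^sub>R H' t) = (LINT t|lborel. indicator {0..1} t *\<^sub>R H t)"
    by (intro Bochner_Integration.integral_cong) (auto simp: H'_def indicator_def)
  also have "\<dots> = f a" using set_integral_01[OF FTC cH] by simp
  finally have "(LINT w|lborel. F w) = of_real pi * f a" .
  then have "of_real (inverse pi) * (LINT w|lborel. F w) = f a" by (simp add: field_simps)
  moreover have "of_real (inverse pi) * (LINT w|lborel. F w) = (LINT w|lborel. of_real (inverse pi) * F w)" by simp
  moreover have "of_real (inverse pi) * F w = indicator (ball 0 1) w *\<^sub>R (f w / (of_real pi * (1 - a * cnj w)\<^sup>2))" for w
    by (simp add: F_def divide_inverse mult_ac indicator_def)
  ultimately show ?thesis by (simp only:)
qed

text \<open>On the unit circle the integrand is \<open>1 / ((1 - b cnj u) (1 - u cnj b))\<close>, to which Cauchy's formula applies.\<close>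

lemma circle_average_poisson:
  assumes b: "norm b < 1"
  shows "(\<integral>\<^sup>+t. indicator {0..1} t * ennreal (inverse ((norm (1 - b * cnj (unit_circle t)))\<^sup>2)) \<partial>lborel)
    = ennreal (1 / (1 - (norm b)\<^sup>2))"
proof -
  obtain R where R: "R > 1" "R * norm b < 1"
  proof (cases "b = 0")
    case True then show ?thesis using that[of 2] by simp
  next
    case False
    then obtain R where "1 < R" "R < 1 / norm b" using b dense[of 1 "1 / norm b"] by auto
    then show ?thesis using that[of R] False by (auto simp: field_simps)
  qed
  define g where "g u = 1 / (1 - cnj b * u)" for u
  have nz: "1 - cnj b * u \<noteq> 0" if "norm u < R" for u
  proof
    assume "1 - cnj b * u = 0"
    then have "norm (cnj b * u) = 1" by simp
    moreover have "norm (cnj b * u) \<le> norm b * R" using that by (simp add: norm_mult mult_left_mono)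
    ultimately show False using R by (simp add: mult.commute)
  qed
  have hol: "g holomorphic_on ball 0 R" unfolding g_def by (intro holomorphic_intros) (use nz in auto)
  have I: "((\<lambda>t. g (unit_circle t) * unit_circle t / (unit_circle t - b)) has_integral g b) {0..1}"
    by (rule circle_cauchy[OF hol R(1) b])
  have cc: "cnj (unit_circle t) = 1 / unit_circle t" for t
    using complex_norm_square[of "unit_circle t"] by (simp add: field_simps)
  have nz': "unit_circle t - b \<noteq> 0" for t using b norm_unit_circle[of t] by (metis eq_iff_diff_eq_0 less_irrefl)
  have eq: "g (unit_circle t) * unit_circle t / (unit_circle t - b) = of_real (inverse ((norm (1 - b * cnj (unit_circle t)))\<^sup>2))" for t
  proof -
    have "of_real ((norm (1 - b * cnj (unit_circle t)))\<^sup>2) = (1 - b * cnj (unit_circle t)) * (1 - cnj b * unit_circle t)"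
      unfolding complex_norm_square by simp
    also have "\<dots> = (unit_circle t - b) * (1 - cnj b * unit_circle t) / unit_circle t" by (simp add: cc field_simps)
    finally show ?thesis unfolding g_def of_real_inverse by (simp add: divide_inverse mult_ac)
  qed
  have gb: "g b = of_real (1 / (1 - (norm b)\<^sup>2))"
    unfolding g_def of_real_divide of_real_diff complex_norm_square by (simp add: mult.commute)
  have "((\<lambda>t. inverse ((norm (1 - b * cnj (unit_circle t)))\<^sup>2)) has_integral (1 / (1 - (norm b)\<^sup>2))) {0..1}"
    using has_integral_linear[OF I bounded_linear_Re] unfolding eq gb by (simp only: o_def Re_complex_of_real)
  from nn_integral_has_integral_lebesgue'[OF _ this]
  show ?thesis by (simp add: mult.commute)
qed

text \<open>Away from \<open>s = 0\<close> the factor \<open>1 - R s\<close> is at least both \<open>1 - s\<close> and \<open>1 - R\<close>; using the better bound on either side of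
\<open>1 - s = 1 - R\<close> gives two elementary integrals of the same order. Near \<open>s = 0\<close> only the integrable singularity
\<open>s powr (- x / 2)\<close> matters.\<close>

lemma weighted_poisson_integral_bound:
  assumes x: "0 \<le> x" "x < 2" and y: "0 < y" "y < 1" and R: "0 \<le> R" "R < 1"
  shows "(\<integral>\<^sup>+s. indicator {0..1} s * ennreal (1 / (1 - R * s) * s powr (- x / 2) * (1 - s) powr (- y)) \<partial>lborel)
     \<le> ennreal ((4 / (1 - x / 2) + 2 / y + 2 / (1 - y)) * (1 - R) powr (- y))"
proof -
  define d where "d = 1 - R"
  have d: "0 < d" "d \<le> 1" using R by (auto simp: d_def)
  have pt: "1 / (1 - R * s) * s powr (- x / 2) * (1 - s) powr (- y)
      \<le> 4 * s powr (- x / 2) + 2 * ((if 1 - s \<ge> d then (1 - s) powr (- 1 - y) else 0) + (if 1 - s \<le> d then (1 - s) powr (- y) / d else 0))"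
    if s: "0 < s" "s < 1" for s
  proof -
    have Rs: "R * s \<le> R" "R * s \<le> s" using R s by (auto intro: mult_left_le mult_left_le_one_le)
    show ?thesis
    proof (cases "s \<le> 1/2")
      case True
      have "1 / (1 - R * s) \<le> 2" using Rs True by (simp add: divide_le_eq)
      moreover have "(1 - s) powr (- y) \<le> 2"
      proof -
        have "(1 - s) powr (- y) \<le> (1/2) powr (- y)" using True y by (intro powr_mono2') auto
        also have "\<dots> = 2 powr y" by (simp add: powr_minus powr_divide)
        also have "\<dots> \<le> 2 powr 1" using y by (intro powr_mono) auto
        finally show ?thesis by simp
      qed
      ultimately have "1 / (1 - R * s) * (1 - s) powr (- y) \<le> 2 * 2"
        by (intro mult_mono) auto
      then have "1 / (1 - R * s) * (1 - s) powr (- y) * s powr (- x / 2) \<le> 4 * s powr (- x / 2)"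
        by (intro mult_right_mono) auto
      moreover have "0 \<le> 2 * ((if 1 - s \<ge> d then (1 - s) powr (- 1 - y) else 0) + (if 1 - s \<le> d then (1 - s) powr (- y) / d else 0))"
        using d by simp
      moreover have "1 / (1 - R * s) * s powr (- x / 2) * (1 - s) powr (- y) = 1 / (1 - R * s) * (1 - s) powr (- y) * s powr (- x / 2)"
        by (simp add: mult_ac)
      ultimately show ?thesis by linarith
    next
      case False
      have "s powr (- x / 2) \<le> (1/2) powr (- x / 2)" using False x by (intro powr_mono2') auto
      also have "\<dots> = 2 powr (x / 2)" by (simp add: powr_minus powr_divide)
      also have "\<dots> \<le> 2 powr 1" using x by (intro powr_mono) auto
      finally have sx: "s powr (- x / 2) \<le> 2" by simp
      have main: "1 / (1 - R * s) * (1 - s) powr (- y)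
         \<le> (if 1 - s \<ge> d then (1 - s) powr (- 1 - y) else 0) + (if 1 - s \<le> d then (1 - s) powr (- y) / d else 0)"
      proof (cases "1 - s \<ge> d")
        case True
        have "1 / (1 - R * s) * (1 - s) powr (- y) \<le> 1 / (1 - s) * (1 - s) powr (- y)"
          using Rs s R by (intro mult_right_mono divide_left_mono mult_pos_pos) auto
        also have "\<dots> = (1 - s) powr (- 1 - y)"
        proof -
          have "(1 - s) powr (- 1 - y) = (1 - s) powr (- 1) * (1 - s) powr (- y)"
            by (subst powr_add[symmetric]) (simp add: algebra_simps)
          moreover have "(1 - s) powr (- 1) = 1 / (1 - s)" using s by (intro powr_neg_one) simp
          ultimately show ?thesis by (simp only:)
        qed
        finally have "1 / (1 - R * s) * (1 - s) powr (- y) \<le> (1 - s) powr (- 1 - y)" .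
        moreover have "0 \<le> (1 - s) powr (- y) / d" using d by simp
        ultimately show ?thesis using True by auto
      next
        case False
        have "1 / (1 - R * s) * (1 - s) powr (- y) \<le> 1 / d * (1 - s) powr (- y)"
          using Rs s d R by (intro mult_right_mono divide_left_mono mult_pos_pos) (auto simp: d_def)
        then show ?thesis using False by simp
      qed
      have nn: "0 \<le> 1 / (1 - R * s) * (1 - s) powr (- y)" using Rs s by simp
      have "1 / (1 - R * s) * s powr (- x / 2) * (1 - s) powr (- y) = s powr (- x / 2) * (1 / (1 - R * s) * (1 - s) powr (- y))"
        by (simp add: mult_ac)
      also have "\<dots> \<le> 2 * (1 / (1 - R * s) * (1 - s) powr (- y))"
        using sx nn by (intro mult_right_mono) auto
      also have "\<dots> \<le> 2 * ((if 1 - s \<ge> d then (1 - s) powr (- 1 - y) else 0) + (if 1 - s \<le> d then (1 - s) powr (- y) / d else 0))"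
        using main by simp
      also have "\<dots> \<le> 4 * s powr (- x / 2) + \<dots>" by simp
      finally show ?thesis .
    qed
  qed
  define h1 where "h1 s = ennreal (s powr (- x / 2)) * indicator {0..1} s" for s :: real
  define h2 where "h2 u = ennreal (u powr (- 1 - y)) * indicator {d..} u" for u :: real
  define h3 where "h3 u = ennreal (u powr (- y)) * indicator {0..d} u" for u :: real
  have [measurable]: "h1 \<in> borel_measurable borel" "h2 \<in> borel_measurable borel" "h3 \<in> borel_measurable borel"
    unfolding h1_def h2_def h3_def by measurable
  have I1: "(\<integral>\<^sup>+s. h1 s \<partial>lborel) = ennreal (1 / (1 - x / 2))"
    using nn_integral_has_integral_lebesgue'[OF _ has_integral_powr_from_0[of "- x / 2" 1]] x
    by (simp add: h1_def)
  have I2: "(\<integral>\<^sup>+u. h2 u \<partial>lborel) = ennreal (d powr (- y) / y)"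
    using nn_integral_has_integral_lebesgue'[OF _ has_integral_powr_to_inf[of "- 1 - y" d]] y d
    by (simp add: h2_def)
  have I3: "(\<integral>\<^sup>+u. h3 u \<partial>lborel) = ennreal (d powr (1 - y) / (1 - y))"
    using nn_integral_has_integral_lebesgue'[OF _ has_integral_powr_from_0[of "- y" d]] y d
    by (simp add: h3_def add.commute)
  have refl: "(\<integral>\<^sup>+s. h (1 - s) \<partial>lborel) = (\<integral>\<^sup>+u. h u \<partial>lborel)" if [measurable]: "h \<in> borel_measurable borel"
    for h :: "real \<Rightarrow> ennreal"
    using nn_integral_real_affine[of h "-1" 1] by simp
  have "AE s in lborel. s \<noteq> 0 \<and> s \<noteq> (1::real)"
    using AE_lborel_singleton[of "0::real"] AE_lborel_singleton[of "1::real"] by eventually_elim auto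
  then have "(\<integral>\<^sup>+s. indicator {0..1} s * ennreal (1 / (1 - R * s) * s powr (- x / 2) * (1 - s) powr (- y)) \<partial>lborel)
     \<le> (\<integral>\<^sup>+s. 4 * h1 s + 2 * (h2 (1 - s) + ennreal (1 / d) * h3 (1 - s)) \<partial>lborel)"
  proof (intro nn_integral_mono_AE, eventually_elim)
    case (elim s)
    show ?case
    proof (cases "s \<in> {0..1}")
      case True
      then have s: "0 < s" "s < 1" using elim by auto
      have "ennreal (1 / (1 - R * s) * s powr (- x / 2) * (1 - s) powr (- y))
         \<le> ennreal (4 * s powr (- x / 2) + 2 * ((if 1 - s \<ge> d then (1 - s) powr (- 1 - y) else 0) + (if 1 - s \<le> d then (1 - s) powr (- y) / d else 0)))"
        by (rule ennreal_leI[OF pt[OF s]])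
      also have "\<dots> = 4 * h1 s + 2 * (h2 (1 - s) + ennreal (1 / d) * h3 (1 - s))"
        using s d by (auto simp: h1_def h2_def h3_def indicator_def ennreal_plus[symmetric] ennreal_mult'[symmetric]
            ennreal_numeral[symmetric] mult_ac simp del: ennreal_plus ennreal_numeral)
      finally show ?thesis using True by simp
    qed simp
  qed
  also have "\<dots> = 4 * (\<integral>\<^sup>+s. h1 s \<partial>lborel) + 2 * ((\<integral>\<^sup>+s. h2 (1 - s) \<partial>lborel) + ennreal (1 / d) * (\<integral>\<^sup>+s. h3 (1 - s) \<partial>lborel))"
    by (simp add: nn_integral_add nn_integral_cmult)
  also have "\<dots> = 4 * ennreal (1 / (1 - x / 2)) + 2 * (ennreal (d powr (- y) / y) + ennreal (1 / d) * ennreal (d powr (1 - y) / (1 - y)))"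
    by (simp add: refl I1 I2 I3)
  also have "\<dots> = ennreal (4 * (1 / (1 - x / 2)) + 2 * (d powr (- y) / y + 1 / d * (d powr (1 - y) / (1 - y))))"
    using x y d by (simp add: ennreal_plus[symmetric] ennreal_mult'[symmetric] ennreal_numeral[symmetric]
         del: ennreal_plus ennreal_numeral)
  also have "\<dots> \<le> ennreal ((4 / (1 - x / 2) + 2 / y + 2 / (1 - y)) * d powr (- y))"
  proof (rule ennreal_leI)
    have "1 / d * d powr (1 - y) = d powr (- y)"
      using d by (simp add: powr_diff powr_minus divide_inverse)
    then have e1: "1 / d * (d powr (1 - y) / (1 - y)) = d powr (- y) / (1 - y)" by simp
    have "d powr 0 \<le> d powr (- y)" using d y by (intro powr_mono') auto
    then have "1 \<le> d powr (- y)" using d by simp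
    then have "4 / (1 - x / 2) * 1 \<le> 4 / (1 - x / 2) * d powr (- y)"
      using x by (intro mult_left_mono) auto
    then show "4 * (1 / (1 - x / 2)) + 2 * (d powr (- y) / y + 1 / d * (d powr (1 - y) / (1 - y)))
        \<le> (4 / (1 - x / 2) + 2 / y + 2 / (1 - y)) * d powr (- y)"
      unfolding e1 by (simp add: distrib_left distrib_right mult_ac)
  qed
  finally show ?thesis by (simp add: d_def)
qed

text \<open>The Forelli--Rudin estimate with an additional singularity at the origin. Averaging over circles replaces the kernel
by \<open>1 / (1 - |\<zeta>|\<^sup>2 |w|\<^sup>2)\<close> and leaves a radial integral.\<close>

lemma disc_kernel_integral_bound:
  assumes x: "0 \<le> x" "x < 2" and y: "0 < y" "y < 1"
  obtains C where "C > 0" "\<And>\<zeta>. norm \<zeta> < 1 \<Longrightarrow>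
    (\<integral>\<^sup>+w. indicator (ball 0 1) w * ennreal (inverse ((norm (1 - \<zeta> * cnj w))\<^sup>2) * (norm w powr (- x) * (1 - (norm w)\<^sup>2) powr (- y))) \<partial>lborel)
     \<le> ennreal (C * (1 - (norm \<zeta>)\<^sup>2) powr (- y))"
proof
  let ?C = "4 / (1 - x / 2) + 2 / y + 2 / (1 - y)"
  have "?C > 0" using x y by (intro add_pos_pos) auto
  then show "pi * ?C > 0" by simp
  fix \<zeta> :: complex assume \<zeta>: "norm \<zeta> < 1"
  define R where "R = (norm \<zeta>)\<^sup>2"
  have R: "0 \<le> R" "R < 1" using \<zeta> by (auto simp: R_def power_less_one_iff)
  define u where "u r = ennreal (r powr (- x / 2) * (1 - r) powr (- y))" for r
  have [measurable]: "u \<in> borel_measurable borel" unfolding u_def by measurable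
  have m[measurable]: "(\<lambda>w. ennreal (inverse ((norm (1 - \<zeta> * cnj w))\<^sup>2))) \<in> borel_measurable borel"
  proof -
    have [measurable]: "cnj \<in> borel_measurable borel" by (intro borel_measurable_continuous_onI continuous_intros)
    show ?thesis by measurable
  qed
  define F where "F w = ennreal (inverse ((norm (1 - \<zeta> * cnj w))\<^sup>2)) * (indicator (ball 0 1) w * u ((norm w)\<^sup>2))" for w
  have [measurable]: "F \<in> borel_measurable borel" unfolding F_def by measurable
  have powr_eq: "norm w powr (- x) = ((norm w)\<^sup>2) powr (- x / 2)" for w :: complex
  proof (cases "w = 0")
    case False
    then have "((norm w)\<^sup>2) powr (- x / 2) = (norm w powr 2) powr (- x / 2)" by (simp add: powr_numeral)
    also have "\<dots> = norm w powr (- x)" by (simp only: powr_powr) simp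
    finally show ?thesis by simp
  qed simp
  have "(\<integral>\<^sup>+w. indicator (ball 0 1) w * ennreal (inverse ((norm (1 - \<zeta> * cnj w))\<^sup>2) * (norm w powr (- x) * (1 - (norm w)\<^sup>2) powr (- y))) \<partial>lborel)
     = (\<integral>\<^sup>+w. F w \<partial>lborel)"
  proof (rule nn_integral_cong)
    fix w :: complex
    have "ennreal (inverse ((norm (1 - \<zeta> * cnj w))\<^sup>2) * (norm w powr (- x) * (1 - (norm w)\<^sup>2) powr (- y)))
        = ennreal (inverse ((norm (1 - \<zeta> * cnj w))\<^sup>2)) * u ((norm w)\<^sup>2)"
      unfolding u_def powr_eq by (rule ennreal_mult') simp
    then show "indicator (ball 0 1) w * ennreal (inverse ((norm (1 - \<zeta> * cnj w))\<^sup>2) * (norm w powr (- x) * (1 - (norm w)\<^sup>2) powr (- y))) = F w"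
      unfolding F_def by (simp only: mult.left_commute)
  qed
  also have "\<dots> = (\<integral>\<^sup>+w. (\<integral>\<^sup>+t. indicator {0..1} t * F (unit_circle t * w) \<partial>lborel) \<partial>lborel)"
    by (rule nn_integral_circle_average) measurable
  also have "\<dots> = (\<integral>\<^sup>+w. indicator (ball (0::complex) 1) w * (ennreal (1 / (1 - R * (norm w)\<^sup>2)) * u ((norm w)\<^sup>2)) \<partial>lborel)"
  proof (rule nn_integral_cong)
    fix w :: complex
    have "(\<integral>\<^sup>+t. indicator {0..1} t * F (unit_circle t * w) \<partial>lborel)
      = (\<integral>\<^sup>+t. (indicator (ball 0 1) w * u ((norm w)\<^sup>2)) * (indicator {0..1} t * ennreal (inverse ((norm (1 - (\<zeta> * cnj w) * cnj (unit_circle t)))\<^sup>2))) \<partial>lborel)"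
    proof (rule nn_integral_cong)
      fix t
      have "\<zeta> * cnj (unit_circle t * w) = (\<zeta> * cnj w) * cnj (unit_circle t)" by simp
      moreover have "norm (unit_circle t * w) = norm w" by (simp add: norm_mult)
      then have "indicator (ball 0 1) (unit_circle t * w) = (indicator (ball 0 1) w :: ennreal)" by (simp add: indicator_def)
      ultimately have "F (unit_circle t * w) = ennreal (inverse ((norm (1 - (\<zeta> * cnj w) * cnj (unit_circle t)))\<^sup>2)) * (indicator (ball 0 1) w * u ((norm w)\<^sup>2))"
        unfolding F_def \<open>norm (unit_circle t * w) = norm w\<close> by (simp only:)
      then show "indicator {0..1} t * F (unit_circle t * w)
        = (indicator (ball 0 1) w * u ((norm w)\<^sup>2)) * (indicator {0..1} t * ennreal (inverse ((norm (1 - (\<zeta> * cnj w) * cnj (unit_circle t)))\<^sup>2)))"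
        by (simp only: mult_ac)
    qed
    also have "\<dots> = (indicator (ball 0 1) w * u ((norm w)\<^sup>2)) * (\<integral>\<^sup>+t. (indicator {0..1} t * ennreal (inverse ((norm (1 - (\<zeta> * cnj w) * cnj (unit_circle t)))\<^sup>2))) \<partial>lborel)"
    proof (rule nn_integral_cmult)
      have [measurable]: "cnj \<in> borel_measurable borel" by (intro borel_measurable_continuous_onI continuous_intros)
      show "(\<lambda>t. indicator {0..1} t * ennreal (inverse ((norm (1 - (\<zeta> * cnj w) * cnj (unit_circle t)))\<^sup>2))) \<in> borel_measurable lborel"
        by measurable
    qed
    also have "\<dots> = indicator (ball (0::complex) 1) w * (ennreal (1 / (1 - R * (norm w)\<^sup>2)) * u ((norm w)\<^sup>2))"
    proof (cases "norm w < 1")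
      case True
      have b: "norm (\<zeta> * cnj w) < 1"
        using \<zeta> True mult_strict_mono[of "norm \<zeta>" 1 "norm w" 1] by (simp add: norm_mult)
      show ?thesis using True circle_average_poisson[OF b] by (simp add: norm_mult power_mult_distrib R_def mult.commute)
    qed simp
    finally show "(\<integral>\<^sup>+t. indicator {0..1} t * F (unit_circle t * w) \<partial>lborel)
      = indicator (ball (0::complex) 1) w * (ennreal (1 / (1 - R * (norm w)\<^sup>2)) * u ((norm w)\<^sup>2))" .
  qed
  also have "\<dots> = ennreal pi * (\<integral>\<^sup>+s. indicator {0..1} s * (ennreal (1 / (1 - R * s)) * u s) \<partial>lborel)"
    by (rule nn_integral_radial_disc) measurable
  also have "(\<integral>\<^sup>+s. indicator {0..1} s * (ennreal (1 / (1 - R * s)) * u s) \<partial>lborel)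
     = (\<integral>\<^sup>+s. indicator {0..1} s * ennreal (1 / (1 - R * s) * s powr (- x / 2) * (1 - s) powr (- y)) \<partial>lborel)"
  proof (rule nn_integral_cong)
    fix s :: real
    show "indicator {0..1} s * (ennreal (1 / (1 - R * s)) * u s)
       = indicator {0..1} s * ennreal (1 / (1 - R * s) * s powr (- x / 2) * (1 - s) powr (- y))"
    proof (cases "s \<in> {0..1}")
      case True
      then have "R * s \<le> R" using R by (auto intro: mult_left_le)
      then have "0 \<le> 1 / (1 - R * s)" using R by simp
      then show ?thesis by (simp only: u_def mult.assoc ennreal_mult')
    qed simp
  qed
  also have "ennreal pi * \<dots> \<le> ennreal pi * ennreal (?C * (1 - R) powr (- y))"
    by (intro mult_left_mono weighted_poisson_integral_bound x y R) simp
  also have "\<dots> = ennreal (pi * ?C * (1 - R) powr (- y))" by (subst ennreal_mult'[symmetric]) (simp_all only: mult.assoc pi_ge_zero)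
  finally show "(\<integral>\<^sup>+w. indicator (ball 0 1) w * ennreal (inverse ((norm (1 - \<zeta> * cnj w))\<^sup>2) * (norm w powr (- x) * (1 - (norm w)\<^sup>2) powr (- y))) \<partial>lborel)
     \<le> ennreal (pi * ?C * (1 - (norm \<zeta>)\<^sup>2) powr (- y))" by (simp add: R_def)
qed

section \<open>The unit polydisc\<close>

definition polydisc_kernel :: "complex ^ 'n::finite \<Rightarrow> complex ^ 'n \<Rightarrow> complex" where
  "polydisc_kernel a w = (\<Prod>j\<in>UNIV. 1 / (of_real pi * (1 - a $ j * cnj (w $ j))\<^sup>2))"

lemma unit_polydisc_eq: "unit_polydisc = polydisc 0 (\<lambda>_. 1)"
  by (simp add: unit_polydisc_def polydisc_def)

lemma unit_polydisc_borel [measurable]: "unit_polydisc \<in> sets borel"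
  by (simp add: unit_polydisc_eq)

lemma open_unit_polydisc: "open (unit_polydisc :: (complex ^ 'n::finite) set)"
proof -
  have "open (\<Inter>k. {z::complex ^ 'n. norm (z $ k) < 1})"
    by (intro open_INT ballI open_Collect_less continuous_intros) auto
  also have "(\<Inter>k. {z::complex ^ 'n. norm (z $ k) < 1}) = unit_polydisc" by (auto simp: unit_polydisc_def)
  finally show ?thesis .
qed

lemma emeasure_unit_polydisc: "emeasure lborel (unit_polydisc :: (complex ^ 'n::finite) set) < \<infinity>"
  unfolding unit_polydisc_eq by (subst emeasure_polydisc) auto

lemma cnj_measurable [measurable]: "cnj \<in> borel_measurable borel"
  by (intro borel_measurable_continuous_onI continuous_intros)

lemma polydisc_kernel_measurable [measurable]: "polydisc_kernel a \<in> borel_measurable borel"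
  unfolding polydisc_kernel_def by measurable

lemma disc_kernel_bound:
  assumes "norm a < 1" "norm w < (1::real)"
  shows "norm (1 / (of_real pi * (1 - a * cnj w)\<^sup>2)) \<le> 1 / (pi * (1 - norm a)\<^sup>2)"
proof -
  have "(1 - norm a)\<^sup>2 \<le> (norm (1 - a * cnj w))\<^sup>2"
    using disc_kernel_denominator_bound[of w a] assms by (intro power_mono) auto
  then show ?thesis using assms by (simp add: norm_divide norm_mult norm_power frac_le)
qed

lemma polydisc_kernel_bound:
  assumes "a \<in> unit_polydisc" "w \<in> unit_polydisc"
  shows "norm (polydisc_kernel a w) \<le> (\<Prod>j\<in>UNIV. 1 / (pi * (1 - norm (a $ j))\<^sup>2))"
  unfolding polydisc_kernel_def prod_norm[symmetric]
  using assms by (intro prod_mono conjI norm_ge_zero disc_kernel_bound) (auto simp: unit_polydisc_def)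

text \<open>Apply the reproducing formula of the disc in one coordinate at a time. Boundedness makes the integrand absolutely
integrable on all slices at once.\<close>

lemma polydisc_reproducing_bounded:
  fixes f :: "complex ^ 'n::finite \<Rightarrow> complex"
  assumes f: "holomorphic_sv unit_polydisc f" and bound: "\<And>w. w \<in> unit_polydisc \<Longrightarrow> norm (f w) \<le> M"
    and a: "a \<in> unit_polydisc"
  shows "(LINT w|lborel. indicator unit_polydisc w *\<^sub>R (f w * polydisc_kernel a w)) = f a"
proof -
  define k where "k j w = indicator (ball 0 1) w *\<^sub>R (1 / (of_real pi * (1 - a $ j * cnj w)\<^sup>2))" for j w
  have [measurable]: "k j \<in> borel_measurable borel" for j unfolding k_def by measurable
  define g where "g w = indicator unit_polydisc w *\<^sub>R f w" for w
  have [measurable]: "g \<in> borel_measurable borel"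
    unfolding g_def by (rule holomorphic_sv_borel[OF f open_unit_polydisc])
  have M: "M \<ge> 0" by (rule order_trans[OF norm_ge_zero bound[OF a]])
  have gM: "norm (g w) \<le> M" for w using bound M by (simp add: g_def indicator_def)
  have a1: "norm (a $ j) < 1" for j using a by (simp add: unit_polydisc_def)
  define v where "v S x = (\<chi> j. if j \<in> S then x j else a $ j)" for S and x :: "'n \<Rightarrow> complex"
  have key: "(LINT x|PiM S (\<lambda>_. lborel). (\<Prod>j\<in>S. k j (x j)) * g (v S x)) = f a" if "finite S" for S
    using that
  proof (induction S rule: finite_induct)
    case empty
    have "v {} x = a" for x by (simp add: v_def vec_eq_iff)
    then show ?case using a by (simp add: g_def PiM_empty lebesgue_integral_count_space_finite)
  next
    case (insert i S)
    let ?F = "\<lambda>x. (\<Prod>j\<in>insert i S. k j (x j)) * g (v (insert i S) x)"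
    have vm: "(\<lambda>x. v T x) \<in> PiM T (\<lambda>_. lborel) \<rightarrow>\<^sub>M borel" for T
      unfolding v_def
    proof (rule borel_measurable_vec_lambda)
      fix j
      show "(\<lambda>x. if j \<in> T then x j else a $ j) \<in> borel_measurable (PiM T (\<lambda>_. lborel))"
        using measurable_component_singleton[of j T "\<lambda>_. lborel :: complex measure"] by (cases "j \<in> T") auto
    qed
    have int: "integrable (PiM (insert i S) (\<lambda>_. lborel)) ?F"
    proof (rule Bochner_Integration.integrable_bound)
      show "integrable (PiM (insert i S) (\<lambda>_. lborel))
          (\<lambda>x::'n \<Rightarrow> complex. (\<Prod>j\<in>insert i S. indicator (ball 0 1) (x j) * (1 / (pi * (1 - norm (a $ j))\<^sup>2))) * M)"
        using insert.hyps emeasure_lborel_ball_finite[of "0::complex" 1]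
        by (intro integrable_mult_left lborel_product.product_integrable_prod integrable_real_indicator) auto
      show "?F \<in> borel_measurable (PiM (insert i S) (\<lambda>_. lborel))"
      proof (intro borel_measurable_times borel_measurable_prod)
        show "(\<lambda>x. k j (x j)) \<in> borel_measurable (PiM (insert i S) (\<lambda>_. lborel))" if "j \<in> insert i S" for j
          using measurable_compose[OF measurable_component_singleton[OF that, of "\<lambda>_. lborel"], of "k j" borel] by simp
        show "(\<lambda>x. g (v (insert i S) x)) \<in> borel_measurable (PiM (insert i S) (\<lambda>_. lborel))"
          by (rule measurable_compose[OF vm]) simp
      qed
      show "AE x in PiM (insert i S) (\<lambda>_. lborel). norm (?F x)
         \<le> norm ((\<Prod>j\<in>insert i S. indicator (ball 0 1) (x j) * (1 / (pi * (1 - norm (a $ j))\<^sup>2))) * M)"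
      proof (rule AE_I2)
        fix x
        have "norm (k j (x j)) \<le> indicator (ball 0 1) (x j) * (1 / (pi * (1 - norm (a $ j))\<^sup>2))" for j
          using disc_kernel_bound[OF a1[of j], of "x j"] unfolding k_def
          by (cases "norm (x j) < 1") auto
        then have "norm (\<Prod>j\<in>insert i S. k j (x j)) \<le> (\<Prod>j\<in>insert i S. indicator (ball 0 1) (x j) * (1 / (pi * (1 - norm (a $ j))\<^sup>2)))"
          unfolding prod_norm[symmetric] by (intro prod_mono) auto
        then have "norm (?F x) \<le> (\<Prod>j\<in>insert i S. indicator (ball 0 1) (x j) * (1 / (pi * (1 - norm (a $ j))\<^sup>2))) * M"
          unfolding norm_mult by (intro mult_mono gM) (auto intro!: prod_nonneg)
        also have "\<dots> \<le> norm \<dots>" by (simp only: real_norm_def abs_ge_self)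
        finally show "norm (?F x) \<le> norm ((\<Prod>j\<in>insert i S. indicator (ball 0 1) (x j) * (1 / (pi * (1 - norm (a $ j))\<^sup>2))) * M)" .
      qed
    qed
    have inner: "(LINT y|lborel. ?F (x(i := y))) = (\<Prod>j\<in>S. k j (x j)) * g (v S x)" for x
    proof (cases "\<forall>j\<in>S. norm (x j) < 1")
      case False
      then obtain j where j: "j \<in> S" "k j (x j) = 0" by (auto simp: k_def indicator_def)
      then have "(\<Prod>j\<in>S. k j (x j)) = 0" using insert.hyps by (auto intro: prod_zero)
      moreover have "?F (x(i := y)) = 0" for y
      proof -
        have "(\<Prod>l\<in>insert i S. k l ((x(i := y)) l)) = 0"
          using insert.hyps j by (intro prod_zero) (auto intro!: bexI[of _ j])
        then show ?thesis by simp
      qed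
      ultimately show ?thesis by (simp only: mult_zero_left Bochner_Integration.integral_zero)
    next
      case True
      define s where "s y = v (insert i S) (x(i := y))" for y
      have s_in: "s y \<in> unit_polydisc \<longleftrightarrow> norm y < 1" for y
        using True a1 by (auto simp: s_def v_def unit_polydisc_def split: if_splits)
      have s_eq: "s y = (v S x - (a $ i) *s axis i 1) + y *s axis i 1" for y
        using insert.hyps by (auto simp: s_def v_def vec_eq_iff axis_def)
      have hol: "(\<lambda>y. f (s y)) holomorphic_on ball 0 1"
        unfolding s_eq by (rule holomorphic_on_line[OF f]) (use s_in in \<open>simp add: s_eq\<close>)
      have "(LINT y|lborel. indicator (ball 0 1) y *\<^sub>R (f (s y) / (of_real pi * (1 - a $ i * cnj y)\<^sup>2))) = f (s (a $ i))"
        by (rule disc_reproducing[OF hol _ a1]) (use s_in bound in auto)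
      note I = this
      have sa: "s (a $ i) = v S x"
        using insert.hyps by (auto simp: s_def v_def vec_eq_iff)
      have vD: "v S x \<in> unit_polydisc" using s_in[of "a $ i"] a1 sa by simp
      have FF: "?F (x(i := y)) = (\<Prod>j\<in>S. k j (x j)) * (indicator (ball 0 1) y *\<^sub>R (f (s y) / (of_real pi * (1 - a $ i * cnj y)\<^sup>2)))" for y
      proof -
        have "(\<Prod>j\<in>insert i S. k j ((x(i := y)) j)) = k i y * (\<Prod>j\<in>S. k j (x j))"
          using insert.hyps by (subst prod.insert) (auto intro!: arg_cong2[where f = "(*)"] prod.cong)
        moreover have "k i y * g (s y) = indicator (ball 0 1) y *\<^sub>R (f (s y) / (of_real pi * (1 - a $ i * cnj y)\<^sup>2))"
          using s_in[of y] by (simp add: k_def g_def indicator_def)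
        moreover have "(k i y * (\<Prod>j\<in>S. k j (x j))) * g (s y) = (\<Prod>j\<in>S. k j (x j)) * (k i y * g (s y))"
          by (simp only: mult_ac)
        ultimately show ?thesis unfolding s_def[symmetric] by (simp only:)
      qed
      have "(LINT y|lborel. ?F (x(i := y))) = (\<Prod>j\<in>S. k j (x j)) * f (v S x)"
        unfolding FF integral_mult_right_zero I sa ..
      then show ?thesis using vD by (simp only: g_def indicator_simps(1) scaleR_one)
    qed
    have "(LINT x|PiM (insert i S) (\<lambda>_. lborel). ?F x)
       = (LINT x|PiM S (\<lambda>_. lborel). (LINT y|lborel. ?F (x(i := y))))"
      by (rule lborel_product.product_integral_insert[OF insert.hyps int])
    also have "\<dots> = f a" unfolding inner by (rule insert.IH)
    finally show ?case .
  qed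
  have "(LINT w|lborel. indicator unit_polydisc w *\<^sub>R (f w * polydisc_kernel a w))
      = (LINT x|PiM (UNIV::'n set) (\<lambda>_. lborel). indicator unit_polydisc (\<chi> j. x j) *\<^sub>R (f (\<chi> j. x j) * polydisc_kernel a (\<chi> j. x j)))"
  proof (subst lborel_vec_eq_distr, rule integral_distr)
    have "(\<lambda>w. g w * polydisc_kernel a w) \<in> borel_measurable borel" by measurable
    then show "(\<lambda>w. indicator unit_polydisc w *\<^sub>R (f w * polydisc_kernel a w)) \<in> borel_measurable borel"
      by (simp add: g_def)
  qed measurable
  also have "\<dots> = (LINT x|PiM (UNIV::'n set) (\<lambda>_. lborel). (\<Prod>j\<in>UNIV. k j (x j)) * g (v UNIV x))"
  proof (rule Bochner_Integration.integral_cong[OF refl])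
    fix x :: "'n \<Rightarrow> complex"
    have vx: "v UNIV x = (\<chi> j. x j)" by (simp add: v_def)
    show "indicator unit_polydisc (\<chi> j. x j) *\<^sub>R (f (\<chi> j. x j) * polydisc_kernel a (\<chi> j. x j)) = (\<Prod>j\<in>UNIV. k j (x j)) * g (v UNIV x)"
    proof (cases "(\<chi> j. x j) \<in> unit_polydisc")
      case True
      then have "k j (x j) = 1 / (of_real pi * (1 - a $ j * cnj (x j))\<^sup>2)" for j
        by (simp add: k_def unit_polydisc_def)
      then show ?thesis using True by (simp add: vx g_def polydisc_kernel_def)
    qed (simp add: vx g_def)
  qed
  also have "\<dots> = f a" by (rule key) simp
  finally show ?thesis .
qed

lemma bergman_unit_polydisc_integrable:
  fixes f :: "complex ^ 'n::finite \<Rightarrow> complex"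
  assumes "f \<in> bergman_space unit_polydisc"
  shows "integrable lborel (\<lambda>w. indicator unit_polydisc w *\<^sub>R f w)"
proof (rule Bochner_Integration.integrable_bound)
  have m: "(\<lambda>w. indicator unit_polydisc w *\<^sub>R (norm (f w))\<^sup>2) \<in> borel_measurable borel"
    using bergman_spaceD(1)[OF assms] open_unit_polydisc
    by (intro borel_measurable_continuous_on_indicator continuous_intros holomorphic_sv_continuous_on) auto
  have "integrable lborel (\<lambda>w. indicator unit_polydisc w *\<^sub>R (norm (f w))\<^sup>2)"
    using bergman_spaceD(2)[OF assms] lebesgue_on_eq_lborel(1)[OF unit_polydisc_borel m] by simp
  moreover have "integrable lborel (indicator unit_polydisc :: complex ^ 'n \<Rightarrow> real)"
    using emeasure_unit_polydisc by (intro integrable_real_indicator) auto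
  ultimately show "integrable lborel (\<lambda>w. indicator unit_polydisc w + indicator unit_polydisc w *\<^sub>R (norm (f w))\<^sup>2)"
    by (intro Bochner_Integration.integrable_add)
  show "(\<lambda>w. indicator unit_polydisc w *\<^sub>R f w) \<in> borel_measurable lborel"
    using holomorphic_sv_borel[OF bergman_spaceD(1)[OF assms] open_unit_polydisc] by simp
  have "x \<le> 1 + x\<^sup>2" for x :: real
    using zero_le_power2[of "x - 1/2"] by (simp add: power2_eq_square algebra_simps)
  then show "AE w in lborel. norm (indicator unit_polydisc w *\<^sub>R f w)
     \<le> norm (indicator unit_polydisc w + indicator unit_polydisc w *\<^sub>R (norm (f w))\<^sup>2)"
    by (intro AE_I2) (auto simp: indicator_def)
qed

lemma bergman_unit_polydisc_kernel_integrable: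
  fixes f :: "complex ^ 'n::finite \<Rightarrow> complex"
  assumes f: "f \<in> bergman_space unit_polydisc" and a: "a \<in> unit_polydisc"
  shows "integrable lborel (\<lambda>w. indicator unit_polydisc w *\<^sub>R (f w * polydisc_kernel a w))"
proof (rule Bochner_Integration.integrable_bound)
  let ?C = "\<Prod>j\<in>UNIV. 1 / (pi * (1 - norm (a $ j))\<^sup>2)"
  show "integrable lborel (\<lambda>w. ?C *\<^sub>R (indicator unit_polydisc w *\<^sub>R f w))"
    by (intro integrable_scaleR_right bergman_unit_polydisc_integrable f)
  have [measurable]: "(\<lambda>w. indicator unit_polydisc w *\<^sub>R f w) \<in> borel_measurable borel"
    using holomorphic_sv_borel[OF bergman_spaceD(1)[OF f] open_unit_polydisc] .
  have "(\<lambda>w. (indicator unit_polydisc w *\<^sub>R f w) * polydisc_kernel a w) \<in> borel_measurable borel" by measurable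
  then show "(\<lambda>w. indicator unit_polydisc w *\<^sub>R (f w * polydisc_kernel a w)) \<in> borel_measurable lborel" by simp
  show "AE w in lborel. norm (indicator unit_polydisc w *\<^sub>R (f w * polydisc_kernel a w))
      \<le> norm (?C *\<^sub>R (indicator unit_polydisc w *\<^sub>R f w))"
  proof (rule AE_I2)
    fix w :: "complex ^ 'n"
    have C: "?C \<ge> 0" by (intro prod_nonneg) auto
    show "norm (indicator unit_polydisc w *\<^sub>R (f w * polydisc_kernel a w))
      \<le> norm (?C *\<^sub>R (indicator unit_polydisc w *\<^sub>R f w))"
    proof (cases "w \<in> unit_polydisc")
      case True
      have "norm (f w) * norm (polydisc_kernel a w) \<le> norm (f w) * ?C"
        by (intro mult_left_mono polydisc_kernel_bound a True) auto
      then show ?thesis using True C by (simp add: norm_mult mult.commute)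
    qed simp
  qed
qed

text \<open>The dilates \<open>f(r z)\<close> with \<open>r < 1\<close> are bounded. After rescaling, the integrals are dominated by a multiple
of \<open>|f|\<close>, so one can let \<open>r\<close> tend to 1.\<close>

theorem polydisc_reproducing:
  fixes f :: "complex ^ 'n::finite \<Rightarrow> complex"
  assumes f: "f \<in> bergman_space unit_polydisc" and a: "a \<in> unit_polydisc"
  shows "(LINT w|lborel. indicator unit_polydisc w *\<^sub>R (f w * polydisc_kernel a w)) = f a"
proof -
  let ?D = "unit_polydisc :: (complex ^ 'n) set"
  let ?d = "DIM(complex ^ 'n)"
  note hol = bergman_spaceD(1)[OF f]
  \<comment> \<open>Any sequence in the open unit interval tending to 1 would do.\<close>
  define r where "r n = real (Suc n) / real (Suc (Suc n))" for n
  have r: "0 < r n" "r n < 1" for n by (auto simp: r_def)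
  have rlim: "r \<longlonglongrightarrow> 1"
  proof -
    have "(\<lambda>n. real (Suc n) / real (Suc (Suc n))) \<longlonglongrightarrow> 1"
      using LIMSEQ_Suc[OF LIMSEQ_n_over_Suc_n] by simp
    then show ?thesis unfolding r_def .
  qed
  have [measurable]: "(\<lambda>w. indicator ?D w *\<^sub>R f w) \<in> borel_measurable borel"
    by (rule holomorphic_sv_borel[OF hol open_unit_polydisc])
  have scale_in: "r n *\<^sub>R w \<in> ?D" if "w \<in> ?D" for w n
    using that r[of n] by (auto simp: unit_polydisc_def intro: le_less_trans[OF mult_left_le_one_le])
  have fr: "(LINT w|lborel. indicator ?D w *\<^sub>R (f (r n *\<^sub>R w) * polydisc_kernel a w)) = f (r n *\<^sub>R a)" for n
  proof -
    have hol': "holomorphic_sv ?D (\<lambda>w. f (r n *\<^sub>R w))"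
    proof (rule holomorphic_sv_compose[OF hol])
      show "holomorphic_sv ?D (\<lambda>w. (r n *\<^sub>R w) $ k)" for k
      proof -
        have "(r n *\<^sub>R w) $ k = of_real (r n) * w $ k" for w :: "complex ^ 'n"
          by (simp only: vector_scaleR_component) (simp only: scaleR_conv_of_real)
        then show ?thesis
          using holomorphic_sv_mult[OF holomorphic_sv_const[of ?D "of_real (r n)"] holomorphic_sv_nth[of ?D k]] by simp
      qed
    qed (rule scale_in)
    let ?E = "{z :: complex ^ 'n. \<forall>k. norm (z $ k) \<le> r n}"
    have "closed (\<Inter>k. {z :: complex ^ 'n. norm (z $ k) \<le> r n})"
      by (intro closed_INT ballI closed_Collect_le continuous_intros)
    moreover have "?E = (\<Inter>k. {z :: complex ^ 'n. norm (z $ k) \<le> r n})" by auto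
    moreover have "bounded ?E"
    proof (rule boundedI)
      fix x :: "complex ^ 'n" assume "x \<in> ?E"
      then show "norm x \<le> (\<Sum>k\<in>(UNIV::'n set). r n)"
        by (intro order_trans[OF norm_le_sum_components] sum_mono) auto
    qed
    ultimately have "compact ?E" by (simp add: compact_eq_bounded_closed)
    moreover have "?E \<subseteq> ?D" using r(2)[of n] by (auto simp: unit_polydisc_def intro: le_less_trans)
    ultimately have "compact (f ` ?E)"
      using holomorphic_sv_continuous_on[OF hol] by (intro compact_continuous_image) (auto intro: continuous_on_subset)
    then obtain M where M: "\<And>z. z \<in> ?E \<Longrightarrow> norm (f z) \<le> M"
      using compact_imp_bounded[of "f ` ?E"] unfolding bounded_iff by blast
    show ?thesis
    proof (rule polydisc_reproducing_bounded[OF hol' _ a])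
      fix w assume w: "w \<in> ?D"
      have "norm ((r n *\<^sub>R w) $ k) \<le> r n" for k
        using w r[of n] by (auto simp: unit_polydisc_def intro!: mult_left_le less_imp_le)
      then show "norm (f (r n *\<^sub>R w)) \<le> M" by (intro M) simp
    qed
  qed
  define F where "F n v = indicator ?D (v /\<^sub>R r n) *\<^sub>R (f v * polydisc_kernel a (v /\<^sub>R r n))" for n v
  have in_D: "v \<in> ?D" if "v /\<^sub>R r n \<in> ?D" for v n
    using scale_in[OF that, of n] r[of n] by simp
  have F_eq: "F n v = indicator ?D (v /\<^sub>R r n) *\<^sub>R ((indicator ?D v *\<^sub>R f v) * polydisc_kernel a (v /\<^sub>R r n))" for n v
    using in_D[of n v] by (auto simp: F_def indicator_def)
  have [measurable]: "F n \<in> borel_measurable borel" for n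
  proof -
    have [measurable]: "(\<lambda>v. v /\<^sub>R r n) \<in> borel_measurable (borel :: (complex ^ 'n) measure)" by measurable
    show ?thesis unfolding F_eq[abs_def] by measurable
  qed
  have sub: "(LINT v|lborel. F n v) = of_real (r n ^ ?d) * f (r n *\<^sub>R a)" for n
  proof -
    have "(LINT v|lborel. F n v) = (LINT v|density (distr lborel borel (\<lambda>x. 0 + r n *\<^sub>R x)) (\<lambda>_. ennreal (\<bar>r n\<bar> ^ ?d)). F n v)"
      using lborel_affine[of "r n" "0 :: complex ^ 'n"] r[of n] by simp
    also have "\<dots> = (LINT x|lborel. (r n ^ ?d) *\<^sub>R F n (r n *\<^sub>R x))"
      using r[of n] by (subst integral_density) (auto simp: integral_distr)
    also have "\<dots> = (r n ^ ?d) *\<^sub>R (LINT x|lborel. F n (r n *\<^sub>R x))" by simp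
    also have "(LINT x|lborel. F n (r n *\<^sub>R x)) = f (r n *\<^sub>R a)"
      using fr[of n] r[of n] by (simp add: F_def)
    finally show ?thesis by (simp add: scaleR_conv_of_real)
  qed
  let ?C = "\<Prod>j\<in>UNIV. 1 / (pi * (1 - norm (a $ j))\<^sup>2)"
  have C: "?C \<ge> 0" by (intro prod_nonneg) auto
  have "(\<lambda>n. LINT v|lborel. F n v) \<longlonglongrightarrow> (LINT v|lborel. indicator ?D v *\<^sub>R (f v * polydisc_kernel a v))"
  proof (rule integral_dominated_convergence)
    have "(\<lambda>w. (indicator unit_polydisc w *\<^sub>R f w) * polydisc_kernel a w) \<in> borel_measurable borel" by measurable
    then show "(\<lambda>v. indicator ?D v *\<^sub>R (f v * polydisc_kernel a v)) \<in> borel_measurable lborel" by simp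
    show "integrable lborel (\<lambda>v. norm (?C *\<^sub>R (indicator ?D v *\<^sub>R f v)))"
      by (intro integrable_norm integrable_scaleR_right bergman_unit_polydisc_integrable f)
    show "AE v in lborel. norm (F n v) \<le> norm (?C *\<^sub>R (indicator ?D v *\<^sub>R f v))" for n
    proof (rule AE_I2)
      fix v :: "complex ^ 'n"
      show "norm (F n v) \<le> norm (?C *\<^sub>R (indicator ?D v *\<^sub>R f v))"
      proof (cases "v /\<^sub>R r n \<in> ?D")
        case True
        have "norm (f v) * norm (polydisc_kernel a (v /\<^sub>R r n)) \<le> norm (f v) * ?C"
          by (intro mult_left_mono polydisc_kernel_bound a True) auto
        then show ?thesis using True in_D[OF True] C by (simp add: F_def norm_mult mult.commute)
      qed (simp add: F_def)
    qed
    show "AE v in lborel. (\<lambda>n. F n v) \<longlonglongrightarrow> indicator ?D v *\<^sub>R (f v * polydisc_kernel a v)"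
    proof (rule AE_I2)
      fix v :: "complex ^ 'n"
      show "(\<lambda>n. F n v) \<longlonglongrightarrow> indicator ?D v *\<^sub>R (f v * polydisc_kernel a v)"
      proof (cases "v \<in> ?D")
        case False
        then have "F n v = 0" for n using in_D[of n v] by (auto simp: F_def indicator_def)
        then show ?thesis using False by simp
      next
        case True
        have "(\<lambda>n. v /\<^sub>R r n) \<longlonglongrightarrow> v /\<^sub>R 1" by (intro tendsto_intros rlim) simp
        then have lim: "(\<lambda>n. v /\<^sub>R r n) \<longlonglongrightarrow> v" by simp
        then have ev: "\<forall>\<^sub>F n in sequentially. v /\<^sub>R r n \<in> ?D"
          by (rule topological_tendstoD[OF _ open_unit_polydisc True])
        have "(\<lambda>n. f v * polydisc_kernel a (v /\<^sub>R r n)) \<longlonglongrightarrow> f v * polydisc_kernel a v"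
          unfolding polydisc_kernel_def
        proof (intro tendsto_intros lim)
          fix j
          show "complex_of_real pi * (1 - a $ j * cnj (v $ j))\<^sup>2 \<noteq> 0"
            using disc_kernel_denominator_nz[of "a $ j" "v $ j"] a True by (auto simp: unit_polydisc_def less_imp_le)
        qed
        moreover have "\<forall>\<^sub>F n in sequentially. f v * polydisc_kernel a (v /\<^sub>R r n) = F n v"
          using ev by eventually_elim (simp add: F_def)
        ultimately show ?thesis using True by (simp add: Lim_transform_eventually)
      qed
    qed
  qed auto
  moreover have "(\<lambda>n. LINT v|lborel. F n v) \<longlonglongrightarrow> of_real (1 ^ ?d) * f (1 *\<^sub>R a)"
    unfolding sub
  proof (intro tendsto_intros rlim)
    have "isCont f a"
      using holomorphic_sv_continuous_on[OF hol] a continuous_on_eq_continuous_at[OF open_unit_polydisc] by blast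
    moreover have "(\<lambda>n. r n *\<^sub>R a) \<longlonglongrightarrow> 1 *\<^sub>R a" by (intro tendsto_intros rlim)
    ultimately show "(\<lambda>n. f (r n *\<^sub>R a)) \<longlonglongrightarrow> f (1 *\<^sub>R a)"
      using isCont_tendsto_compose[of "1 *\<^sub>R a" f] by simp
  qed
  ultimately show ?thesis using LIMSEQ_unique by fastforce
qed

section \<open>Change of variables along the monomial map\<close>

definition vec_inverse :: "complex ^ 'n \<Rightarrow> complex ^ 'n::finite" where
  "vec_inverse x = (\<chi> k. inverse (x $ k))"

lemma vec_inverse_measurable [measurable]: "vec_inverse \<in> borel \<rightarrow>\<^sub>M borel"
  unfolding vec_inverse_def by measurable

lemma vec_inverse_mult: "x \<in> regular \<Longrightarrow> vec_inverse x * x = 1" "x \<in> regular \<Longrightarrow> x * vec_inverse x = 1"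
  by (auto simp: vec_inverse_def regular_def vec_eq_iff)

lemma vec_inverse_regular: "x \<in> regular \<Longrightarrow> vec_inverse x \<in> regular"
  by (simp add: vec_inverse_def regular_def)

lemma mult_regular: "x \<in> regular \<Longrightarrow> y \<in> regular \<Longrightarrow> x * y \<in> regular"
  by (simp add: regular_def)

lemma powi_bounds:
  fixes y :: real
  assumes "inverse 2 \<le> y" "y \<le> 1"
  shows "inverse (2 ^ nat \<bar>b\<bar>) \<le> y powi b" "y powi b \<le> 2 ^ nat \<bar>b\<bar>"
proof -
  have y: "y > 0" using assms(1) by (rule less_le_trans[rotated]) simp
  have p: "inverse (2 ^ n) \<le> y ^ n" "y ^ n \<le> 1" for n
  proof -
    have "inverse (2::real) ^ n \<le> y ^ n" by (rule power_mono[OF assms(1)]) simp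
    then show "inverse (2 ^ n) \<le> y ^ n" by (simp only: power_inverse)
    show "y ^ n \<le> 1" using y assms(2) by (simp add: power_le_one)
  qed
  have one: "(1::real) \<le> 2 ^ n" for n by simp
  show "inverse (2 ^ nat \<bar>b\<bar>) \<le> y powi b"
  proof (cases "b \<ge> 0")
    case True
    then show ?thesis using p(1)[of "nat b"] by (simp add: power_int_def)
  next
    case False
    have "inverse (2 ^ nat \<bar>b\<bar>) \<le> (1::real)" using one by (simp add: inverse_le_1_iff)
    also have "1 \<le> inverse (y ^ nat (- b))" using p(2) y by (simp add: one_le_inverse)
    finally show ?thesis using False by (simp add: power_int_def power_inverse)
  qed
  show "y powi b \<le> 2 ^ nat \<bar>b\<bar>"
  proof (cases "b \<ge> 0")
    case True
    then show ?thesis using order_trans[OF p(2) one] by (simp add: power_int_def)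
  next
    case False
    have "inverse (y ^ nat (- b)) \<le> inverse (inverse (2 ^ nat (- b)))"
      by (rule le_imp_inverse_le[OF p(1)]) simp
    then show ?thesis using False by (simp add: power_int_def power_inverse)
  qed
qed

lemma prod_of_inverse: "(\<Prod>k\<in>S. inverse (f k)) = inverse (\<Prod>k\<in>S. f k)" for f :: "'b \<Rightarrow> 'c::field"
  using prod_inversef[of f S] by (simp add: o_def)

context monomial_cover
begin

lemma Phi_one [simp]: "Phi 1 = 1" by (simp add: Phi_def vec_eq_iff)

lemma Phi_vec_inverse: "x \<in> regular \<Longrightarrow> Phi (vec_inverse x) = vec_inverse (Phi x)"
  by (simp add: Phi_def vec_inverse_def vec_eq_iff power_inverse prod_of_inverse)

text \<open>Needed for finiteness of the constant in the push-forward: the preimage of a product of closed annuli is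
contained in such a product.\<close>

lemma Phi_preimage_annulus:
  obtains r where "r > 0" "r \<le> 1"
    "\<And>x j. x \<in> regular \<Longrightarrow> (\<And>k. inverse 2 \<le> norm (Phi x $ k) \<and> norm (Phi x $ k) \<le> 1)
       \<Longrightarrow> r \<le> norm (x $ j) \<and> norm (x $ j) \<le> inverse r"
proof
  let ?N = "\<Sum>j\<in>UNIV. \<Sum>k\<in>UNIV. nat \<bar>B $ j $ k\<bar>"
  show "inverse (2 ^ ?N) > (0::real)" by simp
  show "inverse (2 ^ ?N) \<le> (1::real)" by (simp add: inverse_le_1_iff)
  fix x j assume x: "x \<in> regular" and E: "\<And>k. inverse 2 \<le> norm (Phi x $ k) \<and> norm (Phi x $ k) \<le> 1"
  let ?n = "\<Sum>k\<in>UNIV. nat \<bar>B $ j $ k\<bar>"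
  have n: "?n \<le> ?N" by (rule member_le_sum[of j UNIV "\<lambda>j. \<Sum>k\<in>UNIV. nat \<bar>B $ j $ k\<bar>"]) auto
  have pw: "(2::real) ^ ?n \<le> 2 ^ ?N" using n by (intro power_increasing) auto
  have b: "inverse (2 ^ ?n) \<le> norm (x $ j) ^ m j" "norm (x $ j) ^ m j \<le> 2 ^ ?n"
  proof -
    have "(\<Prod>k\<in>UNIV. inverse (2 ^ nat \<bar>B $ j $ k\<bar>)) \<le> (\<Prod>k\<in>UNIV. norm (Phi x $ k) powi (B $ j $ k))"
      by (intro prod_mono conjI powi_bounds) (use E in auto)
    then show "inverse (2 ^ ?n) \<le> norm (x $ j) ^ m j"
      unfolding Phi_powi(1)[OF x] by (simp add: prod_of_inverse power_sum)
    have "(\<Prod>k\<in>UNIV. norm (Phi x $ k) powi (B $ j $ k)) \<le> (\<Prod>k\<in>UNIV. 2 ^ nat \<bar>B $ j $ k\<bar>)"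
      by (intro prod_mono conjI powi_bounds) (use E in auto)
    then show "norm (x $ j) ^ m j \<le> 2 ^ ?n"
      unfolding Phi_powi(1)[OF x] by (simp add: power_sum)
  qed
  have m1: "1 \<le> m j" using m_pos[of j] by simp
  show "inverse (2 ^ ?N) \<le> norm (x $ j) \<and> norm (x $ j) \<le> inverse (inverse (2 ^ ?N))"
  proof
    show "inverse (2 ^ ?N) \<le> norm (x $ j)"
    proof (cases "norm (x $ j) \<le> 1")
      case True
      have "inverse (2 ^ ?N) \<le> (inverse (2 ^ ?n) :: real)" using pw by (intro le_imp_inverse_le) auto
      also have "\<dots> \<le> norm (x $ j) ^ m j" by (rule b)
      also have "\<dots> \<le> norm (x $ j) ^ 1" using True m1 by (intro power_decreasing) auto
      finally show ?thesis by simp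
    next
      case False
      have "inverse (2 ^ ?N) \<le> (1::real)" by (simp add: inverse_le_1_iff)
      then show ?thesis using False by simp
    qed
    show "norm (x $ j) \<le> inverse (inverse (2 ^ ?N))"
    proof (cases "norm (x $ j) \<le> 1")
      case True
      moreover have "(1::real) \<le> 2 ^ ?N" by simp
      ultimately show ?thesis unfolding inverse_inverse_eq by linarith
    next
      case False
      have "norm (x $ j) ^ 1 \<le> norm (x $ j) ^ m j" using False m1 by (intro power_increasing) auto
      also have "\<dots> \<le> 2 ^ ?n" by (rule b)
      also have "\<dots> \<le> 2 ^ ?N" by (rule pw)
      finally show ?thesis by simp
    qed
  qed
qed

text \<open>The multiplicative instance of the push-forward lemma, tested on a product of annuli.\<close>

lemma cover_haar:
  obtains c where "c > 0" "\<And>f. f \<in> borel_measurable borel \<Longrightarrow>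
    (\<integral>\<^sup>+x. f (Phi x) \<partial>mult_haar) = ennreal c * (\<integral>\<^sup>+x. f x \<partial>mult_haar)"
proof -
  define E where "E = {z :: complex ^ 'n. \<forall>k. 1 \<le> norm (z $ k) \<and> norm (z $ k) \<le> 2}"
  have [measurable]: "E \<in> sets borel" unfolding E_def by measurable
  have bdd: "bounded {z :: complex ^ 'n. \<forall>k. r \<le> norm (z $ k) \<and> norm (z $ k) \<le> R}" for r R
  proof (rule boundedI)
    fix x :: "complex ^ 'n" assume "x \<in> {z. \<forall>k. r \<le> norm (z $ k) \<and> norm (z $ k) \<le> R}"
    then show "norm x \<le> (\<Sum>k\<in>(UNIV::'n set). R)"
      by (intro order_trans[OF norm_le_sum_components] sum_mono) auto
  qed
  define G1 where "G1 = emeasure mult_haar E"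
  define G2 where "G2 = (\<integral>\<^sup>+x. indicator E (vec_inverse (Phi x)) \<partial>mult_haar)"
  have main: "(\<integral>\<^sup>+x. f (Phi x) \<partial>mult_haar) * G1 = G2 * (\<integral>\<^sup>+x. f x \<partial>mult_haar)"
    if f: "f \<in> borel_measurable borel" for f
  proof -
    have "(\<integral>\<^sup>+x. f (Phi x) \<partial>mult_haar) * (\<integral>\<^sup>+x. indicator E x \<partial>mult_haar)
      = (\<integral>\<^sup>+x. indicator E (vec_inverse (Phi x)) \<partial>mult_haar) * (\<integral>\<^sup>+x. f x \<partial>mult_haar)"
    proof (rule invariant_measure_pushforward[where m = "(*)" and X = regular])
      show "(\<lambda>(x, y). x * y) \<in> borel \<Otimes>\<^sub>M borel \<rightarrow>\<^sub>M (borel :: (complex ^ 'n) measure)" by measurable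
      show "vec_inverse (x * y) * x = vec_inverse y" if "x \<in> regular" "y \<in> regular" for x y :: "complex ^ 'n"
        using that by (simp add: vec_inverse_def regular_def vec_eq_iff field_simps)
      show "\<exists>x\<in>regular. Phi x = y" if "y \<in> regular" for y
        using Phi_psi[OF that] psi_regular by blast
    qed (use f in \<open>auto simp: sigma_finite_mult_haar AE_mult_haar_regular nn_integral_mult_haar_mult Phi_regular
          vec_inverse_regular Phi_mult mult.commute\<close>)
    then show ?thesis by (simp add: G1_def G2_def)
  qed
  have G1_fin: "G1 < \<infinity>"
    unfolding G1_def by (rule emeasure_mult_haar_finite[of _ 1]) (use bdd[of 1 2] in \<open>auto simp: E_def\<close>)
  have G1_pos: "G1 > 0"
  proof -
    have op: "open (\<Inter>k. {z :: complex ^ 'n. 1 < norm (z $ k)} \<inter> {z. norm (z $ k) < 2})"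
      by (intro open_INT ballI open_Int open_Collect_less continuous_intros) auto
    have "0 < emeasure mult_haar (\<Inter>k. {z :: complex ^ 'n. 1 < norm (z $ k)} \<inter> {z. norm (z $ k) < 2})"
    proof (rule emeasure_mult_haar_pos[OF op])
      have "(\<chi> k. 3/2) \<in> (\<Inter>k. {z :: complex ^ 'n. 1 < norm (z $ k)} \<inter> {z. norm (z $ k) < 2})" by (simp add: norm_divide)
      then show "(\<Inter>k. {z :: complex ^ 'n. 1 < norm (z $ k)} \<inter> {z. norm (z $ k) < 2}) \<noteq> {}" by blast
      show "(\<Inter>k. {z :: complex ^ 'n. 1 < norm (z $ k)} \<inter> {z. norm (z $ k) < 2}) \<subseteq> regular"
      proof
        fix z assume "z \<in> (\<Inter>k. {z :: complex ^ 'n. 1 < norm (z $ k)} \<inter> {z. norm (z $ k) < 2})"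
        then have "1 < norm (z $ k)" for k by auto
        then have "z $ k \<noteq> 0" for k using less_trans[OF zero_less_one] by fastforce
        then show "z \<in> regular" by (simp add: regular_def)
      qed
    qed
    also have "\<dots> \<le> G1" unfolding G1_def by (intro emeasure_mono) (auto simp: E_def intro: less_imp_le)
    finally show ?thesis .
  qed
  have G2_fin: "G2 < \<infinity>"
  proof -
    obtain r where r: "r > 0" "r \<le> 1" "\<And>x j. x \<in> regular \<Longrightarrow> (\<And>k. inverse 2 \<le> norm (Phi x $ k) \<and> norm (Phi x $ k) \<le> 1)
       \<Longrightarrow> r \<le> norm (x $ j) \<and> norm (x $ j) \<le> inverse r"
      using Phi_preimage_annulus by blast
    define E' where "E' = {z :: complex ^ 'n. \<forall>k. r \<le> norm (z $ k) \<and> norm (z $ k) \<le> inverse r}"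
    have [measurable]: "E' \<in> sets borel" unfolding E'_def by measurable
    have "G2 \<le> (\<integral>\<^sup>+x. indicator E' x \<partial>mult_haar)"
      unfolding G2_def
    proof (rule nn_integral_mono_AE, use AE_mult_haar_regular in eventually_elim)
      case (elim x)
      have "x \<in> E'" if "vec_inverse (Phi x) \<in> E"
      proof -
        have "inverse 2 \<le> norm (Phi x $ k) \<and> norm (Phi x $ k) \<le> 1" for k
        proof -
          have 1: "1 \<le> inverse (norm (Phi x $ k))" "inverse (norm (Phi x $ k)) \<le> 2"
            using that by (auto simp: E_def vec_inverse_def norm_inverse)
          have pos: "norm (Phi x $ k) > 0" using Phi_regular[OF elim] by (simp add: regular_def)
          show ?thesis using 1 pos by (simp add: field_simps)
        qed
        then show ?thesis using r(3)[OF elim] by (simp add: E'_def)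
      qed
      then show ?case by (auto simp: indicator_def)
    qed
    also have "\<dots> < \<infinity>"
      using emeasure_mult_haar_finite[of E' r] bdd[of r "inverse r"] r(1) by (auto simp: E'_def[symmetric]) (auto simp: E'_def)
    finally show ?thesis .
  qed
  have G2_pos: "G2 > 0"
  proof (rule ccontr)
    assume "\<not> G2 > 0"
    then have "emeasure mult_haar (UNIV :: (complex ^ 'n) set) * G1 = 0"
      using main[of "\<lambda>_. 1"] by (simp add: mult_haar_def)
    then have "emeasure mult_haar (UNIV :: (complex ^ 'n) set) = 0" using G1_pos by auto
    moreover have "G1 \<le> emeasure mult_haar (UNIV :: (complex ^ 'n) set)"
      unfolding G1_def by (intro emeasure_mono) auto
    ultimately show False using G1_pos by simp
  qed
  obtain g1 where g1: "G1 = ennreal g1" "g1 > 0" using G1_fin G1_pos by (cases G1) auto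
  obtain g2 where g2: "G2 = ennreal g2" "g2 > 0" using G2_fin G2_pos by (cases G2) auto
  show thesis
  proof (rule that)
    show "g2 / g1 > 0" using g1 g2 by simp
    fix f :: "complex ^ 'n \<Rightarrow> ennreal" assume f: "f \<in> borel_measurable borel"
    have inv: "ennreal g1 * ennreal (1 / g1) = 1" using g1 by (simp add: ennreal_mult[symmetric])
    have "(\<integral>\<^sup>+x. f (Phi x) \<partial>mult_haar) = (\<integral>\<^sup>+x. f (Phi x) \<partial>mult_haar) * (ennreal g1 * ennreal (1 / g1))"
      unfolding inv by simp
    also have "\<dots> = ennreal g2 * (\<integral>\<^sup>+x. f x \<partial>mult_haar) * ennreal (1 / g1)"
      using main[OF f] g1 g2 by (simp add: mult.assoc[symmetric])
    also have "\<dots> = (ennreal g2 * ennreal (1 / g1)) * (\<integral>\<^sup>+x. f x \<partial>mult_haar)" by (simp only: mult_ac)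
    also have "ennreal g2 * ennreal (1 / g1) = ennreal (g2 / g1)" using g1 g2 by (simp add: ennreal_mult[symmetric])
    finally show "(\<integral>\<^sup>+x. f (Phi x) \<partial>mult_haar) = ennreal (g2 / g1) * (\<integral>\<^sup>+x. f x \<partial>mult_haar)" .
  qed
qed

text \<open>Translation of the previous lemma to Lebesgue measure through \<open>prod_Phi\<close>.\<close>

lemma cover_lborel:
  obtains c where "c > 0" "\<And>f. f \<in> borel_measurable borel \<Longrightarrow>
    (\<integral>\<^sup>+z. ennreal ((norm (jac z))\<^sup>2) * f (Phi z) \<partial>lborel) = ennreal c * (\<integral>\<^sup>+w. f w \<partial>lborel)"
proof -
  obtain c where c: "c > 0" "\<And>f. f \<in> borel_measurable borel \<Longrightarrow>
    (\<integral>\<^sup>+x. f (Phi x) \<partial>mult_haar) = ennreal c * (\<integral>\<^sup>+x. f x \<partial>mult_haar)"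
    using cover_haar by blast
  let ?q = "\<lambda>z::complex^'n. \<Prod>k\<in>UNIV. (norm (z $ k))\<^sup>2"
  have "(\<integral>\<^sup>+z. ennreal ((norm (jac z))\<^sup>2) * f (Phi z) \<partial>lborel) = ennreal c * (\<integral>\<^sup>+w. f w \<partial>lborel)"
    if [measurable]: "f \<in> borel_measurable borel" for f
  proof -
    define h where "h w = ennreal (?q w) * f w" for w
    have cancel: "ennreal (inverse q) * ennreal (y * q) = ennreal y" if "q > 0" "y \<ge> 0" for q y :: real
      using that by (simp add: ennreal_mult'[symmetric])
    have [measurable]: "h \<in> borel_measurable borel" unfolding h_def by measurable
    have q0: "?q z \<ge> 0" for z by (intro prod_nonneg) auto
    have inv: "(\<Prod>k\<in>UNIV. inverse ((norm (z $ k))\<^sup>2)) = inverse (?q z)" for z :: "complex ^ 'n"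
      by (simp add: prod_of_inverse)
    have 1: "(\<integral>\<^sup>+w. h w \<partial>mult_haar) = (\<integral>\<^sup>+w. f w \<partial>lborel)"
    proof (subst nn_integral_mult_haar, simp, rule nn_integral_cong_AE, use AE_regular in eventually_elim)
      case (elim z)
      then have "?q z > 0" by (intro prod_pos) (auto simp: regular_def)
      from cancel[OF this, of 1] have "ennreal (inverse (?q z)) * ennreal (?q z) = 1" by simp
      then show ?case unfolding inv h_def by (simp add: mult.assoc[symmetric])
    qed
    have 2: "(\<integral>\<^sup>+z. h (Phi z) \<partial>mult_haar) = (\<integral>\<^sup>+z. ennreal ((norm (jac z))\<^sup>2) * f (Phi z) \<partial>lborel)"
    proof (subst nn_integral_mult_haar, simp, rule nn_integral_cong_AE, use AE_regular in eventually_elim)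
      case (elim z)
      have q: "?q z > 0" using elim by (intro prod_pos) (auto simp: regular_def)
      have "?q (Phi z) = (norm (jac z))\<^sup>2 * ?q z"
      proof -
        have "?q w = (norm (\<Prod>k\<in>UNIV. w $ k))\<^sup>2" for w by (simp add: prod_norm[symmetric] prod_power_distrib)
        then show ?thesis by (simp add: prod_Phi norm_mult power_mult_distrib)
      qed
      then have "ennreal (inverse (?q z)) * ennreal (?q (Phi z)) = ennreal ((norm (jac z))\<^sup>2)"
        using cancel[OF q] by simp
      then show ?case unfolding inv h_def by (simp add: mult.assoc[symmetric])
    qed
    show ?thesis using c(2)[of h] 1 2 by simp
  qed
  with c(1) show thesis using that by blast
qed

text \<open>The number of sheets of \<open>Phi\<close> times the constant in its Jacobian determinant.\<close>

definition cover_const :: real where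
  "cover_const = (SOME c. c > 0 \<and> (\<forall>f\<in>borel_measurable borel.
    (\<integral>\<^sup>+z. ennreal ((norm (jac z))\<^sup>2) * f (Phi z) \<partial>lborel) = ennreal c * (\<integral>\<^sup>+w. f w \<partial>lborel)))"

lemma cover_const_pos: "cover_const > 0"
  and nn_integral_cover: "f \<in> borel_measurable borel \<Longrightarrow>
    (\<integral>\<^sup>+z. ennreal ((norm (jac z))\<^sup>2) * f (Phi z) \<partial>lborel) = ennreal cover_const * (\<integral>\<^sup>+w. f w \<partial>lborel)"
proof -
  obtain c where c: "c > 0" "\<And>f. f \<in> borel_measurable borel \<Longrightarrow>
    (\<integral>\<^sup>+z. ennreal ((norm (jac z))\<^sup>2) * f (Phi z) \<partial>lborel) = ennreal c * (\<integral>\<^sup>+w. f w \<partial>lborel)"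
    using cover_lborel by blast
  have "\<exists>c. c > 0 \<and> (\<forall>f\<in>borel_measurable borel.
    (\<integral>\<^sup>+z. ennreal ((norm (jac z))\<^sup>2) * f (Phi z) \<partial>lborel) = ennreal c * (\<integral>\<^sup>+w. f w \<partial>lborel))"
    by (intro exI[of _ c] conjI ballI c)
  note * = someI_ex[OF this, folded cover_const_def]
  show "cover_const > 0" by (rule conjunct1[OF *])
  show "(\<integral>\<^sup>+z. ennreal ((norm (jac z))\<^sup>2) * f (Phi z) \<partial>lborel) = ennreal cover_const * (\<integral>\<^sup>+w. f w \<partial>lborel)"
    if "f \<in> borel_measurable borel"
    using conjunct2[OF *] that by (rule bspec)
qed

lemma integral_cover:
  fixes g :: "complex ^ 'n \<Rightarrow> complex"
  assumes [measurable]: "g \<in> borel_measurable borel"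
  shows "(LINT z|lborel. (norm (jac z))\<^sup>2 *\<^sub>R g (Phi z)) = cover_const *\<^sub>R (LINT w|lborel. g w)"
proof -
  have eq: "distr (density lborel (\<lambda>z. ennreal ((norm (jac z))\<^sup>2))) borel Phi = density lborel (\<lambda>_. ennreal cover_const)"
  proof (rule measure_eqI)
    fix A assume "A \<in> sets (distr (density lborel (\<lambda>z. ennreal ((norm (jac z))\<^sup>2))) borel Phi)"
    then have [measurable]: "A \<in> sets borel" by simp
    have "emeasure (distr (density lborel (\<lambda>z. ennreal ((norm (jac z))\<^sup>2))) borel Phi) A
       = (\<integral>\<^sup>+w. indicator A w \<partial>distr (density lborel (\<lambda>z. ennreal ((norm (jac z))\<^sup>2))) borel Phi)" by simp
    also have "\<dots> = (\<integral>\<^sup>+z. ennreal ((norm (jac z))\<^sup>2) * indicator A (Phi z) \<partial>lborel)"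
      by (subst nn_integral_distr) (auto simp: nn_integral_density)
    also have "\<dots> = ennreal cover_const * (\<integral>\<^sup>+w. indicator A w \<partial>lborel)"
      by (rule nn_integral_cover) measurable
    also have "\<dots> = (\<integral>\<^sup>+w. ennreal cover_const * indicator A w \<partial>lborel)"
      by (rule nn_integral_cmult[symmetric]) measurable
    also have "\<dots> = emeasure (density lborel (\<lambda>_. ennreal cover_const)) A"
      by (rule emeasure_density[symmetric]) auto
    finally show "emeasure (distr (density lborel (\<lambda>z. ennreal ((norm (jac z))\<^sup>2))) borel Phi) A
       = emeasure (density lborel (\<lambda>_. ennreal cover_const)) A" .
  qed simp
  have "(LINT z|lborel. (norm (jac z))\<^sup>2 *\<^sub>R g (Phi z)) = (LINT w|distr (density lborel (\<lambda>z. ennreal ((norm (jac z))\<^sup>2))) borel Phi. g w)"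
    by (subst integral_distr) (auto simp: integral_density)
  also have "\<dots> = (LINT w|lborel. cover_const *\<^sub>R g w)"
    unfolding eq using cover_const_pos by (intro integral_density) auto
  finally show ?thesis by simp
qed

text \<open>The group of deck transformations; it acts by multiplication.\<close>

definition deck :: "(complex ^ 'n) set" where "deck = {w \<in> regular. Phi w = 1}"

lemma deck_root: "w \<in> deck \<Longrightarrow> w $ j ^ m j = 1"
  using Phi_powi(2)[of w j] by (simp add: deck_def)

lemma deck_norm: "w \<in> deck \<Longrightarrow> norm (w $ j) = 1"
proof -
  assume "w \<in> deck"
  then have "norm (w $ j ^ m j) = 1" by (simp only: deck_root norm_one)
  then have "norm (w $ j) ^ m j = 1" by (simp only: norm_power)
  moreover have "norm (w $ j) ^ m j < 1" if "norm (w $ j) < 1"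
    using that m_pos[of j] by (simp add: power_less_one_iff)
  moreover have "1 < norm (w $ j) ^ m j" if "1 < norm (w $ j)"
    using that m_pos[of j] by (rule one_less_power)
  ultimately show ?thesis by (cases "norm (w $ j)" "1::real" rule: linorder_cases) simp_all
qed

lemma deck_regular: "w \<in> deck \<Longrightarrow> w \<in> regular" by (simp add: deck_def)

lemma finite_deck: "finite deck"
proof (rule finite_subset)
  show "deck \<subseteq> (\<lambda>f. \<chi> j. f j) ` (PiE UNIV (\<lambda>j. {x. x ^ m j = 1}))"
  proof
    fix w assume "w \<in> deck"
    then have "(\<lambda>j. w $ j) \<in> PiE UNIV (\<lambda>j. {x. x ^ m j = 1})" by (auto simp: deck_root)
    then show "w \<in> (\<lambda>f. \<chi> j. f j) ` (PiE UNIV (\<lambda>j. {x. x ^ m j = 1}))"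
      by (rule rev_image_eqI) (simp add: vec_eq_iff)
  qed
  show "finite ((\<lambda>f. \<chi> j. f j) ` (PiE UNIV (\<lambda>j. {x::complex. x ^ m j = 1})))"
    using m_pos by (intro finite_imageI finite_PiE finite_roots_unity) (auto simp: Suc_le_eq)
qed

lemma one_in_deck: "1 \<in> deck" by (simp add: deck_def regular_def)

lemma card_deck_pos: "card deck > 0"
  using finite_deck one_in_deck by (auto simp: card_gt_0_iff)

lemma deck_mult: "w \<in> deck \<Longrightarrow> w' \<in> deck \<Longrightarrow> w * w' \<in> deck"
  by (simp add: deck_def mult_regular Phi_mult)

lemma deck_inverse: "w \<in> deck \<Longrightarrow> vec_inverse w \<in> deck"
  by (simp add: deck_def vec_inverse_regular Phi_vec_inverse) (simp add: vec_inverse_def vec_eq_iff)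

lemma deck_bij: "w \<in> deck \<Longrightarrow> bij_betw ((*) w) deck deck"
  by (rule bij_betwI[where g = "(*) (vec_inverse w)"])
     (auto simp: deck_mult deck_inverse mult.assoc[symmetric] vec_inverse_mult deck_regular)

lemma Phi_deck: "w \<in> deck \<Longrightarrow> Phi (w * z) = Phi z"
  by (simp add: Phi_mult deck_def)

lemma Phi_eqD:
  assumes "z \<in> regular" "z' \<in> regular" "Phi z = Phi z'"
  obtains w where "w \<in> deck" "z = w * z'"
proof
  have "Phi (z * vec_inverse z') = 1"
    using assms by (simp add: Phi_mult Phi_vec_inverse vec_inverse_mult Phi_regular)
  then show "z * vec_inverse z' \<in> deck" using assms by (simp add: deck_def mult_regular vec_inverse_regular)
  show "z = z * vec_inverse z' * z'" using assms by (simp add: mult.assoc vec_inverse_mult)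
qed

lemma norm_jac_deck: "w \<in> deck \<Longrightarrow> norm (jac w) = 1"
  by (simp add: jac_def prod_norm[symmetric] norm_power deck_norm)

lemma deck_polydisc: "w \<in> deck \<Longrightarrow> w * z \<in> unit_polydisc \<longleftrightarrow> z \<in> unit_polydisc"
  by (simp add: unit_polydisc_def norm_mult deck_norm)

lemma Phi_in_set:
  assumes "z \<in> regular" shows "Phi z \<in> monomial_set B \<longleftrightarrow> z \<in> unit_polydisc"
proof -
  have "Phi z $ k \<noteq> 0" for k using Phi_regular[OF assms] by (simp add: regular_def)
  moreover have "norm (z $ j) ^ m j < 1 \<longleftrightarrow> norm (z $ j) < 1" for j
    using m_pos[of j] by (simp add: power_less_one_iff)
  ultimately show ?thesis using Phi_powi(1)[OF assms] by (simp add: monomial_set_def unit_polydisc_def)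
qed

end

section \<open>The Bergman kernel of a monomial polyhedron\<close>

lemma polydisc_kernel_rotate:
  assumes "\<And>j. norm (w $ j) = 1"
  shows "polydisc_kernel (w * x) (w * y) = polydisc_kernel x y"
proof -
  have "w $ j * cnj (w $ j) = 1" for j
    using complex_norm_square[of "w $ j"] assms[of j] by simp
  then have "(w * x) $ j * cnj ((w * y) $ j) = x $ j * cnj (y $ j)" for j
    by (simp add: algebra_simps)
  then show ?thesis unfolding polydisc_kernel_def by (simp only:)
qed

lemma holomorphic_sv_cnj_polydisc_kernel:
  fixes a :: "complex ^ 'n::finite"
  assumes "a \<in> unit_polydisc"
  shows "holomorphic_sv unit_polydisc (\<lambda>w. cnj (polydisc_kernel a w))"
proof -
  have "holomorphic_sv unit_polydisc (\<lambda>w::complex^'n. \<Prod>j\<in>UNIV. 1 / (of_real pi * (1 - cnj (a $ j) * w $ j)\<^sup>2))"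
  proof (intro holomorphic_sv_prod holomorphic_sv_divide holomorphic_sv_const holomorphic_sv_mult
      holomorphic_sv_power holomorphic_sv_diff holomorphic_sv_nth)
    fix j and z :: "complex ^ 'n" assume "z \<in> unit_polydisc"
    then have "1 - a $ j * cnj (z $ j) \<noteq> 0"
      using assms by (intro disc_kernel_denominator_nz) (auto simp: unit_polydisc_def less_imp_le)
    then have "cnj (1 - a $ j * cnj (z $ j)) \<noteq> 0" by (simp only: complex_cnj_zero_iff not_False_eq_True)
    then show "complex_of_real pi * (1 - cnj (a $ j) * z $ j)\<^sup>2 \<noteq> 0" by simp
  qed
  then show ?thesis by (simp add: polydisc_kernel_def)
qed

context monomial_cover
begin

text \<open>A kernel of the polydisc averaged so that it is equivariant under the deck group in the same way as \<open>jac\<close>.\<close>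

definition deck_kernel :: "complex ^ 'n \<Rightarrow> complex ^ 'n \<Rightarrow> complex" where
  "deck_kernel x y = (\<Sum>w\<in>deck. cnj (jac w) * polydisc_kernel (w * x) y)"

text \<open>The pull-back of the Bergman kernel of the monomial polyhedron to the polydisc.\<close>

definition lifted_kernel :: "complex ^ 'n \<Rightarrow> complex ^ 'n \<Rightarrow> complex" where
  "lifted_kernel x y = of_real (cover_const / card deck) * deck_kernel x y / (jac x * cnj (jac y))"

lemma deck_kernel_measurable [measurable]: "deck_kernel x \<in> borel_measurable borel"
  unfolding deck_kernel_def by measurable

lemma lifted_kernel_measurable [measurable]: "lifted_kernel x \<in> borel_measurable borel"
  unfolding lifted_kernel_def by measurable

lemma deck_kernel_equivariant:
  assumes w: "w \<in> deck"
  shows "deck_kernel x (w * y) = cnj (jac w) * deck_kernel x y"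
proof -
  have "deck_kernel x (w * y) = (\<Sum>u\<in>deck. cnj (jac (w * u)) * polydisc_kernel ((w * u) * x) (w * y))"
    unfolding deck_kernel_def by (rule sum.reindex_bij_betw[OF deck_bij[OF w], symmetric])
  also have "\<dots> = (\<Sum>u\<in>deck. cnj (jac w) * (cnj (jac u) * polydisc_kernel (u * x) y))"
    using polydisc_kernel_rotate[of w] deck_norm[OF w] by (simp add: jac_mult mult.assoc)
  finally show ?thesis by (simp add: deck_kernel_def sum_distrib_left)
qed

lemma lifted_kernel_invariant:
  assumes w: "w \<in> deck"
  shows "lifted_kernel x (w * y) = lifted_kernel x y"
proof -
  have "jac w \<noteq> 0" using jac_nz deck_regular[OF w] by blast
  then show ?thesis by (simp add: lifted_kernel_def deck_kernel_equivariant[OF w] jac_mult)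
qed

lemma lifted_kernel_Phi_cong:
  "y \<in> regular \<Longrightarrow> y' \<in> regular \<Longrightarrow> Phi y = Phi y' \<Longrightarrow> lifted_kernel x y = lifted_kernel x y'"
  by (metis Phi_eqD lifted_kernel_invariant)

lemma deck_kernel_bound:
  assumes x: "x \<in> unit_polydisc"
  obtains C where "C \<ge> 0" "\<And>y. y \<in> unit_polydisc \<Longrightarrow> norm (deck_kernel x y) \<le> C"
proof
  let ?C = "\<Sum>w\<in>deck. (\<Prod>j\<in>UNIV. 1 / (pi * (1 - norm ((w * x) $ j))\<^sup>2))"
  show "?C \<ge> 0" by (intro sum_nonneg prod_nonneg) auto
  show "norm (deck_kernel x y) \<le> ?C" if y: "y \<in> unit_polydisc" for y
    unfolding deck_kernel_def
  proof (rule sum_norm_le)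
    fix w assume w: "w \<in> deck"
    have "norm (polydisc_kernel (w * x) y) \<le> (\<Prod>j\<in>UNIV. 1 / (pi * (1 - norm ((w * x) $ j))\<^sup>2))"
      by (rule polydisc_kernel_bound) (use w x y deck_polydisc in auto)
    then show "norm (cnj (jac w) * polydisc_kernel (w * x) y) \<le> (\<Prod>j\<in>UNIV. 1 / (pi * (1 - norm ((w * x) $ j))\<^sup>2))"
      using norm_jac_deck[OF w] by (simp add: norm_mult)
  qed
qed

lemma holomorphic_sv_jac: "holomorphic_sv S jac"
  unfolding jac_def[abs_def] by (intro holomorphic_sv_prod holomorphic_sv_power holomorphic_sv_nth)

lemma holomorphic_sv_Phi_nth: "holomorphic_sv S (\<lambda>z. Phi z $ k)"
  unfolding Phi_def by (simp, intro holomorphic_sv_prod holomorphic_sv_power holomorphic_sv_nth)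

lemma holomorphic_lifted_kernel:
  assumes x: "x \<in> unit_polydisc"
  shows "holomorphic_sv (unit_polydisc \<inter> regular) (\<lambda>y. cnj (lifted_kernel x y))"
proof -
  have "holomorphic_sv (unit_polydisc \<inter> regular)
     (\<lambda>y. of_real (cover_const / card deck) * (\<Sum>w\<in>deck. jac w * cnj (polydisc_kernel (w * x) y)) / (cnj (jac x) * jac y))"
  proof (cases "jac x = 0")
    case True
    then show ?thesis by (simp add: holomorphic_sv_const)
  next
    case False
    then show ?thesis
      by (intro holomorphic_sv_divide holomorphic_sv_mult holomorphic_sv_const holomorphic_sv_sum holomorphic_sv_jac
          holomorphic_sv_subset[OF holomorphic_sv_cnj_polydisc_kernel]) (use x deck_polydisc jac_nz in auto)
  qed
  then show ?thesis by (simp add: lifted_kernel_def deck_kernel_def)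
qed

lemma psi_in_polydisc: "x \<in> regular \<Longrightarrow> psi x \<in> unit_polydisc \<longleftrightarrow> x \<in> monomial_set B"
  using Phi_in_set[OF psi_regular, of x] by (simp add: Phi_psi)

text \<open>Although \<open>psi\<close> is discontinuous, it may be replaced near any point by a holomorphic local inverse of \<open>Phi\<close>, because the lifted
kernel is invariant under the deck group.\<close>

lemma holomorphic_descended_kernel:
  assumes x: "x \<in> unit_polydisc"
  shows "holomorphic_sv (monomial_set B \<inter> regular) (\<lambda>w. cnj (lifted_kernel x (psi w)))"
  unfolding holomorphic_sv_def
proof
  fix w0 assume w0: "w0 \<in> monomial_set B \<inter> regular"
  \<comment> \<open>A local inverse of \<open>Phi\<close> through \<open>psi w0\<close>; the logarithm is taken near 1.\<close>
  define \<phi> where "\<phi> w = (\<chi> j. psi w0 $ j * exp (\<Sum>l\<in>UNIV. of_real (inverse_exponent j l) * Ln (w $ l / w0 $ l)))" for w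
  define N where "N = {w :: complex ^ 'n. \<forall>l. w $ l / w0 $ l \<notin> \<real>\<^sub>\<le>\<^sub>0}"
  have nz: "w0 $ l \<noteq> 0" for l using w0 by (simp add: regular_def)
  have opN: "open N"
  proof -
    have "open ((\<lambda>w::complex ^ 'n. w $ l / w0 $ l) -` (- \<real>\<^sub>\<le>\<^sub>0))" for l
      by (intro open_vimage continuous_intros) (auto simp: nz open_Compl)
    then have "open (\<Inter>l. (\<lambda>w::complex ^ 'n. w $ l / w0 $ l) -` (- \<real>\<^sub>\<le>\<^sub>0))"
      by (intro open_INT) auto
    also have "(\<Inter>l. (\<lambda>w::complex ^ 'n. w $ l / w0 $ l) -` (- \<real>\<^sub>\<le>\<^sub>0)) = N" by (auto simp: N_def)
    finally show ?thesis .
  qed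
  have w0N: "w0 \<in> N" using nz by (simp add: N_def)
  have Nreg: "w \<in> regular" if "w \<in> N" for w
  proof -
    have "w $ l \<noteq> 0" for l
    proof
      assume "w $ l = 0"
      then have "w $ l / w0 $ l \<in> \<real>\<^sub>\<le>\<^sub>0" by simp
      then show False using that by (simp add: N_def)
    qed
    then show ?thesis by (simp add: regular_def)
  qed
  have phi_reg: "\<phi> w \<in> regular" for w
    using psi_regular[of w0] by (simp add: \<phi>_def regular_def)
  have Phi_phi: "Phi (\<phi> w) = w" if "w \<in> N" for w
  proof -
    have "w $ l / w0 $ l \<noteq> 0" for l using Nreg[OF that] nz by (simp add: regular_def)
    then have "Phi (\<phi> w) = (\<chi> k. w0 $ k * (w $ k / w0 $ k))"
      unfolding \<phi>_def Phi_exp using w0 by (simp add: Phi_psi exp_Ln)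
    then show ?thesis using nz by (simp add: vec_eq_iff)
  qed
  have hol_phi: "holomorphic_sv N (\<lambda>w. \<phi> w $ j)" for j
  proof -
    have "holomorphic_sv N (\<lambda>w. exp (\<Sum>l\<in>UNIV. of_real (inverse_exponent j l) * Ln (w $ l / w0 $ l)))"
    proof (rule holomorphic_sv_compose_1[of _ _ exp UNIV])
      have "holomorphic_sv N (\<lambda>w. Ln (w $ l / w0 $ l))" for l
      proof (rule holomorphic_sv_compose_1[of _ _ Ln "- \<real>\<^sub>\<le>\<^sub>0"])
        show "holomorphic_sv N (\<lambda>w. w $ l / w0 $ l)"
          by (intro holomorphic_sv_divide holomorphic_sv_nth holomorphic_sv_const) (use nz in auto)
        show "Ln holomorphic_on - \<real>\<^sub>\<le>\<^sub>0" by (intro holomorphic_intros) auto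
      qed (auto simp: N_def open_Compl)
      then show "holomorphic_sv N (\<lambda>w. \<Sum>l\<in>UNIV. of_real (inverse_exponent j l) * Ln (w $ l / w0 $ l))"
        by (intro holomorphic_sv_sum holomorphic_sv_mult holomorphic_sv_const)
    qed (auto intro!: holomorphic_intros)
    then show ?thesis unfolding \<phi>_def by (simp, intro holomorphic_sv_mult holomorphic_sv_const)
  qed
  define N' where "N' = N \<inter> (\<lambda>w. \<phi> w) -` (unit_polydisc \<inter> regular)"
  have cont_phi: "continuous_on N \<phi>"
  proof -
    have "continuous_on N (\<lambda>w. \<chi> j. \<phi> w $ j)"
      by (intro continuous_on_vec_lambda holomorphic_sv_continuous_on hol_phi)
    then show ?thesis by simp
  qed
  have opN': "open N'"
    unfolding N'_def Int_commute[of N]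
    by (rule continuous_on_open_vimage[OF opN, THEN iffD1, rule_format, OF cont_phi])
       (intro open_Int open_unit_polydisc open_regular)
  have "holomorphic_sv N' (\<lambda>w. cnj (lifted_kernel x (\<phi> w)))"
    by (rule holomorphic_sv_compose[OF holomorphic_lifted_kernel[OF x]])
       (auto simp: N'_def intro: holomorphic_sv_subset[OF hol_phi])
  note h1 = this
  have h2: "cnj (lifted_kernel x (\<phi> w)) = cnj (lifted_kernel x (psi w))" if "w \<in> N'" for w
  proof -
    have "w \<in> N" using that by (simp add: N'_def)
    then have "Phi (\<phi> w) = Phi (psi w)" using Phi_phi Phi_psi Nreg by simp
    then have "lifted_kernel x (\<phi> w) = lifted_kernel x (psi w)" using phi_reg psi_regular by (intro lifted_kernel_Phi_cong)
    then show ?thesis by simp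
  qed
  have "holomorphic_sv N' (\<lambda>w. cnj (lifted_kernel x (psi w)))"
    by (rule holomorphic_sv_cong[OF h1 opN' h2])
  moreover have "w0 \<in> N'"
  proof -
    have "\<phi> w0 = psi w0" using nz by (simp add: \<phi>_def vec_eq_iff)
    then show ?thesis using w0 w0N psi_in_polydisc psi_regular by (simp add: N'_def)
  qed
  ultimately show "\<exists>L. ((\<lambda>w. cnj (lifted_kernel x (psi w))) has_derivative L) (at w0) \<and> (\<forall>c v. L (c *s v) = c * L v)"
    unfolding holomorphic_sv_def by (rule bspec)
qed

lemma psi_measurable [measurable]: "psi \<in> borel \<rightarrow>\<^sub>M borel"
  unfolding psi_def by measurable

lemma lifted_kernel_psi_Phi: "z \<in> regular \<Longrightarrow> lifted_kernel x (psi (Phi z)) = lifted_kernel x z"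
  by (rule lifted_kernel_Phi_cong) (auto simp: psi_regular Phi_psi Phi_regular)

lemma monomial_set_measurable [measurable]: "monomial_set B \<in> sets borel"
proof -
  have [measurable]: "(\<lambda>x::real. x powi b) \<in> borel_measurable borel" for b :: int
    unfolding power_int_def by measurable
  show ?thesis unfolding monomial_set_def by measurable
qed

text \<open>The descended kernel is square integrable, since \<open>jac\<close> times the lifted kernel is bounded; the removability theorem
extends it to all points of the polyhedron.\<close>

lemma descended_kernel_bergman:
  assumes op: "open (monomial_set B)" and x: "x \<in> unit_polydisc \<inter> regular"
  obtains g where "g \<in> bergman_space (monomial_set B)"
    "\<And>w. w \<in> monomial_set B \<Longrightarrow> w \<in> regular \<Longrightarrow> g w = cnj (lifted_kernel x (psi w))"
proof -
  let ?U = "monomial_set B"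
  obtain C where C: "C \<ge> 0" "\<And>y. y \<in> unit_polydisc \<Longrightarrow> norm (deck_kernel x y) \<le> C"
    using deck_kernel_bound[of x] x by blast
  define D where "D = (cover_const / card deck * C / norm (jac x))\<^sup>2"
  let ?f = "\<lambda>w. cnj (lifted_kernel x (psi w))"
  let ?F = "\<lambda>w. ennreal ((norm (?f w))\<^sup>2) * indicator (?U \<inter> regular) w"
  have [measurable]: "?F \<in> borel_measurable borel" by measurable
  have "ennreal cover_const * (\<integral>\<^sup>+w. ?F w \<partial>lborel) = (\<integral>\<^sup>+z. ennreal ((norm (jac z))\<^sup>2) * ?F (Phi z) \<partial>lborel)"
    by (rule nn_integral_cover[symmetric]) measurable
  also have "\<dots> \<le> (\<integral>\<^sup>+z. ennreal D * indicator (unit_polydisc :: (complex ^ 'n) set) z \<partial>lborel)"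
  proof (rule nn_integral_mono_AE, use AE_regular in eventually_elim)
    case (elim z)
    show ?case
    proof (cases "z \<in> unit_polydisc")
      case True
      have "norm (jac z) * norm (lifted_kernel x z) = cover_const / card deck * norm (deck_kernel x z) / norm (jac x)"
        using jac_nz[OF elim] cover_const_pos by (simp add: lifted_kernel_def norm_mult norm_divide)
      also have "\<dots> \<le> cover_const / card deck * C / norm (jac x)"
        using C(2)[OF True] cover_const_pos by (intro divide_right_mono mult_left_mono) auto
      finally have "(norm (jac z) * norm (lifted_kernel x z))\<^sup>2 \<le> D"
        unfolding D_def by (intro power_mono) auto
      then have "ennreal ((norm (jac z))\<^sup>2) * ennreal ((norm (lifted_kernel x z))\<^sup>2) \<le> ennreal D"
        by (simp add: ennreal_mult[symmetric] power_mult_distrib ennreal_leI)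
      then show ?thesis
        using True elim by (simp add: lifted_kernel_psi_Phi Phi_in_set Phi_regular)
    qed (simp add: Phi_in_set[OF elim])
  qed
  also have "\<dots> = ennreal D * emeasure lborel (unit_polydisc :: (complex ^ 'n) set)"
    by (rule nn_integral_cmult_indicator) simp
  also have "\<dots> < \<infinity>" using emeasure_unit_polydisc[where 'n = 'n] by (simp add: ennreal_mult_less_top)
  finally have "(\<integral>\<^sup>+w. ?F w \<partial>lborel) < \<infinity>"
    using cover_const_pos by (auto simp: ennreal_mult_less_top)
  then show thesis
    using bergman_removable[OF op holomorphic_descended_kernel] x that by blast
qed

text \<open>Pulling back along \<open>Phi\<close> with the factor \<open>jac\<close> preserves square integrability. The map may leave the polyhedron at nonregular
points of the polydisc, whence the removability theorem.\<close>

lemma pullback_bergman: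
  assumes op: "open (monomial_set B)" and f: "f \<in> bergman_space (monomial_set B)"
  obtains g where "g \<in> bergman_space unit_polydisc"
    "\<And>z. z \<in> unit_polydisc \<Longrightarrow> z \<in> regular \<Longrightarrow> g z = f (Phi z) * jac z"
proof -
  let ?U = "monomial_set B"
  have hol: "holomorphic_sv (unit_polydisc \<inter> regular) (\<lambda>z. f (Phi z) * jac z)"
    by (intro holomorphic_sv_mult holomorphic_sv_jac holomorphic_sv_compose[OF bergman_spaceD(1)[OF f]] holomorphic_sv_Phi_nth)
       (auto simp: Phi_in_set)
  let ?F = "\<lambda>w. ennreal ((norm (f w))\<^sup>2) * indicator ?U w"
  have [measurable]: "?F \<in> borel_measurable borel"
    by (rule holomorphic_sv_borel_nn[OF bergman_spaceD(1)[OF f] op])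
  have "(\<integral>\<^sup>+z. ennreal ((norm (f (Phi z) * jac z))\<^sup>2) * indicator (unit_polydisc \<inter> regular) z \<partial>lborel)
      = (\<integral>\<^sup>+z. ennreal ((norm (jac z))\<^sup>2) * ?F (Phi z) \<partial>lborel)"
  proof (rule nn_integral_cong_AE, use AE_regular in eventually_elim)
    case (elim z)
    then show ?case
      by (cases "z \<in> unit_polydisc") (simp_all add: Phi_in_set norm_mult power_mult_distrib ennreal_mult mult.commute)
  qed
  also have "\<dots> = ennreal cover_const * (\<integral>\<^sup>+w. ?F w \<partial>lborel)" by (rule nn_integral_cover) measurable
  also have "\<dots> < \<infinity>" using f bergman_space_iff[OF op, of f] by (simp add: ennreal_mult_less_top)
  finally show thesis using bergman_removable[OF open_unit_polydisc hol] that by blast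
qed

text \<open>All points of the orbit of \<open>x\<close> are reproduced, and the pulled back function takes the same values there up to the factor
\<open>jac w\<close>, which the weights of \<open>deck_kernel\<close> cancel.\<close>

lemma pullback_reproducing:
  assumes op: "open (monomial_set B)" and f: "f \<in> bergman_space (monomial_set B)"
    and x: "x \<in> unit_polydisc" "x \<in> regular"
  shows "(LINT y|lborel. indicator unit_polydisc y *\<^sub>R ((indicator (monomial_set B) (Phi y) *\<^sub>R f (Phi y)) * jac y * deck_kernel x y)) = of_nat (card deck) * (f (Phi x) * jac x)"
proof -
  obtain g where g: "g \<in> bergman_space unit_polydisc"
    "\<And>z. z \<in> unit_polydisc \<Longrightarrow> z \<in> regular \<Longrightarrow> g z = f (Phi z) * jac z"
    using pullback_bergman[OF op f] by blast
  have [measurable]: "(\<lambda>w. indicator unit_polydisc w *\<^sub>R g w) \<in> borel_measurable borel"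
    by (rule holomorphic_sv_borel[OF bergman_spaceD(1)[OF g(1)] open_unit_polydisc])
  have [measurable]: "(\<lambda>w. indicator (monomial_set B) w *\<^sub>R f w) \<in> borel_measurable borel"
    by (rule holomorphic_sv_borel[OF bergman_spaceD(1)[OF f] op])
  have wx: "w * x \<in> unit_polydisc" "w * x \<in> regular" if "w \<in> deck" for w
    using x(1) deck_polydisc[OF that] mult_regular[OF deck_regular[OF that] x(2)] by auto
  let ?T = "\<lambda>w y. cnj (jac w) * (indicator unit_polydisc y *\<^sub>R (g y * polydisc_kernel (w * x) y))"
  have "(LINT y|lborel. indicator unit_polydisc y *\<^sub>R ((indicator (monomial_set B) (Phi y) *\<^sub>R f (Phi y)) * jac y * deck_kernel x y))
      = (LINT y|lborel. (\<Sum>w\<in>deck. ?T w y))"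
  proof (rule integral_cong_AE)
    show "(\<lambda>y. indicator unit_polydisc y *\<^sub>R ((indicator (monomial_set B) (Phi y) *\<^sub>R f (Phi y)) * jac y * deck_kernel x y)) \<in> borel_measurable lborel"
    proof -
      note [measurable] = measurable_compose[OF Phi_measurable \<open>(\<lambda>w. indicator (monomial_set B) w *\<^sub>R f w) \<in> borel_measurable borel\<close>]
      show ?thesis by measurable
    qed
    show "(\<lambda>y. \<Sum>w\<in>deck. ?T w y) \<in> borel_measurable lborel"
    proof -
      have eq: "(\<lambda>y. \<Sum>w\<in>deck. ?T w y) = (\<lambda>y. \<Sum>w\<in>deck. cnj (jac w) * ((indicator unit_polydisc y *\<^sub>R g y) * polydisc_kernel (w * x) y))"
        by simp
      show ?thesis unfolding measurable_lborel1 eq by measurable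
    qed
    show "AE y in lborel. indicator unit_polydisc y *\<^sub>R ((indicator (monomial_set B) (Phi y) *\<^sub>R f (Phi y)) * jac y * deck_kernel x y) = (\<Sum>w\<in>deck. ?T w y)"
      using AE_regular
    proof eventually_elim
      case (elim y)
      show ?case
      proof (cases "y \<in> unit_polydisc")
        case True
        then show ?thesis using g(2)[OF True elim] Phi_in_set[OF elim]
          by (simp add: deck_kernel_def sum_distrib_left mult_ac)
      qed simp
    qed
  qed
  also have "\<dots> = (\<Sum>w\<in>deck. (LINT y|lborel. ?T w y))"
    by (intro Bochner_Integration.integral_sum integrable_mult_right bergman_unit_polydisc_kernel_integrable g(1) wx)
  also have "\<dots> = (\<Sum>w\<in>deck. cnj (jac w) * g (w * x))"
    by (rule sum.cong[OF refl]) (simp only: integral_mult_right_zero polydisc_reproducing[OF g(1) wx(1)])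
  also have "\<dots> = (\<Sum>w\<in>deck. f (Phi x) * jac x)"
  proof (rule sum.cong[OF refl])
    fix w assume w: "w \<in> deck"
    have "cnj (jac w) * jac w = 1"
      using complex_norm_square[of "jac w"] norm_jac_deck[OF w] by (simp add: mult.commute)
    then have "cnj (jac w) * (jac w * y) = y" for y by (simp add: mult.assoc[symmetric])
    then show "cnj (jac w) * g (w * x) = f (Phi x) * jac x"
      using g(2)[OF wx[OF w]] by (simp add: Phi_deck[OF w] jac_mult mult.left_commute)
  qed
  finally show ?thesis by simp
qed

lemma lifted_kernel_reproducing:
  assumes op: "open (monomial_set B)" and f: "f \<in> bergman_space (monomial_set B)"
    and x: "x \<in> unit_polydisc" "x \<in> regular"
  shows "(LINT w|lborel. indicator (monomial_set B) w *\<^sub>R (f w * lifted_kernel x (psi w))) = f (Phi x)"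
proof -
  let ?U = "monomial_set B"
  let ?g = "\<lambda>w. indicator ?U w *\<^sub>R (f w * lifted_kernel x (psi w))"
  let ?c = "of_real (cover_const / card deck) / jac x"
  have [measurable]: "(\<lambda>w. indicator ?U w *\<^sub>R f w) \<in> borel_measurable borel"
    by (rule holomorphic_sv_borel[OF bergman_spaceD(1)[OF f] op])
  have "(\<lambda>w. (indicator ?U w *\<^sub>R f w) * lifted_kernel x (psi w)) \<in> borel_measurable borel" by measurable
  then have gm[measurable]: "?g \<in> borel_measurable borel" by simp
  have "cover_const *\<^sub>R (LINT w|lborel. ?g w) = (LINT z|lborel. (norm (jac z))\<^sup>2 *\<^sub>R ?g (Phi z))"
    by (rule integral_cover[OF gm, symmetric])
  also have "\<dots> = (LINT z|lborel. ?c * (indicator unit_polydisc z *\<^sub>R ((indicator (monomial_set B) (Phi z) *\<^sub>R f (Phi z)) * jac z * deck_kernel x z)))"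
  proof (rule integral_cong_AE)
    show "(\<lambda>z. (norm (jac z))\<^sup>2 *\<^sub>R ?g (Phi z)) \<in> borel_measurable lborel"
    proof -
      have "(\<lambda>z. (norm (jac z))\<^sup>2 *\<^sub>R G (Phi z)) \<in> borel_measurable borel"
        if [measurable]: "G \<in> borel_measurable borel" for G :: "complex ^ 'n \<Rightarrow> complex"
        by measurable
      from this[OF gm] show ?thesis unfolding measurable_lborel1 measurable_lborel2 .
    qed
    show "(\<lambda>z. ?c * (indicator unit_polydisc z *\<^sub>R ((indicator (monomial_set B) (Phi z) *\<^sub>R f (Phi z)) * jac z * deck_kernel x z))) \<in> borel_measurable lborel"
    proof -
      note [measurable] = measurable_compose[OF Phi_measurable \<open>(\<lambda>w. indicator ?U w *\<^sub>R f w) \<in> borel_measurable borel\<close>]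
      show ?thesis by measurable
    qed
    show "AE z in lborel. (norm (jac z))\<^sup>2 *\<^sub>R ?g (Phi z) = ?c * (indicator unit_polydisc z *\<^sub>R ((indicator (monomial_set B) (Phi z) *\<^sub>R f (Phi z)) * jac z * deck_kernel x z))"
      using AE_regular
    proof eventually_elim
      case (elim z)
      show ?case
      proof (cases "z \<in> unit_polydisc")
        case True
        have "(norm (jac z))\<^sup>2 *\<^sub>R lifted_kernel x z = (jac z * cnj (jac z)) * lifted_kernel x z"
          unfolding scaleR_conv_of_real complex_norm_square ..
        also have "\<dots> = ?c * (jac z * deck_kernel x z)"
          using jac_nz[OF elim] by (simp add: lifted_kernel_def)
        finally have "(norm (jac z))\<^sup>2 *\<^sub>R lifted_kernel x z = ?c * (jac z * deck_kernel x z)" .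
        then have "f (Phi z) * ((norm (jac z))\<^sup>2 *\<^sub>R lifted_kernel x z) = f (Phi z) * (?c * (jac z * deck_kernel x z))"
          by (simp only:)
        then show ?thesis using True elim
          by (simp add: Phi_in_set lifted_kernel_psi_Phi mult_ac)
      qed (simp add: Phi_in_set[OF elim])
    qed
  qed
  also have "\<dots> = ?c * (of_nat (card deck) * (f (Phi x) * jac x))"
    by (simp only: integral_mult_right_zero pullback_reproducing[OF op f x])
  also have "\<dots> = cover_const *\<^sub>R f (Phi x)"
    using jac_nz[OF x(2)] card_deck_pos by (simp add: scaleR_conv_of_real)
  finally show ?thesis using cover_const_pos by (simp add: scaleR_cancel_left)
qed

text \<open>Reproduce the Bergman kernel \<open>K(., v)\<close> at \<open>z\<close> with the lifted kernel and, conversely, reproduce the conjugate of the lifted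
kernel at \<open>v\<close> with \<open>K\<close>: both are the same integral.\<close>

theorem bergman_kernel_formula:
  assumes op: "open (monomial_set B)"
    and z: "z \<in> monomial_set B" "z \<in> regular" and v: "v \<in> monomial_set B" "v \<in> regular"
  shows "bergman_kernel (monomial_set B) z v = lifted_kernel (psi z) (psi v)"
proof -
  let ?U = "monomial_set B"
  define K where "K = bergman_kernel ?U"
  have K: "is_bergman_kernel ?U K" unfolding K_def by (rule bergman_kernel_is_kernel[OF op])
  have KA: "(\<lambda>w. K w v) \<in> bergman_space ?U" using K v unfolding is_bergman_kernel_def by simp
  have rep: "g v = (LINT w|lebesgue_on ?U. g w * cnj (K w v))" if "g \<in> bergman_space ?U" for g
    using K v that unfolding is_bergman_kernel_def by simp
  have x: "psi z \<in> unit_polydisc" "psi z \<in> regular" using z psi_in_polydisc psi_regular by auto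
  obtain g where g: "g \<in> bergman_space ?U"
    "\<And>w. w \<in> ?U \<Longrightarrow> w \<in> regular \<Longrightarrow> g w = cnj (lifted_kernel (psi z) (psi w))"
    using descended_kernel_bergman[OF op, of "psi z"] x by blast
  have m1: "(\<lambda>w. indicator ?U w *\<^sub>R K w v) \<in> borel_measurable borel"
    by (rule holomorphic_sv_borel[OF bergman_spaceD(1)[OF KA] op])
  have m2: "(\<lambda>w. indicator ?U w *\<^sub>R g w) \<in> borel_measurable borel"
    by (rule holomorphic_sv_borel[OF bergman_spaceD(1)[OF g(1)] op])
  have m3: "(\<lambda>w. indicator ?U w *\<^sub>R (g w * cnj (K w v))) \<in> borel_measurable borel"
  proof -
    note [measurable] = m1 m2
    have "(\<lambda>w. indicator ?U w *\<^sub>R (g w * cnj (K w v))) = (\<lambda>w. (indicator ?U w *\<^sub>R g w) * cnj (indicator ?U w *\<^sub>R K w v))"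
      by (auto simp: fun_eq_iff indicator_def)
    also have "\<dots> \<in> borel_measurable borel" by measurable
    finally show ?thesis .
  qed
  have "K z v = (LINT w|lborel. indicator ?U w *\<^sub>R (K w v * lifted_kernel (psi z) (psi w)))"
    using lifted_kernel_reproducing[OF op KA x] z by (simp add: Phi_psi)
  also have "\<dots> = (LINT w|lborel. cnj (indicator ?U w *\<^sub>R (g w * cnj (K w v))))"
  proof (rule integral_cong_AE)
    show "(\<lambda>w. indicator ?U w *\<^sub>R (K w v * lifted_kernel (psi z) (psi w))) \<in> borel_measurable lborel"
    proof -
      note [measurable] = m1
      have "(\<lambda>w. (indicator ?U w *\<^sub>R K w v) * lifted_kernel (psi z) (psi w)) \<in> borel_measurable borel" by measurable
      then show ?thesis by simp
    qed
    show "(\<lambda>w. cnj (indicator ?U w *\<^sub>R (g w * cnj (K w v)))) \<in> borel_measurable lborel"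
      using measurable_compose[OF m3 cnj_measurable] by simp
    show "AE w in lborel. indicator ?U w *\<^sub>R (K w v * lifted_kernel (psi z) (psi w)) = cnj (indicator ?U w *\<^sub>R (g w * cnj (K w v)))"
      using AE_regular by eventually_elim (auto simp: indicator_def g(2))
  qed
  also have "\<dots> = cnj (LINT w|lborel. indicator ?U w *\<^sub>R (g w * cnj (K w v)))"
    by (rule Bochner_Integration.integral_cnj)
  also have "(LINT w|lborel. indicator ?U w *\<^sub>R (g w * cnj (K w v))) = (LINT w|lebesgue_on ?U. g w * cnj (K w v))"
    by (rule lebesgue_on_eq_lborel(2)[OF monomial_set_measurable m3, symmetric])
  also have "\<dots> = g v" by (rule rep[OF g(1), symmetric])
  also have "cnj (g v) = lifted_kernel (psi z) (psi v)" using g(2)[OF v] by simp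
  finally show ?thesis by (simp add: K_def)
qed

end

section \<open>Weighted estimates for the positive kernel of the polydisc\<close>

text \<open>Young's inequality replaces Hoelder's. With \<open>A(x) = \<integral> k(x, y) (u(y) / h(y))\<^sup>p dy\<close>, writing
\<open>u = h(x) s ((u / h) / s) (h / h(x))\<close> and applying Young to the last two factors bounds \<open>\<integral> k u\<close> by a constant times \<open>h(x) s\<close> whenever
\<open>A(x) \<le> s\<^sup>p\<close>. So \<open>(\<integral> k u)\<^sup>p\<close> is bounded by \<open>h(x)\<^sup>p A(x)\<close> up to a constant, and integrating this against \<open>w\<close> uses the second
hypothesis.\<close>

lemma schur_test:
  fixes k :: "'a \<Rightarrow> 'a \<Rightarrow> real" and h w u :: "'a \<Rightarrow> real"
  assumes "sigma_finite_measure M"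
    and k[measurable]: "(\<lambda>(x, y). k x y) \<in> borel_measurable (M \<Otimes>\<^sub>M M)" and k0: "\<And>x y. k x y \<ge> 0"
    and [measurable]: "h \<in> borel_measurable M" "w \<in> borel_measurable M" "u \<in> borel_measurable M"
    and pos: "AE x in M. h x > 0 \<and> w x > 0" and u0: "\<And>x. u x \<ge> 0"
    and p: "p > 1" and q: "q = p / (p - 1)" and C: "C1 > 0" "C2 > 0"
    and S1: "AE x in M. (\<integral>\<^sup>+y. ennreal (k x y * h y powr q) \<partial>M) \<le> ennreal (C1 * h x powr q)"
    and S2: "AE y in M. (\<integral>\<^sup>+x. ennreal (k x y * (h x powr p * w x)) \<partial>M) \<le> ennreal (C2 * (h y powr p * w y))"
    and fin: "(\<integral>\<^sup>+y. ennreal (u y powr p * w y) \<partial>M) < \<infinity>"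
  shows "AE x in M. (\<integral>\<^sup>+y. ennreal (k x y * u y) \<partial>M) < \<infinity>"
    and "(\<integral>\<^sup>+x. ennreal (enn2real (\<integral>\<^sup>+y. ennreal (k x y * u y) \<partial>M) powr p * w x) \<partial>M)
       \<le> ennreal ((1 / p + C1 / q) powr p * C2) * (\<integral>\<^sup>+y. ennreal (u y powr p * w y) \<partial>M)"
proof -
  interpret sigma_finite_measure M by fact
  interpret pair_sigma_finite M M ..
  have k'[measurable]: "(\<lambda>x. k (f x) (g x)) \<in> borel_measurable N" if "f \<in> N \<rightarrow>\<^sub>M M" "g \<in> N \<rightarrow>\<^sub>M M" for f g and N :: "'c measure"
    using measurable_compose[OF measurable_Pair[OF that] k] by simp
  have q1: "q > 1" "1 / p + 1 / q = 1" using p by (auto simp: q field_simps)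
  define A where "A x = (\<integral>\<^sup>+y. ennreal (k x y * (u y / h y) powr p) \<partial>M)" for x
  define T where "T x = (\<integral>\<^sup>+y. ennreal (k x y * u y) \<partial>M)" for x
  have [measurable]: "A \<in> borel_measurable M" unfolding A_def by measurable
  have [measurable]: "T \<in> borel_measurable M" unfolding T_def by measurable
  have pd: "(a / b) powr r = b powr (- r) * a powr r" if "a \<ge> 0" "b > 0" for a b r :: real
    using that by (simp add: powr_divide powr_minus_divide)
  have em: "ennreal (a * x + b * y) = ennreal a * ennreal x + ennreal b * ennreal y"
    if "a \<ge> 0" "b \<ge> 0" "x \<ge> 0" "y \<ge> 0" for a b x y :: real
    using that by (simp add: ennreal_plus ennreal_mult)
  define C where "C = 1 / p + C1 / q"
  have C0: "C > 0" using p q1 C by (auto simp: C_def intro: add_pos_pos)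
  have pt: "T x < \<infinity> \<and> enn2real (T x) powr p \<le> C powr p * h x powr p * enn2real (A x)"
    if hx: "h x > 0" and Sx: "(\<integral>\<^sup>+y. ennreal (k x y * h y powr q) \<partial>M) \<le> ennreal (C1 * h x powr q)" and Ax: "A x < \<infinity>"
    and xs: "x \<in> space M" for x
  proof -
    have kx[measurable]: "(\<lambda>y. k x y) \<in> borel_measurable M" using xs by measurable
    have step: "T x \<le> ennreal (C * h x * s)" if s: "s > 0" "A x \<le> ennreal (s powr p)" for s
    proof -
      let ?b = "h x"
      have "T x \<le> (\<integral>\<^sup>+y. ennreal (?b * s * (s powr (- p) / p)) * ennreal (k x y * (u y / h y) powr p)
            + ennreal (?b * s * (?b powr (- q) / q)) * ennreal (k x y * h y powr q) \<partial>M)"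
        unfolding T_def
      proof (rule nn_integral_mono_AE, use pos in eventually_elim)
        case (elim y)
        have hy: "h y > 0" using elim by simp
        have "((u y / h y) / s) * (h y / ?b) \<le> ((u y / h y) / s) powr p / p + (h y / ?b) powr q / q"
          by (rule Youngs_inequality) (use p q1 hy hx s u0[of y] in auto)
        also have "\<dots> = s powr (- p) / p * (u y / h y) powr p + ?b powr (- q) / q * h y powr q"
        proof -
          have "((u y / h y) / s) powr p = s powr (- p) * (u y / h y) powr p"
            using hy s u0[of y] by (intro pd divide_nonneg_pos) auto
          moreover have "(h y / ?b) powr q = ?b powr (- q) * h y powr q" using hy hx by (intro pd) auto
          ultimately show ?thesis by simp
        qed
        finally have "(k x y * (?b * s)) * (((u y / h y) / s) * (h y / ?b))
           \<le> (k x y * (?b * s)) * (s powr (- p) / p * (u y / h y) powr p + ?b powr (- q) / q * h y powr q)"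
          using k0[of x y] hx s by (intro mult_left_mono) auto
        moreover have "(k x y * (?b * s)) * (((u y / h y) / s) * (h y / ?b)) = k x y * u y"
          using hy hx s by simp
        ultimately have "k x y * u y \<le> (?b * s * (s powr (- p) / p)) * (k x y * (u y / h y) powr p)
            + (?b * s * (?b powr (- q) / q)) * (k x y * h y powr q)"
          by (simp only: distrib_left mult_ac)
        then have "ennreal (k x y * u y) \<le> ennreal ((?b * s * (s powr (- p) / p)) * (k x y * (u y / h y) powr p)
            + (?b * s * (?b powr (- q) / q)) * (k x y * h y powr q))" by (rule ennreal_leI)
        also have "\<dots> = ennreal (?b * s * (s powr (- p) / p)) * ennreal (k x y * (u y / h y) powr p)
            + ennreal (?b * s * (?b powr (- q) / q)) * ennreal (k x y * h y powr q)"
          using hx s p q1 k0[of x y] by (intro em) auto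
        finally show ?case .
      qed
      also have "\<dots> = ennreal (?b * s * (s powr (- p) / p)) * A x
            + ennreal (?b * s * (?b powr (- q) / q)) * (\<integral>\<^sup>+y. ennreal (k x y * h y powr q) \<partial>M)"
        unfolding A_def by (subst nn_integral_add) (auto simp: nn_integral_cmult)
      also have "\<dots> \<le> ennreal (?b * s * (s powr (- p) / p)) * ennreal (s powr p)
            + ennreal (?b * s * (?b powr (- q) / q)) * ennreal (C1 * ?b powr q)"
        by (intro add_mono mult_left_mono s Sx) auto
      also have "\<dots> = ennreal ((?b * s * (s powr (- p) / p)) * s powr p + (?b * s * (?b powr (- q) / q)) * (C1 * ?b powr q))"
        using hx s p q1 C by (intro em[symmetric]) auto
      also have "(?b * s * (s powr (- p) / p)) * s powr p + (?b * s * (?b powr (- q) / q)) * (C1 * ?b powr q) = C * ?b * s"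
      proof -
        have one: "s powr (- p) * s powr p = 1" "?b powr (- q) * ?b powr q = 1"
          using hx s by (auto simp: powr_add[symmetric])
        have "(?b * s * (s powr (- p) / p)) * s powr p = ?b * s / p * (s powr (- p) * s powr p)"
           "(?b * s * (?b powr (- q) / q)) * (C1 * ?b powr q) = ?b * s * C1 / q * (?b powr (- q) * ?b powr q)"
          by (simp_all only: divide_inverse mult_ac)
        then have "(?b * s * (s powr (- p) / p)) * s powr p + (?b * s * (?b powr (- q) / q)) * (C1 * ?b powr q)
            = ?b * s / p + ?b * s * C1 / q"
          by (simp only: one mult_1_right)
        also have "\<dots> = C * ?b * s" by (simp add: C_def algebra_simps)
        finally show ?thesis .
      qed
      finally show ?thesis .
    qed
    \<comment> \<open>As \<open>A x\<close> may vanish, the step is applied with \<open>(a + e) powr (1 / p)\<close>, and \<open>e\<close> tends to 0 afterwards.\<close>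
    define a where "a = enn2real (A x)"
    have a: "A x = ennreal a" "a \<ge> 0" using Ax by (auto simp: a_def)
    have sp: "((a + e) powr (1 / p)) powr p = a + e" if "e > 0" for e
      using that a p by (simp add: powr_powr)
    have bd: "T x \<le> ennreal (C * h x * (a + e) powr (1 / p))" if "e > 0" for e
      using that a sp[OF that] by (intro step) (auto intro: ennreal_leI)
    have Tfin: "T x < \<infinity>" using bd[of 1] by (rule le_less_trans) simp_all
    have "enn2real (T x) powr p \<le> C powr p * h x powr p * (a + e)" if e: "e > 0" for e
    proof -
      have "enn2real (T x) \<le> C * h x * (a + e) powr (1 / p)"
        using bd[OF e] C0 hx by (intro enn2real_leI) auto
      then have "enn2real (T x) powr p \<le> (C * h x * (a + e) powr (1 / p)) powr p"
        using p by (intro powr_mono2) auto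
      also have "\<dots> = C powr p * h x powr p * (a + e)"
        using C0 hx sp[OF e] by (simp add: powr_mult)
      finally show ?thesis .
    qed
    note bound = this
    have lim: "enn2real (T x) powr p - C powr p * h x powr p * a \<le> C powr p * h x powr p * e" if "e > 0" for e
      using bound[OF that] by (simp add: algebra_simps)
    have "enn2real (T x) powr p \<le> C powr p * h x powr p * a"
    proof (rule ccontr)
      define d where "d = enn2real (T x) powr p - C powr p * h x powr p * a"
      define c where "c = C powr p * h x powr p"
      assume "\<not> ?thesis"
      then have d: "d > 0" by (simp add: d_def)
      have c: "c > 0" using C0 hx by (simp add: c_def)
      have "d \<le> c * (d / (2 * c))" using lim[of "d / (2 * c)"] d c by (simp add: d_def c_def)
      then show False using d c by simp
    qed
    then show ?thesis using Tfin by (simp add: a_def)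
  qed
  let ?N = "\<integral>\<^sup>+y. ennreal (u y powr p * w y) \<partial>M"
  have IA: "(\<integral>\<^sup>+x. A x * ennreal (h x powr p * w x) \<partial>M) \<le> ennreal C2 * ?N"
  proof -
    have "(\<integral>\<^sup>+x. A x * ennreal (h x powr p * w x) \<partial>M)
       = (\<integral>\<^sup>+x. (\<integral>\<^sup>+y. ennreal (k x y * (u y / h y) powr p) * ennreal (h x powr p * w x) \<partial>M) \<partial>M)"
      unfolding A_def by (intro nn_integral_cong nn_integral_multc[symmetric]) measurable
    also have "\<dots> = (\<integral>\<^sup>+y. (\<integral>\<^sup>+x. ennreal (k x y * (u y / h y) powr p) * ennreal (h x powr p * w x) \<partial>M) \<partial>M)"
      by (rule Fubini') measurable
    also have "\<dots> = (\<integral>\<^sup>+y. (\<integral>\<^sup>+x. ennreal ((u y / h y) powr p) * ennreal (k x y * (h x powr p * w x)) \<partial>M) \<partial>M)"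
    proof (rule nn_integral_cong, rule nn_integral_cong_AE, use pos in eventually_elim)
      fix y x assume "0 < h x \<and> 0 < w x"
      then show "ennreal (k x y * (u y / h y) powr p) * ennreal (h x powr p * w x)
        = ennreal ((u y / h y) powr p) * ennreal (k x y * (h x powr p * w x))"
        using k0[of x y] by (simp add: ennreal_mult[symmetric] mult_ac)
    qed
    also have "\<dots> = (\<integral>\<^sup>+y. ennreal ((u y / h y) powr p) * (\<integral>\<^sup>+x. ennreal (k x y * (h x powr p * w x)) \<partial>M) \<partial>M)"
      by (intro nn_integral_cong nn_integral_cmult) measurable
    also have "\<dots> \<le> (\<integral>\<^sup>+y. ennreal C2 * ennreal (u y powr p * w y) \<partial>M)"
    proof (rule nn_integral_mono_AE, use pos S2 in eventually_elim)
      case (elim y)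
      have "ennreal ((u y / h y) powr p) * (\<integral>\<^sup>+x. ennreal (k x y * (h x powr p * w x)) \<partial>M)
        \<le> ennreal ((u y / h y) powr p) * ennreal (C2 * (h y powr p * w y))"
        using elim by (intro mult_left_mono) auto
      also have "\<dots> = ennreal C2 * ennreal (u y powr p * w y)"
        using elim C u0[of y] by (simp add: ennreal_mult[symmetric] powr_divide)
      finally show ?case .
    qed
    also have "\<dots> = ennreal C2 * ?N" by (rule nn_integral_cmult) measurable
    finally show ?thesis .
  qed
  also have "\<dots> < \<infinity>" using fin by (simp add: ennreal_mult_less_top)
  finally have "AE x in M. A x * ennreal (h x powr p * w x) < \<infinity>"
    by (intro nn_integral_PInf_AE[THEN eventually_mono]) (auto simp: less_top)
  with pos have Afin: "AE x in M. A x < \<infinity>"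
    by eventually_elim (auto simp: ennreal_mult_less_top)
  have sp: "AE x in M. x \<in> space M" by (rule AE_space)
  from pos Afin S1 sp have main: "AE x in M. T x < \<infinity> \<and> enn2real (T x) powr p \<le> C powr p * h x powr p * enn2real (A x)"
    by eventually_elim (rule pt, auto)
  then show "AE x in M. (\<integral>\<^sup>+y. ennreal (k x y * u y) \<partial>M) < \<infinity>"
    unfolding T_def by eventually_elim simp
  have "(\<integral>\<^sup>+x. ennreal (enn2real (T x) powr p * w x) \<partial>M) \<le> (\<integral>\<^sup>+x. ennreal (C powr p) * (A x * ennreal (h x powr p * w x)) \<partial>M)"
  proof (rule nn_integral_mono_AE, use main pos Afin in eventually_elim)
    case (elim x)
    have "enn2real (T x) powr p * w x \<le> C powr p * h x powr p * enn2real (A x) * w x"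
      using elim by (intro mult_right_mono) auto
    then have "ennreal (enn2real (T x) powr p * w x) \<le> ennreal (C powr p * (enn2real (A x) * (h x powr p * w x)))"
      by (intro ennreal_leI) (simp add: mult_ac)
    also have "\<dots> = ennreal (C powr p) * (A x * ennreal (h x powr p * w x))"
      using elim by (simp add: ennreal_mult ennreal_enn2real_if)
    finally show ?case .
  qed
  also have "\<dots> = ennreal (C powr p) * (\<integral>\<^sup>+x. A x * ennreal (h x powr p * w x) \<partial>M)"
    by (rule nn_integral_cmult) measurable
  also have "\<dots> \<le> ennreal (C powr p) * (ennreal C2 * ?N)"
    by (intro mult_left_mono IA) simp
  also have "\<dots> = ennreal (C powr p * C2) * ?N"
    by (simp add: ennreal_mult' mult.assoc)
  finally show "(\<integral>\<^sup>+x. ennreal (enn2real (\<integral>\<^sup>+y. ennreal (k x y * u y) \<partial>M) powr p * w x) \<partial>M)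
       \<le> ennreal ((1 / p + C1 / q) powr p * C2) * ?N" by (simp add: T_def C_def)
qed

definition polydisc_weight :: "('n \<Rightarrow> real) \<Rightarrow> real \<Rightarrow> complex ^ 'n::finite \<Rightarrow> real" where
  "polydisc_weight x y z = (\<Prod>j\<in>UNIV. norm (z $ j) powr (- x j) * (1 - (norm (z $ j))\<^sup>2) powr (- y))"

lemma polydisc_weight_measurable [measurable]: "polydisc_weight x y \<in> borel_measurable borel"
  unfolding polydisc_weight_def by measurable

lemma polydisc_weight_nonneg: "polydisc_weight x y z \<ge> 0"
  unfolding polydisc_weight_def by (intro prod_nonneg) auto

lemma polydisc_weight_pos:
  assumes "z \<in> unit_polydisc" "z \<in> regular" shows "polydisc_weight x y z > 0"
  unfolding polydisc_weight_def
proof (intro prod_pos ballI)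
  fix j
  have "(norm (z $ j))\<^sup>2 < 1" "z $ j \<noteq> 0" using assms by (auto simp: unit_polydisc_def regular_def power_less_one_iff)
  then show "norm (z $ j) powr (- x j) * (1 - (norm (z $ j))\<^sup>2) powr (- y) > 0" by simp
qed

lemma polydisc_weight_powr:
  assumes "z \<in> unit_polydisc"
  shows "polydisc_weight x y z powr p = polydisc_weight (\<lambda>j. p * x j) (p * y) z"
proof -
  have "(norm (z $ j))\<^sup>2 \<le> 1" for j using assms by (auto simp: unit_polydisc_def power_le_one less_imp_le)
  then show ?thesis
    unfolding polydisc_weight_def
    by (subst prod_powr_distrib) (auto simp: powr_mult powr_powr mult.commute)
qed

lemma norm_polydisc_kernel:
  "norm (polydisc_kernel z w) = (\<Prod>j\<in>UNIV. 1 / pi * inverse ((norm (1 - z $ j * cnj (w $ j)))\<^sup>2))"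
  unfolding polydisc_kernel_def prod_norm[symmetric]
  by (intro prod.cong refl) (simp add: norm_divide norm_mult norm_power inverse_eq_divide)

lemma norm_polydisc_kernel_commute: "norm (polydisc_kernel z w) = norm (polydisc_kernel w z)"
proof -
  have "norm (1 - a * cnj b) = norm (1 - b * cnj a)" for a b
  proof -
    have "norm (1 - a * cnj b) = norm (cnj (1 - a * cnj b))" by (simp only: complex_mod_cnj)
    also have "cnj (1 - a * cnj b) = 1 - b * cnj a" by simp
    finally show ?thesis .
  qed
  then show ?thesis by (simp add: norm_polydisc_kernel)
qed

lemma ennreal_prod_mono:
  fixes f g :: "'b \<Rightarrow> ennreal"
  assumes "\<And>i. f i \<le> g i"
  shows "(\<Prod>i\<in>S. f i) \<le> (\<Prod>i\<in>S. g i)"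
  by (induction S rule: infinite_finite_induct) (auto intro: mult_mono assms)

text \<open>Kernel and weight are products, so the integral factors into Forelli--Rudin integrals over discs.\<close>

lemma polydisc_kernel_weight_bound:
  assumes x: "\<And>j::'n::finite. 0 \<le> x j \<and> x j < 2" and y: "0 < y" "y < 1"
  obtains C where "C > 0" "\<And>z. z \<in> unit_polydisc \<Longrightarrow> z \<in> regular \<Longrightarrow>
    (\<integral>\<^sup>+w. ennreal (norm (polydisc_kernel z w) * polydisc_weight x y w) * indicator unit_polydisc w \<partial>lborel)
      \<le> ennreal (C * polydisc_weight x y z)"
proof -
  define P where "P j c \<longleftrightarrow> 0 < c \<and> (\<forall>\<zeta>. norm \<zeta> < 1 \<longrightarrow>
    (\<integral>\<^sup>+w. indicator (ball 0 1) w * ennreal (inverse ((norm (1 - \<zeta> * cnj w))\<^sup>2) * (norm w powr (- x j) * (1 - (norm w)\<^sup>2) powr (- y))) \<partial>lborel)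
     \<le> ennreal (c * (1 - (norm \<zeta>)\<^sup>2) powr (- y)))" for j and c :: real
  have "\<exists>c. P j c" for j
  proof (rule disc_kernel_integral_bound[of "x j" y])
    fix C assume "0 < C" "\<And>\<zeta>. norm \<zeta> < 1 \<Longrightarrow>
    (\<integral>\<^sup>+w. indicator (ball 0 1) w * ennreal (inverse ((norm (1 - \<zeta> * cnj w))\<^sup>2) * (norm w powr (- x j) * (1 - (norm w)\<^sup>2) powr (- y))) \<partial>lborel)
     \<le> ennreal (C * (1 - (norm \<zeta>)\<^sup>2) powr (- y))"
    then have "P j C" unfolding P_def by simp
    then show ?thesis ..
  qed (use x[of j] y in auto)
  then have "\<exists>C. \<forall>j. P j (C j)" by (intro choice) simp
  then obtain C where PC: "\<forall>j. P j (C j)" ..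
  have C: "C j > 0" "norm \<zeta> < 1 \<Longrightarrow>
    (\<integral>\<^sup>+w. indicator (ball 0 1) w * ennreal (inverse ((norm (1 - \<zeta> * cnj w))\<^sup>2) * (norm w powr (- x j) * (1 - (norm w)\<^sup>2) powr (- y))) \<partial>lborel)
     \<le> ennreal (C j * (1 - (norm \<zeta>)\<^sup>2) powr (- y))" for j \<zeta>
    using PC unfolding P_def by simp_all
  show thesis
  proof (rule that[of "\<Prod>j\<in>UNIV. C j / pi"])
    show "(\<Prod>j\<in>UNIV. C j / pi) > 0" using C(1) by (intro prod_pos) auto
    fix z :: "complex ^ 'n" assume z: "z \<in> unit_polydisc" "z \<in> regular"
    define g where "g j w = inverse ((norm (1 - z $ j * cnj w))\<^sup>2) * (norm w powr (- x j) * (1 - (norm w)\<^sup>2) powr (- y))" for j and w :: complex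
    have g0: "g j w \<ge> 0" for j w by (simp add: g_def)
    have [measurable]: "g j \<in> borel_measurable borel" for j unfolding g_def by measurable
    have "(\<integral>\<^sup>+w. ennreal (norm (polydisc_kernel z w) * polydisc_weight x y w) * indicator unit_polydisc w \<partial>lborel)
       = (\<integral>\<^sup>+w. (\<Prod>j\<in>UNIV. indicator (ball 0 1) (w $ j) * ennreal (1 / pi * g j (w $ j))) \<partial>lborel)"
    proof (rule nn_integral_cong)
      fix w :: "complex ^ 'n"
      have "norm (polydisc_kernel z w) * polydisc_weight x y w = (\<Prod>j\<in>UNIV. 1 / pi * g j (w $ j))"
        unfolding norm_polydisc_kernel polydisc_weight_def prod.distrib[symmetric] g_def by (simp only: mult.assoc)
      then have "ennreal (norm (polydisc_kernel z w) * polydisc_weight x y w) = (\<Prod>j\<in>UNIV. ennreal (1 / pi * g j (w $ j)))"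
        using g0 by (simp add: prod_ennreal del: times_divide_eq_left)
      moreover have "(\<Prod>j\<in>UNIV. indicator (ball 0 1) (w $ j) :: ennreal) = indicator unit_polydisc w"
        unfolding indicator_def by (subst prod_of_bool) (simp add: unit_polydisc_def)
      ultimately show "ennreal (norm (polydisc_kernel z w) * polydisc_weight x y w) * indicator unit_polydisc w
        = (\<Prod>j\<in>UNIV. indicator (ball 0 1) (w $ j) * ennreal (1 / pi * g j (w $ j)))"
        by (simp only: prod.distrib mult.commute)
    qed
    also have "\<dots> = (\<Prod>j\<in>UNIV. \<integral>\<^sup>+w. indicator (ball 0 1) w * ennreal (1 / pi * g j w) \<partial>lborel)"
      by (rule nn_integral_vec_prod) measurable
    also have "\<dots> \<le> (\<Prod>j\<in>UNIV. ennreal (C j / pi * (norm (z $ j) powr (- x j) * (1 - (norm (z $ j))\<^sup>2) powr (- y))))"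
    proof (rule ennreal_prod_mono)
      fix j
      have zj: "norm (z $ j) < 1" "z $ j \<noteq> 0" using z by (auto simp: unit_polydisc_def regular_def)
      have "(\<integral>\<^sup>+w. indicator (ball 0 1) w * ennreal (1 / pi * g j w) \<partial>lborel)
         = (\<integral>\<^sup>+w. ennreal (1 / pi) * (indicator (ball 0 1) w * ennreal (g j w)) \<partial>lborel)"
        using g0 by (intro nn_integral_cong) (simp add: ennreal_mult mult.left_commute del: times_divide_eq_left)
      also have "\<dots> = ennreal (1 / pi) * (\<integral>\<^sup>+w. indicator (ball 0 1) w * ennreal (g j w) \<partial>lborel)"
        by (rule nn_integral_cmult) measurable
      also have "\<dots> \<le> ennreal (1 / pi) * ennreal (C j * (1 - (norm (z $ j))\<^sup>2) powr (- y))"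
        unfolding g_def by (intro mult_left_mono C(2) zj) simp
      also have "\<dots> = ennreal (C j / pi * (1 - (norm (z $ j))\<^sup>2) powr (- y))"
        using C(1)[of j] by (simp add: ennreal_mult[symmetric])
      also have "\<dots> \<le> ennreal (C j / pi * (norm (z $ j) powr (- x j) * (1 - (norm (z $ j))\<^sup>2) powr (- y)))"
      proof (intro ennreal_leI mult_left_mono)
        have "norm (z $ j) powr 0 \<le> norm (z $ j) powr (- x j)" using zj x[of j] by (intro powr_mono') auto
        then have "1 \<le> norm (z $ j) powr (- x j)" using zj by simp
        from mult_right_mono[OF this, of "(1 - (norm (z $ j))\<^sup>2) powr (- y)"]
        show "(1 - (norm (z $ j))\<^sup>2) powr (- y) \<le> norm (z $ j) powr (- x j) * (1 - (norm (z $ j))\<^sup>2) powr (- y)" by simp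
      qed (use C(1)[of j] in simp)
      finally show "(\<integral>\<^sup>+w. indicator (ball 0 1) w * ennreal (1 / pi * g j w) \<partial>lborel)
        \<le> ennreal (C j / pi * (norm (z $ j) powr (- x j) * (1 - (norm (z $ j))\<^sup>2) powr (- y)))" .
    qed
    also have "\<dots> = ennreal ((\<Prod>j\<in>UNIV. C j / pi) * polydisc_weight x y z)"
      unfolding polydisc_weight_def prod.distrib[symmetric]
    proof (rule prod_ennreal)
      fix j
      show "0 \<le> C j / pi * (norm (z $ j) powr - x j * (1 - (norm (z $ j))\<^sup>2) powr - y)"
        using C(1)[of j] by simp
    qed
    finally show "(\<integral>\<^sup>+w. ennreal (norm (polydisc_kernel z w) * polydisc_weight x y w) * indicator unit_polydisc w \<partial>lborel)
      \<le> ennreal ((\<Prod>j\<in>UNIV. C j / pi) * polydisc_weight x y z)" .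
  qed
qed

lemma polydisc_kernel_joint_measurable [measurable (raw)]:
  assumes [measurable]: "f \<in> M \<rightarrow>\<^sub>M borel" "g \<in> M \<rightarrow>\<^sub>M borel"
  shows "(\<lambda>x. polydisc_kernel (f x) (g x)) \<in> borel_measurable M"
proof -
  have [measurable]: "(\<lambda>x. cnj (g x $ j)) \<in> borel_measurable M" for j by measurable
  show ?thesis unfolding polydisc_kernel_def by measurable
qed

text \<open>Schur's test with \<open>h = \<Prod>\<^sub>j |z\<^sub>j| powr (- s\<^sub>j) (1 - |z\<^sub>j|\<^sup>2) powr (- ep)\<close>. The first condition needs \<open>0 \<le> q s\<^sub>j < 2\<close>, the second one
\<open>0 \<le> p s\<^sub>j - d\<^sub>j (2 - p) < 2\<close>; the hypotheses on \<open>d\<close> say that the smallest \<open>s\<^sub>j\<close> meeting the lower bounds also meets the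
upper ones.\<close>

theorem polydisc_operator_bound:
  fixes d :: "'n::finite \<Rightarrow> real"
  assumes p: "p > 1" and d: "\<And>j. d j \<ge> 0" "\<And>j. d j * (2 - p) < 2 * (p - 1)" "\<And>j. d j * (p - 2) < 2"
  obtains C where "C > 0" "\<And>u. u \<in> borel_measurable borel \<Longrightarrow> (\<And>z. u z \<ge> 0) \<Longrightarrow>
      (\<integral>\<^sup>+z. ennreal (u z powr p * polydisc_weight (\<lambda>j. d j * (p - 2)) 0 z) * indicator unit_polydisc z \<partial>lborel) < \<infinity> \<Longrightarrow>
      (AE z in lborel. z \<in> unit_polydisc \<longrightarrow>
          (\<integral>\<^sup>+w. ennreal (norm (polydisc_kernel z w) * u w) * indicator unit_polydisc w \<partial>lborel) < \<infinity>) \<and>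
      (\<integral>\<^sup>+z. ennreal (enn2real (\<integral>\<^sup>+w. ennreal (norm (polydisc_kernel z w) * u w) * indicator unit_polydisc w \<partial>lborel) powr p
            * polydisc_weight (\<lambda>j. d j * (p - 2)) 0 z) * indicator unit_polydisc z \<partial>lborel)
        \<le> ennreal C * (\<integral>\<^sup>+z. ennreal (u z powr p * polydisc_weight (\<lambda>j. d j * (p - 2)) 0 z) * indicator unit_polydisc z \<partial>lborel)"
proof -
  define q where "q = p / (p - 1)"
  have q: "q > 1" using p by (simp add: q_def)
  \<comment> \<open>The smallest exponents for which both singularities at the hyperplanes are nonnegative.\<close>
  define s where "s j = max 0 (d j * (2 - p) / p)" for j
  \<comment> \<open>Both \<open>p * ep\<close> and \<open>q * ep\<close> must lie strictly between 0 and 1.\<close>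
  define ep where "ep = 1 / (2 * max p q)"
  have ep: "0 < ep" "0 < q * ep" "q * ep < 1" "0 < p * ep" "p * ep < 1"
    using p q by (auto simp: ep_def field_simps)
  have sq: "0 \<le> q * s j \<and> q * s j < 2" for j
  proof -
    have "q * (d j * (2 - p) / p) = d j * (2 - p) / (p - 1)" using p by (simp add: q_def field_simps)
    also have "\<dots> < 2" using d(2)[of j] p by (simp add: field_simps)
    finally show ?thesis using q by (auto simp: s_def max_def)
  qed
  have sp: "0 \<le> p * s j + d j * (p - 2) \<and> p * s j + d j * (p - 2) < 2" for j
  proof -
    have "p * (d j * (2 - p) / p) = d j * (2 - p)" using p by simp
    then show ?thesis using d(3)[of j] p mult_nonneg_nonneg[of p "d j * (2 - p) / p"]
      by (cases "0 \<le> d j * (2 - p) / p") (auto simp: s_def max_def algebra_simps zero_le_divide_iff)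
  qed
  let ?W = "polydisc_weight (\<lambda>j. d j * (p - 2)) 0 :: complex ^ 'n \<Rightarrow> real"
  let ?D = "unit_polydisc :: (complex ^ 'n) set"
  define h where "h = (polydisc_weight s ep :: complex ^ 'n \<Rightarrow> real)"
  obtain C1 where C1: "C1 > 0" "\<And>z. z \<in> ?D \<Longrightarrow> z \<in> regular \<Longrightarrow>
    (\<integral>\<^sup>+w. ennreal (norm (polydisc_kernel z w) * polydisc_weight (\<lambda>j. q * s j) (q * ep) w) * indicator ?D w \<partial>lborel)
      \<le> ennreal (C1 * polydisc_weight (\<lambda>j. q * s j) (q * ep) z)"
    using polydisc_kernel_weight_bound[of "\<lambda>j. q * s j" "q * ep"] sq ep by blast
  obtain C2 where C2: "C2 > 0" "\<And>z. z \<in> ?D \<Longrightarrow> z \<in> regular \<Longrightarrow>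
    (\<integral>\<^sup>+w. ennreal (norm (polydisc_kernel z w) * polydisc_weight (\<lambda>j. p * s j + d j * (p - 2)) (p * ep) w) * indicator ?D w \<partial>lborel)
      \<le> ennreal (C2 * polydisc_weight (\<lambda>j. p * s j + d j * (p - 2)) (p * ep) z)"
    using polydisc_kernel_weight_bound[of "\<lambda>j. p * s j + d j * (p - 2)" "p * ep"] sp ep by blast
  have hq: "h z powr q = polydisc_weight (\<lambda>j. q * s j) (q * ep) z" if "z \<in> ?D" for z
    unfolding h_def by (rule polydisc_weight_powr[OF that])
  have hp: "h z powr p * ?W z = polydisc_weight (\<lambda>j. p * s j + d j * (p - 2)) (p * ep) z" if "z \<in> ?D" for z
  proof -
    have "(norm (z $ j))\<^sup>2 < 1" for j using that by (auto simp: unit_polydisc_def power_less_one_iff)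
    then have "(1 - (norm (z $ j))\<^sup>2) powr (- 0) = 1" for j by (simp add: less_imp_neq[THEN not_sym])
    then have "(norm (z $ j) powr - (p * s j) * (1 - (cmod (z $ j))\<^sup>2) powr - (p * ep)) * (norm (z $ j) powr - (d j * (p - 2)) * (1 - (cmod (z $ j))\<^sup>2) powr - 0)
        = norm (z $ j) powr - (p * s j + d j * (p - 2)) * (1 - (cmod (z $ j))\<^sup>2) powr - (p * ep)" for j
    proof -
      have "norm (z $ j) powr - (p * s j + d j * (p - 2)) = norm (z $ j) powr - (p * s j) * norm (z $ j) powr - (d j * (p - 2))"
        by (subst powr_add[symmetric]) simp
      then show ?thesis using \<open>(1 - (norm (z $ j))\<^sup>2) powr (- 0) = 1\<close> by (simp only: mult_1_right mult_ac)
    qed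
    then show ?thesis
      unfolding h_def polydisc_weight_powr[OF that] unfolding polydisc_weight_def prod.distrib[symmetric] by (intro prod.cong refl)
  qed
  define M where "M = density lborel (indicator ?D)"
  have [measurable_cong]: "sets M = sets borel" by (simp add: M_def)
  have nnM: "(\<integral>\<^sup>+z. f z \<partial>M) = (\<integral>\<^sup>+z. f z * indicator ?D z \<partial>lborel)" if "f \<in> borel_measurable borel" for f
    unfolding M_def using that by (subst nn_integral_density) (auto simp: mult.commute)
  have AEM: "(AE z in M. P z) \<longleftrightarrow> (AE z in lborel. z \<in> ?D \<longrightarrow> P z)" for P
    unfolding M_def by (subst AE_density) (auto simp: indicator_def)
  have sf: "sigma_finite_measure M"
    unfolding M_def by (subst sigma_finite_measure.sigma_finite_iff_density_finite[OF sigma_finite_lborel])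
       (auto simp: indicator_def)
  have AEreg: "AE z in M. z \<in> ?D \<and> z \<in> regular"
    unfolding AEM using AE_regular by eventually_elim auto
  have hm[measurable]: "h \<in> borel_measurable borel" unfolding h_def by measurable
  have S1: "AE x in M. (\<integral>\<^sup>+y. ennreal (norm (polydisc_kernel x y) * h y powr q) \<partial>M) \<le> ennreal (C1 * h x powr q)"
    using AEreg
  proof eventually_elim
    case (elim x)
    have "(\<integral>\<^sup>+y. ennreal (norm (polydisc_kernel x y) * h y powr q) \<partial>M)
       = (\<integral>\<^sup>+y. ennreal (norm (polydisc_kernel x y) * polydisc_weight (\<lambda>j. q * s j) (q * ep) y) * indicator ?D y \<partial>lborel)"
      by (subst nnM) (auto intro!: nn_integral_cong simp: indicator_def hq)
    then show ?case using C1(2)[of x] elim by (simp add: hq)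
  qed
  have S2: "AE y in M. (\<integral>\<^sup>+x. ennreal (norm (polydisc_kernel x y) * (h x powr p * ?W x)) \<partial>M) \<le> ennreal (C2 * (h y powr p * ?W y))"
    using AEreg
  proof eventually_elim
    case (elim y)
    have "(\<integral>\<^sup>+x. ennreal (norm (polydisc_kernel x y) * (h x powr p * ?W x)) \<partial>M)
       = (\<integral>\<^sup>+x. ennreal (norm (polydisc_kernel y x) * polydisc_weight (\<lambda>j. p * s j + d j * (p - 2)) (p * ep) x) * indicator ?D x \<partial>lborel)"
      by (subst nnM) (auto intro!: nn_integral_cong simp: indicator_def hp norm_polydisc_kernel_commute[of y])
    then show ?case using C2(2)[of y] elim by (simp add: hp)
  qed
  have pos: "AE x in M. h x > 0 \<and> ?W x > 0"
    using AEreg by eventually_elim (auto simp: h_def intro: polydisc_weight_pos)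
  have km: "(\<lambda>(x, y). norm (polydisc_kernel x y)) \<in> borel_measurable (M \<Otimes>\<^sub>M M)"
    by measurable
  let ?C = "(1 / p + C1 / q) powr p * C2"
  show thesis
  proof (rule that[of ?C])
    have "1 / p + C1 / q > 0" using p q C1 by (intro add_pos_pos) auto
    then show "?C > 0" using C2 by simp
    fix u :: "complex ^ 'n \<Rightarrow> real"
    assume u[measurable]: "u \<in> borel_measurable borel" and u0: "\<And>z. u z \<ge> 0"
      and fin: "(\<integral>\<^sup>+z. ennreal (u z powr p * ?W z) * indicator ?D z \<partial>lborel) < \<infinity>"
    have fin': "(\<integral>\<^sup>+z. ennreal (u z powr p * ?W z) \<partial>M) < \<infinity>" using fin by (subst nnM) auto
    have T: "(\<integral>\<^sup>+w. ennreal (norm (polydisc_kernel z w) * u w) \<partial>M)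
       = (\<integral>\<^sup>+w. ennreal (norm (polydisc_kernel z w) * u w) * indicator ?D w \<partial>lborel)" for z
      by (rule nnM) measurable
    have Tm: "(\<lambda>z. enn2real (\<integral>\<^sup>+w. ennreal (norm (polydisc_kernel z w) * u w) * indicator ?D w \<partial>lborel) powr p * ?W z)
        \<in> borel_measurable borel" by measurable
    have um: "h \<in> borel_measurable M" "?W \<in> borel_measurable M" "u \<in> borel_measurable M" by measurable
    note sch = schur_test[OF sf km _ um pos u0 p q_def C1(1) C2(1) S1 S2 fin']
    have 1: "AE x in M. (\<integral>\<^sup>+y. ennreal (norm (polydisc_kernel x y) * u y) \<partial>M) < \<infinity>" by (rule sch) simp
    have 2: "(\<integral>\<^sup>+x. ennreal (enn2real (\<integral>\<^sup>+y. ennreal (norm (polydisc_kernel x y) * u y) \<partial>M) powr p * ?W x) \<partial>M)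
       \<le> ennreal ?C * (\<integral>\<^sup>+y. ennreal (u y powr p * ?W y) \<partial>M)" by (rule sch) simp
    have l: "(\<integral>\<^sup>+x. ennreal (enn2real (\<integral>\<^sup>+w. ennreal (norm (polydisc_kernel x w) * u w) * indicator ?D w \<partial>lborel) powr p * ?W x) \<partial>M)
      = (\<integral>\<^sup>+x. ennreal (enn2real (\<integral>\<^sup>+w. ennreal (norm (polydisc_kernel x w) * u w) * indicator ?D w \<partial>lborel) powr p * ?W x) * indicator ?D x \<partial>lborel)"
      by (rule nnM) (use Tm in measurable)
    have r: "(\<integral>\<^sup>+y. ennreal (u y powr p * ?W y) \<partial>M) = (\<integral>\<^sup>+y. ennreal (u y powr p * ?W y) * indicator ?D y \<partial>lborel)"
      by (rule nnM) measurable
    show "(AE z in lborel. z \<in> unit_polydisc \<longrightarrow>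
          (\<integral>\<^sup>+w. ennreal (norm (polydisc_kernel z w) * u w) * indicator unit_polydisc w \<partial>lborel) < \<infinity>) \<and>
      (\<integral>\<^sup>+z. ennreal (enn2real (\<integral>\<^sup>+w. ennreal (norm (polydisc_kernel z w) * u w) * indicator unit_polydisc w \<partial>lborel) powr p
            * ?W z) * indicator unit_polydisc z \<partial>lborel)
        \<le> ennreal ?C * (\<integral>\<^sup>+z. ennreal (u z powr p * ?W z) * indicator unit_polydisc z \<partial>lborel)"
      using 1 2 unfolding T l r AEM by (rule conjI)
  qed
qed

section \<open>Transfer of the estimates to the monomial polyhedron\<close>

lemma completion_borel_representative:
  fixes f :: "'a::euclidean_space \<Rightarrow> complex"
  assumes "f \<in> borel_measurable lebesgue"
  obtains g where "g \<in> borel_measurable borel" "AE x in lborel. f x = g x"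
proof -
  have "(\<lambda>x. Re (f x)) \<in> borel_measurable (completion lborel)" "(\<lambda>x. Im (f x)) \<in> borel_measurable (completion lborel)"
    using assms by measurable
  from this[THEN completion_ex_borel_measurable_real]
  obtain g1 g2 where g: "g1 \<in> borel_measurable lborel" "AE x in lborel. Re (f x) = g1 x"
    "g2 \<in> borel_measurable lborel" "AE x in lborel. Im (f x) = g2 x" by blast
  show thesis
  proof (rule that[of "\<lambda>x. Complex (g1 x) (g2 x)"])
    have [measurable]: "g1 \<in> borel_measurable borel" "g2 \<in> borel_measurable borel" using g by auto
    have "(\<lambda>x. Complex (g1 x) (g2 x)) = (\<lambda>x. of_real (g1 x) + \<i> * of_real (g2 x))"
      by (simp add: fun_eq_iff complex_eq_iff)
    also have "\<dots> \<in> borel_measurable borel" by measurable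
    finally show "(\<lambda>x. Complex (g1 x) (g2 x)) \<in> borel_measurable borel" .
    show "AE x in lborel. f x = Complex (g1 x) (g2 x)"
      using g(2,4) by eventually_elim (simp add: complex_eq_iff)
  qed
qed

lemma borel_imp_lebesgue_measurable: "f \<in> borel_measurable borel \<Longrightarrow> f \<in> borel_measurable lebesgue"
  by (rule measurable_completion) simp

lemma AE_lebesgue_onI:
  fixes S :: "'a::euclidean_space set"
  assumes S: "S \<in> sets borel"
  shows "(AE x in lborel. x \<in> S \<longrightarrow> P x) \<Longrightarrow> (AE x in lebesgue_on S. P x)"
proof -
  assume "AE x in lborel. x \<in> S \<longrightarrow> P x"
  then have "AE x in lebesgue. x \<in> S \<longrightarrow> P x" by (rule AE_completion)
  then show ?thesis using S by (subst AE_restrict_space_iff) auto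
qed

lemma polydisc_weight_monomial:
  assumes "z \<in> regular" "z \<in> unit_polydisc"
  shows "polydisc_weight (\<lambda>j. real (d j) * (p - 2)) 0 z = norm (\<Prod>j\<in>UNIV. z $ j ^ d j) powr (2 - p)"
proof -
  have "norm (z $ j) powr - (real (d j) * (p - 2)) * (1 - (norm (z $ j))\<^sup>2) powr - 0 = (norm (z $ j) ^ d j) powr (2 - p)" for j
  proof -
    have 1: "(norm (z $ j))\<^sup>2 < 1" "norm (z $ j) > 0" using assms by (auto simp: unit_polydisc_def regular_def power_less_one_iff)
    have "(norm (z $ j) ^ d j) powr (2 - p) = (norm (z $ j) powr real (d j)) powr (2 - p)"
      using 1 by (simp add: powr_realpow)
    also have "\<dots> = norm (z $ j) powr (real (d j) * (2 - p))" by (simp only: powr_powr)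
    also have "real (d j) * (2 - p) = - (real (d j) * (p - 2))" by (simp add: algebra_simps)
    finally show ?thesis using 1 by simp
  qed
  then have "polydisc_weight (\<lambda>j. real (d j) * (p - 2)) 0 z = (\<Prod>j\<in>UNIV. (norm (z $ j) ^ d j) powr (2 - p))"
    unfolding polydisc_weight_def by (intro prod.cong refl)
  also have "\<dots> = (\<Prod>j\<in>UNIV. norm (z $ j) ^ d j) powr (2 - p)"
    by (rule prod_powr_distrib[symmetric])
  finally show ?thesis by (simp add: prod_norm[symmetric] norm_power)
qed

context monomial_cover
begin

definition model_integral :: "(complex ^ 'n \<Rightarrow> real) \<Rightarrow> complex ^ 'n \<Rightarrow> ennreal" where
  "model_integral u x = (\<integral>\<^sup>+y. ennreal (norm (polydisc_kernel x y) * u y) * indicator unit_polydisc y \<partial>lborel)"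

lemma model_integral_rotate:
  assumes w: "w \<in> deck" and u: "u \<in> borel_measurable borel" "\<And>y. u (w * y) = u y"
  shows "model_integral u (w * x) = model_integral u x"
proof -
  note [measurable] = u(1)
  have "model_integral u (w * x) = (\<integral>\<^sup>+y. ennreal (norm (polydisc_kernel (w * x) (w * y)) * u (w * y)) * indicator unit_polydisc (w * y) \<partial>lborel)"
    unfolding model_integral_def by (rule nn_integral_rotate[symmetric]) (auto simp: deck_norm[OF w])
  also have "\<dots> = model_integral u x"
    unfolding model_integral_def
    using polydisc_kernel_rotate[OF deck_norm[OF w]] deck_polydisc[OF w]
    by (intro nn_integral_cong) (simp add: u(2) indicator_def)
  finally show ?thesis .
qed

text \<open>Each of the summands of \<open>deck_kernel\<close> contributes the same integral, since the remaining factors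
are invariant under rotation by deck transformations.\<close>

lemma absolute_integral_bound:
  assumes u0[measurable]: "u0 \<in> borel_measurable borel" "\<And>w. u0 w \<ge> 0" and z: "z \<in> unit_polydisc" "z \<in> regular"
  defines "u \<equiv> \<lambda>y. norm (jac y) * u0 (Phi y)"
  shows "(\<integral>\<^sup>+w. ennreal (norm (lifted_kernel z (psi w)) * u0 w) * indicator (monomial_set B) w \<partial>lborel)
     \<le> ennreal (inverse (norm (jac z))) * model_integral u z"
proof -
  have um[measurable]: "u \<in> borel_measurable borel" unfolding u_def by measurable
  have ur: "u (w * y) = u y" if "w \<in> deck" for w y
    using that by (simp add: u_def Phi_deck jac_mult norm_mult norm_jac_deck)
  have jz: "norm (jac z) > 0" using jac_nz[OF z(2)] by simp
  let ?c = "cover_const / card deck / norm (jac z)"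
  have c0: "?c \<ge> 0" using cover_const_pos by simp
  let ?F = "\<lambda>w. ennreal (norm (lifted_kernel z (psi w)) * u0 w) * indicator (monomial_set B) w"
  have "ennreal cover_const * (\<integral>\<^sup>+w. ?F w \<partial>lborel) = (\<integral>\<^sup>+y. ennreal ((norm (jac y))\<^sup>2) * ?F (Phi y) \<partial>lborel)"
    by (rule nn_integral_cover[symmetric]) measurable
  also have "\<dots> \<le> (\<integral>\<^sup>+y. ennreal ?c * (\<Sum>w\<in>deck. ennreal (norm (polydisc_kernel (w * z) y) * u y) * indicator unit_polydisc y) \<partial>lborel)"
  proof (rule nn_integral_mono_AE, use AE_regular in eventually_elim)
    case (elim y)
    show ?case
    proof (cases "y \<in> unit_polydisc")
      case True
      have jy: "norm (jac y) > 0" using jac_nz[OF elim] by simp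
      have "norm (deck_kernel z y) \<le> (\<Sum>w\<in>deck. norm (polydisc_kernel (w * z) y))"
        unfolding deck_kernel_def by (rule sum_norm_le) (simp add: norm_mult norm_jac_deck)
      then have "?c * norm (jac y) * u0 (Phi y) * norm (deck_kernel z y) \<le> ?c * norm (jac y) * u0 (Phi y) * (\<Sum>w\<in>deck. norm (polydisc_kernel (w * z) y))"
        using u0(2) c0 by (intro mult_left_mono mult_nonneg_nonneg) auto
      moreover have "(norm (jac y))\<^sup>2 * (norm (lifted_kernel z y) * u0 (Phi y)) = ?c * norm (jac y) * u0 (Phi y) * norm (deck_kernel z y)"
        using jy jz cover_const_pos by (simp add: lifted_kernel_def norm_mult norm_divide power2_eq_square)
      moreover have "?c * norm (jac y) * u0 (Phi y) * (\<Sum>w\<in>deck. norm (polydisc_kernel (w * z) y)) = ?c * (\<Sum>w\<in>deck. norm (polydisc_kernel (w * z) y) * u y)"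
        unfolding u_def sum_distrib_left by (intro sum.cong refl) (simp only: mult_ac)
      ultimately have "ennreal ((norm (jac y))\<^sup>2 * (norm (lifted_kernel z y) * u0 (Phi y))) \<le> ennreal (?c * (\<Sum>w\<in>deck. norm (polydisc_kernel (w * z) y) * u y))"
        by (intro ennreal_leI) (simp only:)
      also have "\<dots> = ennreal ?c * (\<Sum>w\<in>deck. ennreal (norm (polydisc_kernel (w * z) y) * u y))"
        using c0 u0(2) by (subst ennreal_mult'[OF c0]) (simp add: sum_ennreal u_def)
      finally show ?thesis
        using True elim u0(2)[of "Phi y"] by (simp add: Phi_in_set lifted_kernel_psi_Phi ennreal_mult'[symmetric])
    qed (simp add: Phi_in_set[OF elim])
  qed
  also have "\<dots> = ennreal ?c * (\<Sum>w\<in>deck. model_integral u (w * z))"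
    unfolding model_integral_def by (subst nn_integral_cmult, measurable, subst nn_integral_sum, measurable)
  also have "(\<Sum>w\<in>deck. model_integral u (w * z)) = of_nat (card deck) * model_integral u z"
    by (simp add: model_integral_rotate um ur)
  also have "ennreal ?c * (of_nat (card deck) * model_integral u z) = ennreal cover_const * (ennreal (inverse (norm (jac z))) * model_integral u z)"
  proof -
    have "ennreal ?c * of_nat (card deck) = ennreal (?c * real (card deck))"
      by (simp only: ennreal_mult[OF c0 of_nat_0_le_iff] ennreal_of_nat_eq_real_of_nat)
    also have "?c * real (card deck) = cover_const * inverse (norm (jac z))"
      using card_deck_pos by (simp add: divide_inverse)
    also have "ennreal \<dots> = ennreal cover_const * ennreal (inverse (norm (jac z)))"
      using cover_const_pos by (simp add: ennreal_mult)
    finally show ?thesis by (simp only: mult.assoc[symmetric])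
  qed
  finally show ?thesis
    using cover_const_pos by (subst (asm) ennreal_mult_le_mult_iff) auto
qed

text \<open>The Bergman projection and the positive operator are treated at once: only the values of the kernel at regular points and
an upper bound for its modulus matter. The power of \<open>jac\<close> in the weight arises from the Jacobian and from the factor \<open>|jac|\<close> in the
domination, through \<open>|jac|\<^sup>2 = |jac|\<^sup>p |jac| powr (2 - p)\<close>.\<close>

lemma strong_type_of_dominated:
  fixes k0 k1 :: "complex ^ 'n \<Rightarrow> complex ^ 'n \<Rightarrow> complex"
  assumes op: "open (monomial_set B)" and p: "p > 1"
    and d: "\<And>j. real (jac_exponent j) * (2 - p) < 2 * (p - 1)" "\<And>j. real (jac_exponent j) * (p - 2) < 2"
    and eq: "\<And>z w. z \<in> monomial_set B \<inter> regular \<Longrightarrow> w \<in> monomial_set B \<inter> regular \<Longrightarrow> k0 z w = k1 z w"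
    and k1[measurable]: "(\<lambda>(z, w). k1 z w) \<in> borel_measurable (borel \<Otimes>\<^sub>M borel)"
    and bound: "\<And>z w. norm (k1 z w) \<le> norm (lifted_kernel (psi z) (psi w))"
  shows "strong_type p (monomial_set B) (integral_operator (monomial_set B) k0)"
proof -
  let ?U = "monomial_set B"
  let ?W = "polydisc_weight (\<lambda>j. real (jac_exponent j) * (p - 2)) 0 :: complex ^ 'n \<Rightarrow> real"
  have k1m[measurable]: "(\<lambda>x. k1 (f x) (g x)) \<in> borel_measurable N" if "f \<in> N \<rightarrow>\<^sub>M borel" "g \<in> N \<rightarrow>\<^sub>M borel" for f g and N :: "'c measure"
    using measurable_compose[OF measurable_Pair[OF that] k1] by simp
  obtain C where C: "C > 0" "\<And>u. u \<in> borel_measurable borel \<Longrightarrow> (\<And>z. u z \<ge> 0) \<Longrightarrow>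
      (\<integral>\<^sup>+z. ennreal (u z powr p * ?W z) * indicator unit_polydisc z \<partial>lborel) < \<infinity> \<Longrightarrow>
      (AE z in lborel. z \<in> unit_polydisc \<longrightarrow>
          (\<integral>\<^sup>+w. ennreal (norm (polydisc_kernel z w) * u w) * indicator unit_polydisc w \<partial>lborel) < \<infinity>) \<and>
      (\<integral>\<^sup>+z. ennreal (enn2real (\<integral>\<^sup>+w. ennreal (norm (polydisc_kernel z w) * u w) * indicator unit_polydisc w \<partial>lborel) powr p
            * ?W z) * indicator unit_polydisc z \<partial>lborel)
        \<le> ennreal C * (\<integral>\<^sup>+z. ennreal (u z powr p * ?W z) * indicator unit_polydisc z \<partial>lborel)"
    using polydisc_operator_bound[of p "\<lambda>j. real (jac_exponent j)", OF p of_nat_0_le_iff d] by blast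
  have weight: "(norm (jac z))\<^sup>2 * y powr p = (norm (jac z) * y) powr p * ?W z"
    if "z \<in> regular" "z \<in> unit_polydisc" "y \<ge> 0" for z y
  proof -
    have j: "norm (jac z) > 0" using jac_nz[OF that(1)] by simp
    have "norm (jac z) powr p * norm (jac z) powr (2 - p) = (norm (jac z))\<^sup>2"
      using j by (simp add: powr_add[symmetric] powr_numeral)
    moreover have "?W z = norm (jac z) powr (2 - p)"
      using polydisc_weight_monomial[OF that(1,2), of jac_exponent p] by (simp add: jac_def)
    moreover have "(norm (jac z) * y) powr p = norm (jac z) powr p * y powr p" using that(3) by (simp add: powr_mult)
    ultimately show ?thesis by (simp only: mult_ac)
  qed
  have "\<exists>g\<in>Lp p ?U. (AE z in lebesgue_on ?U. integral_operator ?U k0 f z = Some (g z)) \<and> Lp_norm p ?U g \<le> C powr (1 / p) * Lp_norm p ?U f"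
    if f: "f \<in> Lp p ?U" for f
  proof -
    have fm: "f \<in> borel_measurable (lebesgue_on ?U)" and fi: "integrable (lebesgue_on ?U) (\<lambda>z. norm (f z) powr p)"
      using f by (auto simp: Lp_def)
    have U': "?U \<inter> space lebesgue \<in> sets lebesgue" by simp
    have "(\<lambda>x. indicator ?U x *\<^sub>R f x) \<in> borel_measurable lebesgue"
      using fm borel_measurable_restrict_space_iff[OF U', of f] by simp
    then obtain f1 where f1[measurable]: "f1 \<in> borel_measurable borel" and f1eq: "AE x in lborel. indicator ?U x *\<^sub>R f x = f1 x"
      by (rule completion_borel_representative)
    define u0 where "u0 w = norm (f1 w)" for w
    have [measurable]: "u0 \<in> borel_measurable borel" unfolding u0_def by measurable
    have u00: "u0 w \<ge> 0" for w by (simp add: u0_def)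
    define I where "I = (\<integral>\<^sup>+w. ennreal (u0 w powr p) * indicator ?U w \<partial>lborel)"
    have f_eq: "AE w in lborel. w \<in> ?U \<longrightarrow> f w = f1 w"
      using f1eq by eventually_elim auto
    have I_eq: "I = ennreal (LINT z|lebesgue_on ?U. norm (f z) powr p)"
    proof -
      have "I = (\<integral>\<^sup>+w. ennreal (u0 w powr p) \<partial>lebesgue_on ?U)"
        unfolding I_def by (rule nn_integral_lebesgue_on_eq_lborel[symmetric]) auto
      also have "\<dots> = (\<integral>\<^sup>+w. ennreal (norm (f w) powr p) \<partial>lebesgue_on ?U)"
        by (rule nn_integral_cong_AE, rule AE_lebesgue_onI[OF monomial_set_measurable])
           (use f_eq in \<open>auto simp: u0_def elim!: eventually_mono\<close>)
      also have "\<dots> = ennreal (LINT z|lebesgue_on ?U. norm (f z) powr p)"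
        by (rule nn_integral_eq_integral[OF fi]) simp
      finally show ?thesis .
    qed
    define u where "u y = norm (jac y) * u0 (Phi y)" for y
    have [measurable]: "u \<in> borel_measurable borel" unfolding u_def by measurable
    have uu: "u y \<ge> 0" for y by (simp add: u_def u00)
    have upI: "(\<integral>\<^sup>+z. ennreal (u z powr p * ?W z) * indicator unit_polydisc z \<partial>lborel) = ennreal cover_const * I"
    proof -
      have "ennreal cover_const * I = (\<integral>\<^sup>+z. ennreal ((norm (jac z))\<^sup>2) * (ennreal (u0 (Phi z) powr p) * indicator ?U (Phi z)) \<partial>lborel)"
        unfolding I_def by (rule nn_integral_cover[symmetric]) measurable
      also have "\<dots> = (\<integral>\<^sup>+z. ennreal (u z powr p * ?W z) * indicator unit_polydisc z \<partial>lborel)"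
      proof (rule nn_integral_cong_AE, use AE_regular in eventually_elim)
        case (elim z)
        show ?case
        proof (cases "z \<in> unit_polydisc")
          case True
          have "ennreal ((norm (jac z))\<^sup>2) * ennreal (u0 (Phi z) powr p) = ennreal (u z powr p * ?W z)"
            unfolding u_def weight[OF elim True u00, symmetric] by (rule ennreal_mult'[symmetric]) simp
          then show ?thesis using True by (simp add: Phi_in_set[OF elim])
        qed (simp add: Phi_in_set[OF elim])
      qed
      finally show ?thesis by simp
    qed
    have "ennreal cover_const * I < \<infinity>" unfolding I_eq by (simp add: ennreal_mult_less_top)
    have Vfin: "AE z in lborel. z \<in> unit_polydisc \<longrightarrow> model_integral u z < \<infinity>"
      and Vp: "(\<integral>\<^sup>+z. ennreal (enn2real (model_integral u z) powr p * ?W z) * indicator unit_polydisc z \<partial>lborel) \<le> ennreal C * (ennreal cover_const * I)"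
      using C(2)[of u, folded model_integral_def, unfolded upI, OF _ uu \<open>ennreal cover_const * I < \<infinity>\<close>] by simp_all
    define S where "S z = (\<integral>\<^sup>+w. ennreal (norm (k1 z w) * u0 w) * indicator ?U w \<partial>lborel)" for z
    have [measurable]: "S \<in> borel_measurable borel" unfolding S_def by measurable
    have Sle: "S (Phi z) \<le> ennreal (inverse (norm (jac z))) * model_integral u z" if z: "z \<in> unit_polydisc" "z \<in> regular" for z
    proof -
      \<comment> \<open>\<open>psi\<close> recovers \<open>z\<close> only up to a deck transformation, which does not affect the estimate.\<close>
      obtain w where w: "w \<in> deck" "psi (Phi z) = w * z"
      proof (rule Phi_eqD[of "psi (Phi z)" z])
        show "Phi (psi (Phi z)) = Phi z" by (rule Phi_psi[OF Phi_regular[OF z(2)]])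
      qed (use z psi_regular that in auto)
      have wz: "w * z \<in> unit_polydisc" "w * z \<in> regular"
        using deck_polydisc[OF w(1)] z mult_regular[OF deck_regular[OF w(1)] z(2)] by auto
      have "S (Phi z) \<le> (\<integral>\<^sup>+v. ennreal (norm (lifted_kernel (w * z) (psi v)) * u0 v) * indicator ?U v \<partial>lborel)"
        unfolding S_def w(2)[symmetric]
        by (intro nn_integral_mono mult_right_mono ennreal_leI bound u00) simp
      also have "\<dots> \<le> ennreal (inverse (norm (jac (w * z)))) * model_integral u (w * z)"
        unfolding u_def[abs_def] by (rule absolute_integral_bound) (use wz u00 in auto)
      also have "norm (jac (w * z)) = norm (jac z)" by (simp add: jac_mult norm_mult norm_jac_deck[OF w(1)])
      also have "model_integral u (w * z) = model_integral u z"
        by (rule model_integral_rotate[OF w(1)]) (auto simp: u_def Phi_deck[OF w(1)] jac_mult norm_mult norm_jac_deck[OF w(1)])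
      finally show ?thesis .
    qed
    have Sfin: "AE z in lborel. z \<in> ?U \<longrightarrow> S z < \<infinity>"
    proof -
      have "ennreal cover_const * (\<integral>\<^sup>+z. indicator {z \<in> ?U. S z = \<infinity>} z \<partial>lborel)
         = (\<integral>\<^sup>+z. ennreal ((norm (jac z))\<^sup>2) * indicator {z \<in> ?U. S z = \<infinity>} (Phi z) \<partial>lborel)"
        by (rule nn_integral_cover[symmetric]) measurable
      also have "\<dots> = (\<integral>\<^sup>+z. 0 \<partial>(lborel :: (complex ^ 'n) measure))"
      proof (rule nn_integral_cong_AE, use AE_regular Vfin in eventually_elim)
        case (elim z)
        have "S (Phi z) < \<infinity>" if "z \<in> unit_polydisc"
          using Sle[OF that elim(1)] elim(2) that by (auto simp: ennreal_mult_less_top elim: le_less_trans)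
        then show ?case using Phi_in_set[OF elim(1)] by (auto simp: indicator_def)
      qed
      finally have "(\<integral>\<^sup>+z. indicator {z \<in> ?U. S z = \<infinity>} z \<partial>lborel) = 0"
        using cover_const_pos by simp
      then have "AE z in lborel. indicator {z \<in> ?U. S z = \<infinity>} z = (0::ennreal)"
        by (subst (asm) nn_integral_0_iff_AE) auto
      then show ?thesis by eventually_elim (auto simp: indicator_def less_top split: if_splits)
    qed
    have Sp: "(\<integral>\<^sup>+z. ennreal (enn2real (S z) powr p) * indicator ?U z \<partial>lborel) \<le> ennreal C * I"
    proof -
      have "ennreal cover_const * (\<integral>\<^sup>+z. ennreal (enn2real (S z) powr p) * indicator ?U z \<partial>lborel)
        = (\<integral>\<^sup>+z. ennreal ((norm (jac z))\<^sup>2) * (ennreal (enn2real (S (Phi z)) powr p) * indicator ?U (Phi z)) \<partial>lborel)"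
        by (rule nn_integral_cover[symmetric]) measurable
      also have "\<dots> \<le> (\<integral>\<^sup>+z. ennreal (enn2real (model_integral u z) powr p * ?W z) * indicator unit_polydisc z \<partial>lborel)"
      proof (rule nn_integral_mono_AE, use AE_regular Vfin in eventually_elim)
        case (elim z)
        show ?case
        proof (cases "z \<in> unit_polydisc")
          case True
          have j: "norm (jac z) > 0" using jac_nz[OF elim(1)] by simp
          have V: "model_integral u z = ennreal (enn2real (model_integral u z))" using elim(2) True by (simp add: ennreal_enn2real_if)
          have "S (Phi z) \<le> ennreal (inverse (norm (jac z)) * enn2real (model_integral u z))"
            using Sle[OF True elim(1)] by (subst ennreal_mult) (use V in auto)
          then have "enn2real (S (Phi z)) \<le> inverse (norm (jac z)) * enn2real (model_integral u z)"
            by (intro enn2real_leI) auto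
          then have "norm (jac z) * enn2real (S (Phi z)) \<le> enn2real (model_integral u z)"
            using j by (simp add: field_simps)
          then have "(norm (jac z) * enn2real (S (Phi z))) powr p * ?W z \<le> enn2real (model_integral u z) powr p * ?W z"
            using p by (intro mult_right_mono powr_mono2 polydisc_weight_nonneg) auto
          then have "(norm (jac z))\<^sup>2 * enn2real (S (Phi z)) powr p \<le> enn2real (model_integral u z) powr p * ?W z"
            using weight[OF elim(1) True, of "enn2real (S (Phi z))"] by simp
          then have "ennreal ((norm (jac z))\<^sup>2) * ennreal (enn2real (S (Phi z)) powr p) \<le> ennreal (enn2real (model_integral u z) powr p * ?W z)"
            by (subst ennreal_mult'[symmetric]) (auto intro: ennreal_leI)
          then show ?thesis using True by (simp add: Phi_in_set[OF elim(1)])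
        qed (simp add: Phi_in_set[OF elim(1)])
      qed
      also have "\<dots> \<le> ennreal cover_const * (ennreal C * I)" using Vp by (simp only: mult.left_commute)
      finally show ?thesis using cover_const_pos by (subst (asm) ennreal_mult_le_mult_iff) auto
    qed
    define g where "g z = (LINT w|lborel. indicator ?U w *\<^sub>R (k1 z w * f1 w))" for z
    have gm[measurable]: "g \<in> borel_measurable borel" unfolding g_def by measurable
    have kint: "integrable lborel (\<lambda>w. indicator ?U w *\<^sub>R (k1 z w * f1 w))" and gS: "norm (g z) \<le> enn2real (S z)"
      if "S z < \<infinity>" for z
    proof -
      have S_eq: "(\<integral>\<^sup>+w. ennreal (norm (indicator ?U w *\<^sub>R (k1 z w * f1 w))) \<partial>lborel) = S z"
        unfolding S_def by (intro nn_integral_cong) (auto simp: indicator_def u0_def norm_mult)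
      show i: "integrable lborel (\<lambda>w. indicator ?U w *\<^sub>R (k1 z w * f1 w))"
        by (rule integrableI_bounded) (use that S_eq in \<open>simp_all, measurable\<close>)
      have "ennreal (norm (g z)) \<le> S z"
        using integral_norm_bound_ennreal[OF i] unfolding g_def S_eq .
      then show "norm (g z) \<le> enn2real (S z)"
        using that by (metis enn2real_mono enn2real_ennreal norm_ge_zero infinity_ennreal_def)
    qed
    have gp: "(\<integral>\<^sup>+z. ennreal (norm (g z) powr p) * indicator ?U z \<partial>lborel) \<le> ennreal C * I"
    proof (rule order_trans[OF _ Sp], rule nn_integral_mono_AE, use Sfin in eventually_elim)
      case (elim z)
      show ?case
        using elim p gS[of z] by (auto simp: indicator_def intro!: ennreal_leI powr_mono2)
    qed
    have gnn: "(\<integral>\<^sup>+z. ennreal (norm (g z) powr p) \<partial>lebesgue_on ?U) \<le> ennreal C * I"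
      using gp by (subst nn_integral_lebesgue_on_eq_lborel) auto
    have gml: "g \<in> borel_measurable (lebesgue_on ?U)"
      by (intro measurable_restrict_space1 borel_imp_lebesgue_measurable gm)
    have gi: "integrable (lebesgue_on ?U) (\<lambda>z. norm (g z) powr p)"
    proof (rule integrableI_nonneg)
      show "(\<lambda>z. norm (g z) powr p) \<in> borel_measurable (lebesgue_on ?U)" using gml by measurable
      show "(\<integral>\<^sup>+z. ennreal (norm (g z) powr p) \<partial>lebesgue_on ?U) < \<infinity>"
        by (rule le_less_trans[OF gnn]) (simp add: I_eq ennreal_mult_less_top)
    qed simp
    have "g \<in> Lp p ?U" using gml gi by (simp add: Lp_def)
    moreover have "AE z in lebesgue_on ?U. integral_operator ?U k0 f z = Some (g z)"
    proof (rule AE_lebesgue_onI[OF monomial_set_measurable], use Sfin AE_regular in eventually_elim)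
      case (elim z)
      show ?case
      proof
        assume z: "z \<in> ?U"
        have Sz: "S z < \<infinity>" using elim z by simp
        have ae: "AE w in lebesgue_on ?U. k1 z w * f1 w = k0 z w * f w"
          by (rule AE_lebesgue_onI[OF monomial_set_measurable], use f_eq AE_regular in eventually_elim)
             (use eq z elim in auto)
        have m1: "(\<lambda>w. k1 z w * f1 w) \<in> borel_measurable (lebesgue_on ?U)"
        proof -
          have "(\<lambda>w. k1 z w * f1 w) \<in> borel_measurable borel" by measurable
          then show ?thesis by (intro measurable_restrict_space1 borel_imp_lebesgue_measurable)
        qed
        have mm: "(\<lambda>w. indicator ?U w *\<^sub>R (k1 z w * f1 w)) \<in> borel_measurable borel" by measurable
        have m0: "(\<lambda>w. k0 z w * f w) \<in> borel_measurable (lebesgue_on ?U)"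
        proof -
          have ae': "AE w in lborel. indicator ?U w *\<^sub>R (k1 z w * f1 w) = indicator ?U w *\<^sub>R (k0 z w * f w)"
            using f_eq AE_regular by eventually_elim (use eq z elim in \<open>auto simp: indicator_def\<close>)
          have "(\<lambda>w. indicator ?U w *\<^sub>R (k0 z w * f w)) \<in> borel_measurable lebesgue"
            by (rule borel_measurable_AE[OF borel_imp_lebesgue_measurable[OF mm] AE_completion[OF ae']])
          then show ?thesis using borel_measurable_restrict_space_iff[OF U', of "\<lambda>w. k0 z w * f w"] by simp
        qed
        have i1: "integrable (lebesgue_on ?U) (\<lambda>w. k1 z w * f1 w)"
          using kint[OF Sz] lebesgue_on_eq_lborel(1)[OF monomial_set_measurable mm] by simp
        have "integrable (lebesgue_on ?U) (\<lambda>w. k0 z w * f w)"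
          using i1 integrable_cong_AE[OF m1 m0 ae] by simp
        moreover have "(LINT w|lebesgue_on ?U. k0 z w * f w) = g z"
          using integral_cong_AE[OF m1 m0 ae] lebesgue_on_eq_lborel(2)[OF monomial_set_measurable mm] by (simp add: g_def)
        ultimately show "integral_operator ?U k0 f z = Some (g z)" by (simp add: integral_operator_def)
      qed
    qed
    moreover have "Lp_norm p ?U g \<le> C powr (1 / p) * Lp_norm p ?U f"
    proof -
      have "ennreal (LINT z|lebesgue_on ?U. norm (g z) powr p) \<le> ennreal (C * (LINT z|lebesgue_on ?U. norm (f z) powr p))"
        using gnn C(1) unfolding I_eq by (subst (asm) nn_integral_eq_integral[OF gi]) (auto simp: ennreal_mult')
      then have "(LINT z|lebesgue_on ?U. norm (g z) powr p) \<le> C * (LINT z|lebesgue_on ?U. norm (f z) powr p)"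
        using C(1) by (subst (asm) ennreal_le_iff) (auto intro!: mult_nonneg_nonneg Bochner_Integration.integral_nonneg)
      then have "(LINT z|lebesgue_on ?U. norm (g z) powr p) powr (1 / p) \<le> (C * (LINT z|lebesgue_on ?U. norm (f z) powr p)) powr (1 / p)"
        using p by (intro powr_mono2 Bochner_Integration.integral_nonneg) auto
      also have "\<dots> = C powr (1 / p) * (LINT z|lebesgue_on ?U. norm (f z) powr p) powr (1 / p)"
        using C(1) by (intro powr_mult)
      finally show ?thesis by (simp add: Lp_norm_def)
    qed
    ultimately show ?thesis by (intro bexI[of _ g] conjI)
  qed
  then show ?thesis unfolding strong_type_def by (intro exI[of _ "C powr (1 / p)"] ballI)
qed

end

context monomial_cover
begin

lemma lifted_kernel_joint_measurable: "(\<lambda>(z, w). lifted_kernel (psi z) (psi w)) \<in> borel_measurable (borel \<Otimes>\<^sub>M borel)"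
  unfolding lifted_kernel_def deck_kernel_def by measurable

theorem bergman_operators_strong_type:
  assumes op: "open (monomial_set B)" and p: "p > 1"
    and d: "\<And>j. real (jac_exponent j) * (2 - p) < 2 * (p - 1)" "\<And>j. real (jac_exponent j) * (p - 2) < 2"
  shows "strong_type p (monomial_set B) (positive_bergman_operator (monomial_set B))"
    and "strong_type p (monomial_set B) (bergman_projection (monomial_set B))"
proof -
  note [measurable] = lifted_kernel_joint_measurable
  show "strong_type p (monomial_set B) (positive_bergman_operator (monomial_set B))"
    unfolding positive_bergman_operator_def
  proof (rule strong_type_of_dominated[OF op p d])
    show "complex_of_real (norm (bergman_kernel (monomial_set B) z w)) = of_real (norm (lifted_kernel (psi z) (psi w)))"
      if "z \<in> monomial_set B \<inter> regular" "w \<in> monomial_set B \<inter> regular" for z w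
      using bergman_kernel_formula[OF op] that by auto
    show "(\<lambda>(z, w). complex_of_real (norm (lifted_kernel (psi z) (psi w)))) \<in> borel_measurable (borel \<Otimes>\<^sub>M borel)"
      using lifted_kernel_joint_measurable unfolding case_prod_unfold by measurable
  qed simp
  show "strong_type p (monomial_set B) (bergman_projection (monomial_set B))"
    unfolding bergman_projection_def
  proof (rule strong_type_of_dominated[OF op p d])
    show "bergman_kernel (monomial_set B) z w = lifted_kernel (psi z) (psi w)"
      if "z \<in> monomial_set B \<inter> regular" "w \<in> monomial_set B \<inter> regular" for z w
      using bergman_kernel_formula[OF op] that by auto
    show "(\<lambda>(z, w). lifted_kernel (psi z) (psi w)) \<in> borel_measurable (borel \<Otimes>\<^sub>M borel)"
      by (rule lifted_kernel_joint_measurable)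
  qed simp
qed

end

section \<open>Reduced columns and the range of exponents\<close>

lemma open_nonempty_meets_regular:
  fixes S :: "(complex ^ 'n::finite) set"
  assumes "open S" "S \<noteq> {}"
  obtains z where "z \<in> S" "z \<in> regular"
proof -
  have "S \<inter> regular \<noteq> {}"
  proof
    assume "S \<inter> regular = {}"
    then have "AE z in lborel. z \<notin> S" using AE_regular by (auto elim!: eventually_mono)
    then have "S \<in> null_sets lborel" using assms by (subst (asm) AE_iff_null_sets[symmetric]) auto
    then have "negligible S" by (simp add: negligible_iff_null_sets null_sets_completionI)
    then show False using open_not_negligible assms by blast
  qed
  then show thesis using that by blast
qed

lemma mult_adjugate_component:
  fixes B :: "int ^ 'n ^ 'n::finite"
  shows "(\<Sum>k\<in>UNIV. B $ j $ k * adjugate B $ k $ l) = (if j = l then det B else 0)"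
  using arg_cong[OF matrix_mult_adjugate[of B], of "\<lambda>M. M $ j $ l"]
  by (simp add: matrix_matrix_mult_def mat_def)

text \<open>Multiplying the moduli of a point by \<open>t powi \<Delta>\<^sub>i\<^sub>j\<close> with \<open>0 < t \<le> 1\<close> multiplies the \<open>j\<close>-th defining monomial by a
power of \<open>t\<close> with exponent \<open>det B\<close> and fixes the others, so it does not leave the set. A negative exponent would make the set unbounded.\<close>

lemma adjugate_nonneg:
  fixes B :: "int ^ 'n ^ 'n::finite"
  assumes U: "open (monomial_set B)" "monomial_set B \<noteq> {}" "bounded (monomial_set B)" and det: "det B > 0"
  shows "adjugate B $ k $ j \<ge> 0"
proof (rule ccontr)
  assume neg: "\<not> ?thesis"
  obtain z where z: "z \<in> monomial_set B" "z \<in> regular" using open_nonempty_meets_regular[OF U(1,2)] by blast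
  obtain M where M: "\<And>w. w \<in> monomial_set B \<Longrightarrow> norm w \<le> M" using U(3) unfolding bounded_iff by blast
  have M0: "M \<ge> 0" by (rule order_trans[OF norm_ge_zero M[OF z(1)]])
  have zk: "norm (z $ k) > 0" using z(2) by (simp add: regular_def)
  \<comment> \<open>Chosen such that \<open>norm (z $ k) / t\<close> exceeds the bound \<open>M\<close>.\<close>
  define t where "t = norm (z $ k) / (norm (z $ k) + M + 1)"
  have den: "norm (z $ k) + M + 1 > 0" using zk M0 by linarith
  have t: "0 < t" "t \<le> 1" using zk M0 den by (auto simp: t_def)
  define w where "w = (\<chi> i. z $ i * of_real (t powi (adjugate B $ i $ j)))"
  have nw: "norm (w $ i) = norm (z $ i) * t powi (adjugate B $ i $ j)" for i
    using t by (simp add: w_def norm_mult norm_power_int)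
  have wreg: "w $ i \<noteq> 0" for i using z(2) t by (simp add: w_def regular_def)
  have "w \<in> monomial_set B"
    unfolding monomial_set_def
  proof (intro CollectI conjI allI impI)
    fix l
    have "(\<Prod>i\<in>UNIV. norm (w $ i) powi (B $ l $ i))
       = (\<Prod>i\<in>UNIV. norm (z $ i) powi (B $ l $ i)) * (\<Prod>i\<in>UNIV. t powi (B $ l $ i * adjugate B $ i $ j))"
    proof -
      have "norm (w $ i) powi (B $ l $ i) = norm (z $ i) powi (B $ l $ i) * t powi (B $ l $ i * adjugate B $ i $ j)" for i
        unfolding nw power_int_mult_distrib power_int_mult[symmetric] by (simp add: mult.commute)
      then show ?thesis by (simp add: prod.distrib)
    qed
    also have "(\<Prod>i\<in>UNIV. t powi (B $ l $ i * adjugate B $ i $ j)) = t powi (if l = j then det B else 0)"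
      using t by (simp add: powi_sum[symmetric] mult_adjugate_component)
    also have "(\<Prod>i\<in>UNIV. norm (z $ i) powi (B $ l $ i)) * \<dots> \<le> (\<Prod>i\<in>UNIV. norm (z $ i) powi (B $ l $ i)) * 1"
    proof (rule mult_left_mono)
      show "t powi (if l = j then det B else 0) \<le> 1"
        using t det by (simp add: power_int_def power_le_one)
      show "0 \<le> (\<Prod>i\<in>UNIV. norm (z $ i) powi (B $ l $ i))" by (intro prod_nonneg) simp
    qed
    also have "\<dots> < 1" using z(1) by (simp add: monomial_set_def)
    finally show "(\<Prod>i\<in>UNIV. norm (w $ i) powi (B $ l $ i)) < 1" .
  qed (use wreg in simp)
  then have "norm w \<le> M" by (rule M)
  moreover have "norm (w $ k) \<le> norm w" by (rule Finite_Cartesian_Product.norm_nth_le)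
  moreover have "norm (w $ k) > M"
  proof -
    define n where "n = nat (- adjugate B $ k $ j)"
    have n: "n \<ge> 1" using neg by (simp add: n_def)
    have "inverse t \<le> inverse (t ^ n)"
      using t n power_decreasing[of 1 n t] by (intro le_imp_inverse_le) auto
    also have "inverse (t ^ n) = t powi (adjugate B $ k $ j)"
      using neg by (simp add: power_int_def n_def power_inverse)
    finally have "norm (z $ k) * inverse t \<le> norm (w $ k)"
      unfolding nw using zk by (intro mult_left_mono) auto
    moreover have "norm (z $ k) * inverse t = norm (z $ k) + M + 1"
      using zk by (simp add: t_def)
    ultimately show ?thesis using zk by linarith
  qed
  ultimately show False by linarith
qed

lemma reduced_column_mult:
  fixes B :: "int ^ 'n ^ 'n::finite"
  assumes det: "det B \<noteq> 0"
  obtains g where "g > 0" "\<And>k. adjugate B $ k $ j = g * reduced_column B j $ k"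
proof -
  define g where "g = Gcd (range (\<lambda>k. column j (adjugate B) $ k))"
  have dvd: "g dvd adjugate B $ k $ j" for k
    unfolding g_def by (rule Gcd_dvd) (auto simp: column_def)
  have "g \<noteq> 0"
  proof
    assume "g = 0"
    then have "adjugate B $ k $ j = 0" for k using dvd[of k] by simp
    then have "(\<Sum>k\<in>UNIV. B $ j $ k * adjugate B $ k $ j) = 0" by simp
    then show False using mult_adjugate_component[of B j j] det by simp
  qed
  moreover have "g \<ge> 0" unfolding g_def by simp
  ultimately have "g > 0" by simp
  moreover have "adjugate B $ k $ j = g * reduced_column B j $ k" for k
    using dvd[of k] by (simp add: reduced_column_def Let_def g_def column_def)
  ultimately show thesis by (rule that)
qed

lemma reduced_columns_cover:
  fixes B :: "int ^ 'n ^ 'n::finite"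
  assumes U: "open (monomial_set B)" "monomial_set B \<noteq> {}" "bounded (monomial_set B)" and det: "det B > 0"
  obtains m where "monomial_cover B (\<lambda>k j. nat (reduced_column B j $ k)) m"
    "\<And>j k. reduced_column B j $ k \<ge> 0"
proof -
  have nonneg: "reduced_column B j $ k \<ge> 0" for j k
  proof -
    obtain g where g: "g > 0" "\<And>k. adjugate B $ k $ j = g * reduced_column B j $ k"
      using reduced_column_mult[of B j] det by auto
    have "g * reduced_column B j $ k \<ge> 0" using adjugate_nonneg[OF U det, of k j] g(2) by simp
    then show ?thesis using g(1) by (simp add: zero_le_mult_iff)
  qed
  have sum: "\<exists>g>0. g * (\<Sum>k\<in>UNIV. B $ j $ k * reduced_column B l $ k) = (if j = l then det B else 0)" for j l
  proof -
    obtain g where g: "g > 0" "\<And>k. adjugate B $ k $ l = g * reduced_column B l $ k"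
      using reduced_column_mult[of B l] det by auto
    have "g * (\<Sum>k\<in>UNIV. B $ j $ k * reduced_column B l $ k) = (\<Sum>k\<in>UNIV. B $ j $ k * adjugate B $ k $ l)"
      unfolding g(2) sum_distrib_left by (intro sum.cong refl) simp
    then show ?thesis using g(1) mult_adjugate_component[of B j l] by auto
  qed
  define s where "s j = (\<Sum>k\<in>UNIV. B $ j $ k * reduced_column B j $ k)" for j
  have s_pos: "s j > 0" for j
  proof -
    obtain g where "g > 0" "g * s j = det B" using sum[of j j] unfolding s_def by auto
    then show ?thesis using det by (metis zero_less_mult_pos)
  qed
  have off: "(\<Sum>k\<in>UNIV. B $ j $ k * reduced_column B l $ k) = 0" if "j \<noteq> l" for j l
    using sum[of j l] that by auto
  have "monomial_cover B (\<lambda>k j. nat (reduced_column B j $ k)) (\<lambda>j. nat (s j))"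
  proof
    show "nat (s j) > 0" for j using s_pos by simp
    show "(\<Sum>k\<in>UNIV. B $ j $ k * int (nat (reduced_column B l $ k))) = (if j = l then int (nat (s j)) else 0)" for j l
      using nonneg less_imp_le[OF s_pos[of l]] off[of j l] by (auto simp: s_def)
  qed
  then show thesis using nonneg by (rule that)
qed

text \<open>The upper bound \<open>p < P / (P - 1)\<close> is used in the form \<open>(p - 1) (P - 1) < 1\<close>, which is monotone in \<open>P\<close>. If \<open>P = 1\<close> then
\<open>hoelder_conjugate\<close> has the value 0 and no \<open>p\<close> qualifies.\<close>

lemma p_star_bounds:
  fixes B :: "int ^ 'n ^ 'n::finite"
  assumes s: "\<And>j. entry_sum (reduced_column B j) \<ge> 1"
    and p: "p_star B < p" "p < hoelder_conjugate (p_star B)"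
  shows "p > 1"
    and "(real_of_int (entry_sum (reduced_column B j)) - 1) * (2 - p) < 2 * (p - 1)"
    and "(real_of_int (entry_sum (reduced_column B j)) - 1) * (p - 2) < 2"
proof -
  define P where "P = p_star B"
  define x where "x i = real_of_int (entry_sum (reduced_column B i))" for i
  have x: "x i \<ge> 1" for i using s[of i] by (simp add: x_def)
  have P_ge: "2 * x i / (x i + 1) \<le> P" for i
    unfolding P_def p_star_def x_def by (rule Max_ge) auto
  have "1 \<le> 2 * x j / (x j + 1)" using x[of j] by (simp add: field_simps)
  then have P1: "P \<ge> 1" using P_ge[of j] by linarith
  then show p1: "p > 1" using p(1) by (simp add: P_def)
  have "P \<noteq> 1"
  proof
    assume "P = 1"
    then show False using p(2) p1 by (simp add: hoelder_conjugate_def P_def)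
  qed
  then have P2: "P > 1" using P1 by simp
  have lt: "2 * x j / (x j + 1) < p" using P_ge[of j] p(1) by (simp add: P_def)
  then have "2 * x j < p * (x j + 1)" using x[of j] by (simp add: pos_divide_less_eq)
  then show "(real_of_int (entry_sum (reduced_column B j)) - 1) * (2 - p) < 2 * (p - 1)"
    unfolding x_def[symmetric] by (simp add: algebra_simps)
  have "p * (P - 1) < P" using p(2) P2 by (simp add: hoelder_conjugate_def P_def[symmetric] pos_less_divide_eq)
  then have a: "(p - 1) * (P - 1) < 1" by (simp add: algebra_simps)
  have "2 * x j / (x j + 1) - 1 = (x j - 1) / (x j + 1)" using x[of j] by (simp add: field_simps)
  then have "(x j - 1) / (x j + 1) \<le> P - 1" using P_ge[of j] by linarith
  then have "(p - 1) * ((x j - 1) / (x j + 1)) \<le> (p - 1) * (P - 1)" using p1 by (intro mult_left_mono) auto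
  then have "(p - 1) * (x j - 1) / (x j + 1) < 1" using a by simp
  then have "(p - 1) * (x j - 1) < x j + 1" using x[of j] by (simp add: pos_divide_less_eq)
  then show "(real_of_int (entry_sum (reduced_column B j)) - 1) * (p - 2) < 2"
    unfolding x_def[symmetric] by (simp add: algebra_simps)
qed

theorem corollary1p6:
  fixes B :: "int ^ 'n ^ 'n::finite" and p :: real
  assumes "CARD('n) \<ge> 2"
    and "monomial_polyhedron B"
    and "monomial_set B \<noteq> unit_polydisc"
    and "det B > 0"
    and "p_star B < p" and "p < hoelder_conjugate (p_star B)"
  shows "strong_type p (monomial_set B) (positive_bergman_operator (monomial_set B)) \<and>
         strong_type p (monomial_set B) (bergman_projection (monomial_set B))"
proof -
  have U: "open (monomial_set B)" "monomial_set B \<noteq> {}" "bounded (monomial_set B)"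
    using assms(2) by (auto simp: monomial_polyhedron_def)
  obtain m where cover: "monomial_cover B (\<lambda>k j. nat (reduced_column B j $ k)) m"
    and nonneg: "\<And>j k. reduced_column B j $ k \<ge> 0"
    using reduced_columns_cover[OF U assms(4)] by blast
  interpret monomial_cover B "\<lambda>k j. nat (reduced_column B j $ k)" m by (rule cover)
  have sum: "entry_sum (reduced_column B j) = int (\<Sum>k\<in>UNIV. nat (reduced_column B j $ k))" for j
    using nonneg by (simp add: entry_sum_def)
  have s1: "entry_sum (reduced_column B j) \<ge> 1" for j
    unfolding sum using col_sum[of j] by linarith
  have e_eq: "real (jac_exponent j) = real_of_int (entry_sum (reduced_column B j)) - 1" for j
    unfolding sum jac_exponent_def using col_sum[of j] by (simp add: of_nat_diff del: of_nat_sum)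
  note bounds = p_star_bounds[OF s1 assms(5,6)]
  show ?thesis
    using bergman_operators_strong_type[OF U(1) bounds(1), unfolded e_eq, OF bounds(2,3)] by (rule conjI)
qed

end
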